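(* Let $\rho:\mathbb{N}\to\mathbb{N}$ be an unbounded non-decreasing function. There is a finitely generated group $G$ such that $1\not\simeq\mathrm{sep}_G(n)$ and $\mathrm{sep}_G(n)\not\gtrsim\rho(n)$.
   Context: For a finite graph $\Gamma$, $|\Gamma|$ denotes its number of vertices. A subset $S$ of the vertex set $V\Gamma$ is a cut-set of $\Gamma$ if $\Gamma-S$ (the graph obtained by deleting the vertices in $S$ and all edges incident to them) has no connected component with more than $|\Gamma|/2$ vertices. The cut-size $\mathrm{cut}(\Gamma)$ is the minimal cardinality of a cut-set of $\Gamma$. The separation profile of a graph $X$ is $\mathrm{sep}_X(n)=\max\{\mathrm{cut}(\Gamma) : \Gamma\subset X \text{ a finite subgraph},\ |\Gamma|\le n\}$. For a finitely generated group $G$, $\mathrm{sep}_G$ denotes the separation profile of a Cayley graph of $G$ with respect to a finite generating set; up to the equivalence $\simeq$ below it does not depend on the choice. For functions $f,g$, $f\lesssim g$ (equivalently $g\gtrsim f$) means that there is a constant $C>0$ such that $f(n)\le C g(Cn+C)+C$ for all $n$ (with $C$ taken to be an integer if needed for $g$ to be defined at $Cn+C$); $f\simeq g$ means $f\lesssim g$ and $g\lesssim f$; $1$ denotes the constant function. *)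

theory Defs
  imports "HOL-Algebra.Generated_Groups" "Graph_Theory.Pair_Digraph" "Graph_Theory.Digraph_Component"
begin

text \<open>
  Graphs are simple and undirected: a finite one is a \<^locale>\<open>pair_graph\<close>, a possibly infinite one a
  \<^locale>\<open>pair_bidirected_digraph\<close>, in both cases a symmetric irreflexive set of arcs on a set of
  vertices. In such a graph the strongly connected components (\<^const>\<open>pre_digraph.sccs\<close>) are the
  connected components; they are nonempty by definition.
\<close>

definition is_cut_set :: "'a pair_pre_digraph \<Rightarrow> 'a set \<Rightarrow> bool" where
  "is_cut_set \<Gamma> S \<longleftrightarrow> S \<subseteq> pverts \<Gamma> \<and>
     (\<forall>c \<in> pre_digraph.sccs (with_proj \<Gamma> \<restriction> (pverts \<Gamma> - S)).
        \<not> real (card (verts c)) > real (card (pverts \<Gamma>)) / 2)"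

definition cut_size :: "'a pair_pre_digraph \<Rightarrow> nat" where
  "cut_size \<Gamma> = Min (card ` {S. is_cut_set \<Gamma> S})"

definition sep :: "'a pair_pre_digraph \<Rightarrow> nat \<Rightarrow> nat" where
  "sep X n = Max (cut_size ` {\<Gamma>. pair_graph \<Gamma> \<and> subgraph (with_proj \<Gamma>) (with_proj X) \<and> card (pverts \<Gamma>) \<le> n})"

text \<open>
  The minimum and the maximum above are taken over finite nonempty sets, see
  \<open>finite_cut_cards\<close>, \<open>cut_cards_nonempty\<close>, \<open>finite_sep_cuts\<close> and \<open>sep_cuts_nonempty\<close> below; the null
  graph counts as a finite subgraph, so this also covers \<open>n = 0\<close>.
\<close>

definition finite_generating_set :: "('a, 'b) monoid_scheme \<Rightarrow> 'a set \<Rightarrow> bool" where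
  "finite_generating_set G S \<longleftrightarrow> finite S \<and> S \<subseteq> carrier G \<and> generate G S = carrier G"

definition finitely_generated_group :: "('a, 'b) monoid_scheme \<Rightarrow> bool" where
  "finitely_generated_group G \<longleftrightarrow> group G \<and> (\<exists>S. finite_generating_set G S)"

text \<open>Generating sets need not be symmetric and may contain the identity, which produces no loop.\<close>

definition cayley_graph :: "('a, 'b) monoid_scheme \<Rightarrow> 'a set \<Rightarrow> 'a pair_pre_digraph" where
  "cayley_graph G S =
     \<lparr> pverts = carrier G,
       parcs = {(g, h). g \<in> carrier G \<and> h \<in> carrier G \<and> g \<noteq> h \<and>
                        (\<exists>s\<in>S. h = g \<otimes>\<^bsub>G\<^esub> s \<or> g = h \<otimes>\<^bsub>G\<^esub> s)} \<rparr>"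

definition growth_le :: "(nat \<Rightarrow> nat) \<Rightarrow> (nat \<Rightarrow> nat) \<Rightarrow> bool" where
  "growth_le f g \<longleftrightarrow> (\<exists>C>0. \<forall>n. f n \<le> C * g (C * n + C) + C)"

definition growth_equiv :: "(nat \<Rightarrow> nat) \<Rightarrow> (nat \<Rightarrow> nat) \<Rightarrow> bool" where
  "growth_equiv f g \<longleftrightarrow> growth_le f g \<and> growth_le g f"

lemma cayley_graph_bidirected: "pair_bidirected_digraph (cayley_graph G S)"
  by unfold_locales (auto simp: cayley_graph_def symmetric_def sym_def)

lemma is_cut_set_verts: "is_cut_set \<Gamma> (pverts \<Gamma>)"
  by (auto simp: is_cut_set_def pre_digraph.sccs_def strongly_connected_def
        induced_subgraph_def subgraph_def)

lemma finite_cut_cards: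
  assumes "finite (pverts \<Gamma>)"
  shows "finite (card ` {S. is_cut_set \<Gamma> S})"
proof -
  have "{S. is_cut_set \<Gamma> S} \<subseteq> Pow (pverts \<Gamma>)"
    by (auto simp: is_cut_set_def)
  then show ?thesis
    using assms by (meson finite_Pow_iff finite_imageI finite_subset)
qed

lemma cut_cards_nonempty: "card ` {S. is_cut_set \<Gamma> S} \<noteq> {}"
  using is_cut_set_verts by blast

lemma cut_size_le_card:
  assumes "finite (pverts \<Gamma>)"
  shows "cut_size \<Gamma> \<le> card (pverts \<Gamma>)"
  unfolding cut_size_def
  by (rule Min_le) (use assms finite_cut_cards is_cut_set_verts in auto)

lemma finite_sep_cuts:
  "finite (cut_size ` {\<Gamma>. pair_graph \<Gamma> \<and> subgraph (with_proj \<Gamma>) (with_proj X) \<and> card (pverts \<Gamma>) \<le> n})"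
proof (rule finite_subset)
  show "cut_size ` {\<Gamma>. pair_graph \<Gamma> \<and> subgraph (with_proj \<Gamma>) (with_proj X) \<and> card (pverts \<Gamma>) \<le> n} \<subseteq> {..n}"
  proof (clarsimp)
    fix \<Gamma> :: "'a pair_pre_digraph"
    assume "pair_graph \<Gamma>" and n: "card (pverts \<Gamma>) \<le> n"
    then interpret pair_graph \<Gamma> by simp
    show "cut_size \<Gamma> \<le> n"
      using cut_size_le_card[OF pair_finite_verts] n by linarith
  qed
qed simp

lemma sep_cuts_nonempty:
  assumes "pair_wf_digraph X"
  shows "cut_size ` {\<Gamma>. pair_graph \<Gamma> \<and> subgraph (with_proj \<Gamma>) (with_proj X) \<and> card (pverts \<Gamma>) \<le> n} \<noteq> {}"
proof -
  let ?N = "\<lparr> pverts = {}, parcs = {} \<rparr> :: 'a pair_pre_digraph"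
  have N: "pair_graph ?N"
    by unfold_locales (auto simp: symmetric_def sym_def)
  have "wf_digraph (with_proj ?N)"
    by unfold_locales auto
  then have "subgraph (with_proj ?N) (with_proj X)"
    using assms by (auto simp: subgraph_def compatible_def wf_digraph_wp_iff)
  then show ?thesis
    using N by (auto intro!: exI[of _ ?N])
qed

end

theory Submission
  imports Defs "HOL-Combinatorics.Permutations" "HOL-Library.Countable"
begin

text \<open>
  The group is generated by two elements \<open>a\<close> and \<open>t\<close>. Put \<open>a\<^sub>i = t\<^sup>i a t\<^sup>-\<^sup>i\<close> and
  \<open>H\<^sub>k = \<langle>a\<^sub>0, \<dots>, a\<^sub>k\<rangle>\<close>. Every \<open>H\<^sub>k\<close> is finite, and conjugation by \<open>t\<close> carries
  \<open>\<langle>a\<^sub>0, \<dots>, a\<^sub>k\<^sub>-\<^sub>1\<rangle>\<close> onto \<open>\<langle>a\<^sub>1, \<dots>, a\<^sub>k\<rangle>\<close>, so the group is a quotient of the HNN extension of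
  \<open>H\<^sub>k\<close> along this isomorphism, which is virtually free. The point of the construction is that
  relations beyond those of this HNN extension appear only in words with more than \<open>R\<^sub>k\<close> letters
  \<open>t\<close>, where \<open>R\<^sub>k\<close> may be chosen after \<open>H\<^sub>k\<close> is known. Thus the group is a limit of virtually free
  groups, and on the scale \<open>R\<^sub>k\<close> it is as poorly connected as a tree.

  \<^emph>\<open>Upper bound.\<close> Join the coset \<open>g H\<^sub>k\<close> to \<open>g t H\<^sub>k\<close>. Up to length \<open>R\<^sub>k\<close> this graph has no
  cycles, so a component of a finite subgraph that is small compared with \<open>R\<^sub>k\<close> maps to a tree. The
  fibre over a vertex that balances the tree, thickened by the word length of the generators, is a
  cut set, and its size is bounded in terms of \<open>|H\<^sub>k|\<close> and that length only
  (\<open>balanced_vertex\<close>, \<open>no_short_cycle\<close>, \<open>sep_upper_bound\<close>). If \<open>R\<^sub>k\<close> is large enough compared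
  with \<open>|H\<^sub>k|\<close> and \<open>\<rho>\<close>, this contradicts \<open>\<rho> \<lesssim> sep\<close>.

  \<^emph>\<open>Lower bound.\<close> Suppose that all finite subgraphs have cut sets of size at most \<open>B\<close>. Cutting a
  finite set repeatedly until all pieces have at most \<open>m\<close> elements adds only about \<open>B / m\<close> times its
  size to the boundary. Since \<open>a\<^sub>n \<notin> H\<^sub>n\<^sub>-\<^sub>1\<close>, the group has exponential growth, so a set of at most
  \<open>m\<close> elements has a boundary of relative size at least of order \<open>1 / log m\<close>. For large \<open>m\<close> the
  second effect wins, and all finite sets satisfy a linear isoperimetric inequality
  (\<open>isoperimetry_from_bounded_sep\<close>). But the group is amenable: the sets
  \<open>{h t\<^sup>j | h \<in> H\<^sub>n, 0 \<le> j \<le> n}\<close> are Foelner sets. Hence the separation profile is unbounded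
  for every finite generating set (\<open>sep_unbounded\<close>).

  \<^emph>\<open>Construction.\<close> The group consists of permutations of the natural numbers, built on a growing
  sequence of finite invariant initial segments. The segments up to stage \<open>k\<close> determine a finite
  group \<open>H\<^sub>k\<close>. A free group acts on a finite set such that every nonempty reduced word of length
  at most \<open>R\<^sub>k\<close> moves a point. The product of such a set with \<open>H\<^sub>k\<close> carries an action of the HNN
  extension of \<open>H\<^sub>k\<close>; it is appended as the next segment. All relations of \<open>H\<^sub>k\<close> hold in it, so \<open>H\<^sub>k\<close>
  keeps its order forever, while every reduced word of the HNN extension with at most \<open>R\<^sub>k\<close> letters
  \<open>t\<close>, and at least one, is seen to lie outside \<open>H\<^sub>k\<close> (\<open>finite_hnn_action\<close>, \<open>tower_exists\<close>).
\<close>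

section \<open>Cut sets and reachability\<close>

text \<open>
  Components of an undirected graph are the reachability classes of its arcs; all later arguments
  about cut sets use this form.
\<close>

lemma is_cut_set_iff:
  assumes "pair_graph \<Gamma>"
  shows "is_cut_set \<Gamma> S \<longleftrightarrow> S \<subseteq> pverts \<Gamma> \<and>
    (\<forall>x \<in> pverts \<Gamma> - S. 2 * card ((Restr (parcs \<Gamma>) (pverts \<Gamma> - S))\<^sup>* `` {x}) \<le> card (pverts \<Gamma>))"
proof -
  interpret pair_graph \<Gamma> by fact
  define W where "W = pverts \<Gamma> - S"
  define H where "H = with_proj \<Gamma> \<restriction> W"
  define R where "R = Restr (parcs \<Gamma>) W"
  have vH: "verts H = W" by (simp add: H_def)
  have ends: "arcs_ends H = R"
    unfolding arcs_ends_def H_def R_def induce_subgraph_def arc_to_ends_def with_proj_def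
    by force
  interpret H: wf_digraph H
    unfolding H_def by (rule wellformed_induce_subgraph)
  have symR: "sym R"
    unfolding R_def sym_def using arcs_symmetric by blast
  have reach: "x \<rightarrow>\<^sup>*\<^bsub>H\<^esub> y \<longleftrightarrow> (x, y) \<in> R\<^sup>*" if "x \<in> W" for x y
  proof -
    have "(x, y) \<in> R\<^sup>* \<Longrightarrow> (x, y) \<in> rtrancl_on W R"
      by (induction rule: rtrancl_induct) (use that in \<open>auto simp: R_def intro: rtrancl_on_into_rtrancl_on\<close>)
    moreover have "(x, y) \<in> rtrancl_on W R \<Longrightarrow> (x, y) \<in> R\<^sup>*"
      by (induction rule: rtrancl_on.induct) auto
    ultimately show ?thesis
      by (auto simp: reachable_def vH ends)
  qed
  have scc: "H.scc_of x = R\<^sup>* `` {x}" if "x \<in> W" for x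
  proof -
    have "y \<in> W \<and> y \<rightarrow>\<^sup>*\<^bsub>H\<^esub> x" if "(x, y) \<in> R\<^sup>*" for y
    proof -
      have "y \<in> W" using that \<open>x \<in> W\<close> by (induction) (auto simp: R_def)
      moreover have "(y, x) \<in> R\<^sup>*" using that symR by (meson sym_rtrancl symD)
      ultimately show ?thesis using reach by auto
    qed
    then show ?thesis using that reach by (auto simp: H.scc_of_def)
  qed
  have "verts ` H.sccs = (\<lambda>x. R\<^sup>* `` {x}) ` W"
    unfolding H.sccs_verts_conv[symmetric] H.sccs_verts_conv_scc_of vH using scc by simp
  moreover have "(\<forall>c \<in> H.sccs. 2 * card (verts c) \<le> card (pverts \<Gamma>)) \<longleftrightarrow>
      (\<forall>v \<in> verts ` H.sccs. 2 * card v \<le> card (pverts \<Gamma>))"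
    by simp
  ultimately have "(\<forall>c \<in> H.sccs. 2 * card (verts c) \<le> card (pverts \<Gamma>)) \<longleftrightarrow>
      (\<forall>x \<in> W. 2 * card (R\<^sup>* `` {x}) \<le> card (pverts \<Gamma>))"
    by simp
  moreover have "\<not> real a > real b / 2 \<longleftrightarrow> 2 * a \<le> b" for a b :: nat
    by linarith
  ultimately show ?thesis
    by (simp add: is_cut_set_def W_def R_def H_def)
qed

lemma cut_size_le_card_cut_set:
  assumes "pair_graph \<Gamma>" "is_cut_set \<Gamma> S"
  shows "cut_size \<Gamma> \<le> card S"
proof -
  interpret pair_graph \<Gamma> by fact
  show ?thesis
    unfolding cut_size_def using assms(2) by (intro Min_le finite_cut_cards pair_finite_verts) auto
qed

lemma cut_size_attained:
  assumes "pair_graph \<Gamma>"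
  obtains S where "is_cut_set \<Gamma> S" "card S = cut_size \<Gamma>"
proof -
  interpret pair_graph \<Gamma> by fact
  have "cut_size \<Gamma> \<in> card ` {S. is_cut_set \<Gamma> S}"
    unfolding cut_size_def by (intro Min_in finite_cut_cards cut_cards_nonempty pair_finite_verts)
  with that show thesis by auto
qed

lemma cut_size_le_sep:
  assumes "pair_graph \<Gamma>" "subgraph (with_proj \<Gamma>) (with_proj X)" "card (pverts \<Gamma>) \<le> n"
  shows "cut_size \<Gamma> \<le> sep X n"
  unfolding sep_def by (rule Max_ge) (use assms finite_sep_cuts in auto)

lemma sep_le:
  assumes "pair_wf_digraph X"
    and "\<And>\<Gamma>. pair_graph \<Gamma> \<Longrightarrow> subgraph (with_proj \<Gamma>) (with_proj X) \<Longrightarrow> card (pverts \<Gamma>) \<le> n \<Longrightarrow>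
      cut_size \<Gamma> \<le> b"
  shows "sep X n \<le> b"
  unfolding sep_def
  by (rule Max.boundedI) (use assms finite_sep_cuts sep_cuts_nonempty in auto)

section \<open>Balanced vertices in graphs without short cycles\<close>

text \<open>
  The closed walks that are excluded start at the root and do not backtrack anywhere else. This makes the ball of radius \<open>D\<close> a tree.
\<close>

locale tree_ball =
  fixes A :: "('b \<times> 'b) set" and r :: 'b and D :: nat
  assumes sym: "sym A"
    and no_cycle: "\<And>s p. 1 \<le> s \<Longrightarrow> s \<le> 2 * D + 1 \<Longrightarrow> p 0 = r \<Longrightarrow>
      (\<forall>i<s. (p i, p (Suc i)) \<in> A) \<Longrightarrow> (\<forall>i. Suc (Suc i) \<le> s \<longrightarrow> p i \<noteq> p (Suc (Suc i))) \<Longrightarrow> p s \<noteq> r"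
begin

definition reached :: "'b \<Rightarrow> bool" where
  "reached v \<longleftrightarrow> (r, v) \<in> A\<^sup>*"

definition dist :: "'b \<Rightarrow> nat" where
  "dist v = (LEAST n. (r, v) \<in> A ^^ n)"

definition parent :: "'b \<Rightarrow> 'b" where
  "parent v = (SOME u. (u, v) \<in> A \<and> reached u \<and> Suc (dist u) = dist v)"

lemma dist_relpow: "reached v \<Longrightarrow> (r, v) \<in> A ^^ dist v"
  unfolding dist_def reached_def by (metis LeastI_ex rtrancl_imp_relpow)

lemma dist_le: "(r, v) \<in> A ^^ n \<Longrightarrow> dist v \<le> n"
  unfolding dist_def by (rule Least_le)

lemma reached_relpow: "(r, v) \<in> A ^^ n \<Longrightarrow> reached v"
  unfolding reached_def by (rule relpow_imp_rtrancl)

lemma dist_root: "dist r = 0" "reached r"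
  using dist_le[of r 0] by (auto simp: reached_def)

lemma dist_0: "reached v \<Longrightarrow> dist v = 0 \<Longrightarrow> v = r"
  using dist_relpow by fastforce

lemma step:
  assumes "reached u" "(u, v) \<in> A"
  shows "reached v" "dist v \<le> Suc (dist u)"
proof -
  have "(r, v) \<in> A ^^ Suc (dist u)"
    using dist_relpow[OF assms(1)] assms(2) by auto
  then show "reached v" "dist v \<le> Suc (dist u)"
    using dist_le reached_relpow by blast+
qed

lemma geodesic:
  assumes "reached v"
  obtains p where "p 0 = r" "p (dist v) = v" "\<And>i. i < dist v \<Longrightarrow> (p i, p (Suc i)) \<in> A"
    "\<And>i. i \<le> dist v \<Longrightarrow> dist (p i) = i"
proof -
  obtain p where p: "p 0 = r" "p (dist v) = v" "\<forall>i<dist v. (p i, p (Suc i)) \<in> A"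
    using dist_relpow[OF assms] by (auto simp: relpow_fun_conv)
  have "dist (p i) = i" if i: "i \<le> dist v" for i
  proof -
    have ri: "(r, p i) \<in> A ^^ i"
      using p i by (auto simp: relpow_fun_conv intro!: exI[of _ p])
    have iv: "(p i, v) \<in> A ^^ (dist v - i)"
      using p i by (auto simp: relpow_fun_conv intro!: exI[of _ "\<lambda>j. p (i + j)"])
    have "(r, p i) \<in> A ^^ dist (p i)"
      by (rule dist_relpow) (rule reached_relpow[OF ri])
    with iv have "(r, v) \<in> A ^^ (dist (p i) + (dist v - i))"
      unfolding relpow_add by blast
    from dist_le[OF this] dist_le[OF ri] i show ?thesis by linarith
  qed
  with p that show thesis by blast
qed

text \<open>
  If two neighbours were equally far from the root, geodesics to both of them and the edge between
  them would close up to a walk without backtracking.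
\<close>

lemma dist_neq:
  assumes "(u, v) \<in> A" "reached u" "dist u \<le> D"
  shows "dist u \<noteq> dist v"
proof
  assume eq: "dist u = dist v"
  obtain p where p: "p 0 = r" "p (dist u) = u" "\<And>i. i < dist u \<Longrightarrow> (p i, p (Suc i)) \<in> A"
      "\<And>i. i \<le> dist u \<Longrightarrow> dist (p i) = i"
    using geodesic[OF assms(2)] by metis
  obtain q where q: "q 0 = r" "q (dist v) = v" "\<And>i. i < dist v \<Longrightarrow> (q i, q (Suc i)) \<in> A"
      "\<And>i. i \<le> dist v \<Longrightarrow> dist (q i) = i"
    using geodesic step(1)[OF assms(2,1)] by metis
  define d where "d = dist u"
  \<comment> \<open>up to \<open>u\<close>, across to \<open>v\<close>, and down to the root\<close>
  define w where "w i = (if i \<le> d then p i else q (2 * d + 1 - i))" for i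
  have "w (2 * d + 1) \<noteq> r"
  proof (rule no_cycle)
    show "1 \<le> 2 * d + 1" "2 * d + 1 \<le> 2 * D + 1" "w 0 = r"
      using assms(3) p by (auto simp: d_def w_def)
    show "\<forall>i<2 * d + 1. (w i, w (Suc i)) \<in> A"
    proof (intro allI impI)
      fix i assume i: "i < 2 * d + 1"
      consider "i < d" | "i = d" | "d < i" by linarith
      then show "(w i, w (Suc i)) \<in> A"
      proof cases
        case 1 then show ?thesis using p by (auto simp: w_def d_def)
      next
        case 2 then show ?thesis using p q assms eq by (auto simp: w_def d_def)
      next
        case 3
        define j where "j = 2 * d - i"
        have "j < d" "2 * d + 1 - i = Suc j" "2 * d + 1 - Suc i = j" using 3 i by (auto simp: j_def)
        then have "w i = q (Suc j)" "w (Suc i) = q j" "j < dist v" using 3 eq by (auto simp: w_def d_def)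
        then show ?thesis using q(3)[of j] sym by (auto dest: symD)
      qed
    qed
    have dw: "dist (w i) = (if i \<le> d then i else 2 * d + 1 - i)" if "i \<le> 2 * d + 1" for i
      using that p q eq by (auto simp: w_def d_def)
    show "\<forall>i. Suc (Suc i) \<le> 2 * d + 1 \<longrightarrow> w i \<noteq> w (Suc (Suc i))"
    proof (intro allI impI notI)
      fix i assume i: "Suc (Suc i) \<le> 2 * d + 1" and "w i = w (Suc (Suc i))"
      then have "dist (w i) = dist (w (Suc (Suc i)))" by simp
      with i show False by (auto simp: dw split: if_splits; presburger)
    qed
  qed
  then show False using q by (simp add: w_def)
qed

text \<open>
  Two different lower neighbours would give two geodesics to the same vertex; going up along one and
  down along the other never backtracks.
\<close>

lemma lower_neighbour_unique:
  assumes "(u, v) \<in> A" "(u', v) \<in> A" "reached u" "reached u'"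
    "dist v = Suc (dist u)" "dist v = Suc (dist u')" "dist v \<le> D"
  shows "u = u'"
proof (rule ccontr)
  assume neq: "u \<noteq> u'"
  obtain p where p: "p 0 = r" "p (dist u) = u" "\<And>i. i < dist u \<Longrightarrow> (p i, p (Suc i)) \<in> A"
      "\<And>i. i \<le> dist u \<Longrightarrow> dist (p i) = i"
    using geodesic[OF assms(3)] by metis
  obtain q where q: "q 0 = r" "q (dist u') = u'" "\<And>i. i < dist u' \<Longrightarrow> (q i, q (Suc i)) \<in> A"
      "\<And>i. i \<le> dist u' \<Longrightarrow> dist (q i) = i"
    using geodesic[OF assms(4)] by metis
  define d where "d = dist u"
  have d': "dist u' = d" "dist v = Suc d" using assms by (auto simp: d_def)
  \<comment> \<open>up through \<open>u\<close> to \<open>v\<close>, and down through \<open>u'\<close>\<close>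
  define w where "w i = (if i \<le> d then p i else if i = Suc d then v else q (2 * d + 2 - i))" for i
  have "w (2 * d + 2) \<noteq> r"
  proof (rule no_cycle)
    show "1 \<le> 2 * d + 2" "2 * d + 2 \<le> 2 * D + 1" "w 0 = r"
      using assms(7) p d' by (auto simp: w_def)
    show "\<forall>i<2 * d + 2. (w i, w (Suc i)) \<in> A"
    proof (intro allI impI)
      fix i assume i: "i < 2 * d + 2"
      consider "i < d" | "i = d" | "i = Suc d" | "Suc d < i" by linarith
      then show "(w i, w (Suc i)) \<in> A"
      proof cases
        case 1 then show ?thesis using p by (auto simp: w_def d_def)
      next
        case 2 then show ?thesis using p assms by (auto simp: w_def d_def)
      next
        case 3 then show ?thesis using q assms(2) sym d' by (auto simp: w_def dest: symD)
      next
        case 4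
        define j where "j = 2 * d + 1 - i"
        have "j < d" "2 * d + 2 - i = Suc j" "2 * d + 2 - Suc i = j" using 4 i by (auto simp: j_def)
        then have "w i = q (Suc j)" "w (Suc i) = q j" "j < dist u'" using 4 d' by (auto simp: w_def)
        then show ?thesis using q(3)[of j] sym by (auto dest: symD)
      qed
    qed
    have dw: "dist (w i) = (if i \<le> Suc d then i else 2 * d + 2 - i)" if "i \<le> 2 * d + 2" for i
      using that p q d' by (auto simp: w_def d_def)
    show "\<forall>i. Suc (Suc i) \<le> 2 * d + 2 \<longrightarrow> w i \<noteq> w (Suc (Suc i))"
    proof (intro allI impI notI)
      fix i assume i: "Suc (Suc i) \<le> 2 * d + 2" and eq: "w i = w (Suc (Suc i))"
      then have "dist (w i) = dist (w (Suc (Suc i)))" by simp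
      with i have "i = d" by (simp add: dw split: if_splits)
      then show False using eq neq p q d' by (simp add: w_def d_def)
    qed
  qed
  then show False using q by (simp add: w_def)
qed

lemma parent:
  assumes "reached v" "0 < dist v"
  shows "(parent v, v) \<in> A" "reached (parent v)" "dist v = Suc (dist (parent v))"
proof -
  obtain p where p: "p 0 = r" "p (dist v) = v" "\<And>i. i < dist v \<Longrightarrow> (p i, p (Suc i)) \<in> A"
      "\<And>i. i \<le> dist v \<Longrightarrow> dist (p i) = i"
    using geodesic[OF assms(1)] by metis
  obtain n where n: "dist v = Suc n" using assms(2) gr0_implies_Suc by blast
  have "(r, p n) \<in> A ^^ n"
    using p n by (auto simp: relpow_fun_conv intro!: exI[of _ p])
  then have "(p n, v) \<in> A \<and> reached (p n) \<and> Suc (dist (p n)) = dist v"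
    using p n reached_relpow p(3)[of n] by auto
  then have "(parent v, v) \<in> A \<and> reached (parent v) \<and> Suc (dist (parent v)) = dist v"
    unfolding parent_def by (rule someI)
  then show "(parent v, v) \<in> A" "reached (parent v)" "dist v = Suc (dist (parent v))" by auto
qed

lemma adjacent_parent:
  assumes "(u, v) \<in> A" "reached u" "dist u \<le> D" "dist v \<le> D"
  shows "0 < dist v \<and> u = parent v \<or> 0 < dist u \<and> v = parent u"
proof -
  have rv: "reached v" and vu: "(v, u) \<in> A" using step assms sym by (auto dest: symD)
  have "dist v = Suc (dist u) \<or> dist u = Suc (dist v)"
    using dist_neq[OF assms(1-3)] step(2)[OF assms(2,1)] step(2)[OF rv vu] by linarith
  then show ?thesis
  proof
    assume "dist v = Suc (dist u)"
    with lower_neighbour_unique[OF assms(1) parent(1) assms(2) parent(2)] parent(3)[OF rv] rv assms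
    show ?thesis by auto
  next
    assume "dist u = Suc (dist v)"
    with lower_neighbour_unique[OF vu parent(1) rv parent(2)] parent(3)[OF assms(2)] rv assms
    show ?thesis by auto
  qed
qed

definition descendants :: "'b \<Rightarrow> 'b set" where
  "descendants z = {v. reached v \<and> dist z \<le> dist v \<and> (parent ^^ (dist v - dist z)) v = z}"

lemma parent_funpow:
  assumes "reached v" "i \<le> dist v"
  shows "reached ((parent ^^ i) v) \<and> dist ((parent ^^ i) v) = dist v - i"
  using assms(2)
proof (induction i)
  case (Suc i)
  then show ?case using parent[of "(parent ^^ i) v"] by auto
qed (use assms in auto)

lemma parent_descendants:
  assumes "reached v" "0 < dist v" "v \<noteq> z"
  shows "v \<in> descendants z \<longleftrightarrow> parent v \<in> descendants z"
proof -
  note p = parent[OF assms(1,2)]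
  have "dist z \<le> dist (parent v)" if "v \<in> descendants z"
    using that assms(3) p by (auto simp: descendants_def le_Suc_eq)
  moreover have "(parent ^^ (dist v - dist z)) v = (parent ^^ (dist (parent v) - dist z)) (parent v)"
    if "dist z \<le> dist (parent v)"
    using that p(3) by (simp add: Suc_diff_le funpow_swap1)
  ultimately show ?thesis using p assms by (auto simp: descendants_def)
qed

text \<open>
  The classical centroid of a weighted tree: a vertex of maximal depth whose descendants carry more
  than half of the weight. The branches at this vertex are recorded by a label, namely the child below
  which a vertex lies, or \<open>None\<close> outside the subtree; edges that avoid the centroid stay in one
  branch, and no branch carries more than half.
\<close>

lemma balanced_vertex:
  fixes f :: "'x \<Rightarrow> 'b"
  assumes "finite V" and f: "\<And>x. x \<in> V \<Longrightarrow> reached (f x) \<and> dist (f x) \<le> D"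
  obtains z and label :: "'b \<Rightarrow> 'b option" where
    "\<And>u v. (u, v) \<in> A \<Longrightarrow> reached u \<Longrightarrow> dist u \<le> D \<Longrightarrow> dist v \<le> D \<Longrightarrow> u \<noteq> z \<Longrightarrow> v \<noteq> z \<Longrightarrow>
      label u = label v"
    "\<And>l. 2 * card {x \<in> V. f x \<noteq> z \<and> label (f x) = l} \<le> card V"
proof (cases "V = {}")
  case True
  then show ?thesis by (intro that[of _ "\<lambda>_. None"]) auto
next
  case False
  define weight where "weight z = card {x \<in> V. f x \<in> descendants z}" for z
  define heavy where "heavy z \<longleftrightarrow> reached z \<and> dist z \<le> D \<and> card V < 2 * weight z" for z
  have "v \<in> descendants r" if "reached v" for v
    using parent_funpow[OF that order_refl] that dist_0 by (auto simp: descendants_def dist_root)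
  then have "{x \<in> V. f x \<in> descendants r} = V" using f by auto
  then have "heavy r" using False assms(1) by (simp add: heavy_def weight_def dist_root card_gt_0_iff)
  then obtain z where z: "heavy z" and zmax: "\<And>y. heavy y \<Longrightarrow> dist y \<le> dist z"
    using ex_has_greatest_nat[of heavy r dist "Suc D"] by (auto simp: heavy_def less_Suc_eq_le)
  define child where "child v = (parent ^^ (dist v - Suc (dist z))) v" for v
  define label where "label v = (if v \<in> descendants z then Some (child v) else None)" for v
  have deeper: "dist z < dist v" if "v \<in> descendants z" "v \<noteq> z" for v
    using that by (cases "dist v = dist z") (auto simp: descendants_def)
  have lab: "label (parent v) = label v"
    if "reached v" "0 < dist v" "parent v \<noteq> z" "v \<noteq> z" for v
  proof (cases "v \<in> descendants z")
    case True
    with that parent_descendants have pv: "parent v \<in> descendants z" by blast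
    with deeper that have "dist z < dist (parent v)" by blast
    with parent(3)[OF that(1,2)] have "child v = child (parent v)"
      unfolding child_def by (metis Suc_diff_Suc Suc_less_SucD diff_Suc_Suc funpow_simps_right(2) less_Suc_eq o_apply)
    with pv True show ?thesis by (simp add: label_def)
  next
    case False
    with that parent_descendants show ?thesis by (auto simp: label_def)
  qed
  show thesis
  proof (rule that[of z label])
    fix u v assume "(u, v) \<in> A" "reached u" "dist u \<le> D" "dist v \<le> D" "u \<noteq> z" "v \<noteq> z"
    with adjacent_parent[of u v] lab[of u] lab[of v] step(1)[of u v] show "label u = label v"
      by metis
  next
    fix l
    show "2 * card {x \<in> V. f x \<noteq> z \<and> label (f x) = l} \<le> card V"
    proof (cases l)
      case None
      have "{x \<in> V. f x \<noteq> z \<and> label (f x) = l} \<subseteq> V - {x \<in> V. f x \<in> descendants z}"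
        by (auto simp: None label_def)
      then have "card {x \<in> V. f x \<noteq> z \<and> label (f x) = l} \<le> card (V - {x \<in> V. f x \<in> descendants z})"
        by (intro card_mono) (use assms in auto)
      also have "\<dots> = card V - weight z"
        unfolding weight_def by (rule card_Diff_subset) (use assms in auto)
      finally show ?thesis using z by (auto simp: heavy_def)
    next
      case (Some c)
      show ?thesis
      proof (cases "{x \<in> V. f x \<noteq> z \<and> label (f x) = l} = {}")
        case True
        then show ?thesis by (metis card.empty le0 mult_0_right)
      next
        case False
        have c: "reached c \<and> dist c = Suc (dist z) \<and> v \<in> descendants c"
          if v: "reached v" "v \<noteq> z" "label v = Some c" for v
        proof -
          have vz: "v \<in> descendants z" and cv: "c = child v"
            using v by (auto simp: label_def split: if_splits)
          have "Suc (dist z) \<le> dist v" using deeper[OF vz v(2)] by simp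
          with parent_funpow[OF v(1), of "dist v - Suc (dist z)"] v(1) show ?thesis
            by (auto simp: cv child_def descendants_def)
        qed
        have "{x \<in> V. f x \<noteq> z \<and> label (f x) = l} \<subseteq> {x \<in> V. f x \<in> descendants c}"
          using c f Some by auto
        then have "card {x \<in> V. f x \<noteq> z \<and> label (f x) = l} \<le> weight c"
          unfolding weight_def by (intro card_mono) (use assms in auto)
        moreover have "\<not> heavy c" "reached c" "dist c \<le> D"
        proof -
          obtain x where x: "x \<in> V" "f x \<noteq> z" "label (f x) = Some c" using False Some by auto
          with c f have cc: "reached c \<and> dist c = Suc (dist z) \<and> f x \<in> descendants c" by blast
          then show "\<not> heavy c" using zmax by fastforce
          show "reached c" using cc by blast
          show "dist c \<le> D" using cc x f by (fastforce simp: descendants_def)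
        qed
        ultimately show ?thesis by (auto simp: heavy_def)
      qed
    qed
  qed
qed

end

section \<open>Words acting by two permutations\<close>

abbreviation finv :: "('x \<Rightarrow> 'y) \<Rightarrow> 'y \<Rightarrow> 'x" where "finv \<equiv> inv_into UNIV"

lemma bij_comp_inv: "bij f \<Longrightarrow> f \<circ> finv f = id" "bij f \<Longrightarrow> finv f \<circ> f = id"
    "bij f \<Longrightarrow> f \<circ> (finv f \<circ> g) = g" "bij f \<Longrightarrow> finv f \<circ> (f \<circ> g) = g"
  by (auto simp: fun_eq_iff bij_is_surj surj_f_inv_f bij_is_inj)

text \<open>
  In a letter, the first component tells the generators \<open>a\<close> (\<open>False\<close>) and \<open>t\<close> (\<open>True\<close>) apart, the
  second one is the sign of the exponent.
\<close>

type_synonym word = "(bool \<times> bool) list"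

definition act_letter :: "(bool \<Rightarrow> 'x \<Rightarrow> 'x) \<Rightarrow> bool \<times> bool \<Rightarrow> 'x \<Rightarrow> 'x" where
  "act_letter \<theta> l = (if snd l then \<theta> (fst l) else finv (\<theta> (fst l)))"

text \<open>
  Words act from the right, so that the words of a path in a Cayley graph are read from left to right.
\<close>

definition act :: "(bool \<Rightarrow> 'x \<Rightarrow> 'x) \<Rightarrow> word \<Rightarrow> 'x \<Rightarrow> 'x" where
  "act \<theta> = fold (act_letter \<theta>)"

definition inverse_word :: "word \<Rightarrow> word" where
  "inverse_word w = rev (map (\<lambda>l. (fst l, \<not> snd l)) w)"

definition conj_letter :: "nat \<Rightarrow> bool \<Rightarrow> word" where
  "conj_letter i s = replicate i (True, True) @ [(False, s)] @ replicate i (True, False)"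

text \<open>
  The words spelled out as products of the conjugates \<open>a\<^sub>i\<close> and their inverses with \<open>i \<in> I\<close>.
\<close>

inductive_set conj_words :: "nat set \<Rightarrow> word set" for I where
  Nil: "[] \<in> conj_words I"
| Cons: "i \<in> I \<Longrightarrow> w \<in> conj_words I \<Longrightarrow> conj_letter i s @ w \<in> conj_words I"

lemma act_simps [simp]: "act \<theta> [] x = x" "act \<theta> (l # w) x = act \<theta> w (act_letter \<theta> l x)"
    "act \<theta> (u @ w) x = act \<theta> w (act \<theta> u x)"
  by (simp_all add: act_def)

lemma inverse_word_simps [simp]: "inverse_word [] = []" "inverse_word (u @ w) = inverse_word w @ inverse_word u" "inverse_word (l # w) = inverse_word w @ [(fst l, \<not> snd l)]"
    "inverse_word (inverse_word w) = w"
  by (simp_all add: inverse_word_def rev_map comp_def)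

lemma conj_words_append: "u \<in> conj_words I \<Longrightarrow> w \<in> conj_words I \<Longrightarrow> u @ w \<in> conj_words I"
  by (induction u rule: conj_words.induct) (auto intro: conj_words.Cons)

lemma conj_words_letter: "i \<in> I \<Longrightarrow> conj_letter i s \<in> conj_words I"
  using conj_words.Cons[OF _ conj_words.Nil] by force

lemma inverse_word_conj_letter: "inverse_word (conj_letter i s) = conj_letter i (\<not> s)"
  by (simp add: conj_letter_def inverse_word_def)

lemma conj_words_inverse_word: "w \<in> conj_words I \<Longrightarrow> inverse_word w \<in> conj_words I"
  by (induction rule: conj_words.induct) (auto simp: inverse_word_conj_letter intro: conj_words_append conj_words_letter conj_words.Nil)

lemma conj_words_mono: "w \<in> conj_words I \<Longrightarrow> I \<subseteq> J \<Longrightarrow> w \<in> conj_words J"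
  by (induction rule: conj_words.induct) (auto intro: conj_words.intros)

lemma act_append: "act \<theta> (u @ w) = act \<theta> w \<circ> act \<theta> u"
  by (simp add: fun_eq_iff)

lemma act_letter_permutes: "(\<And>g. \<theta> g permutes X) \<Longrightarrow> act_letter \<theta> l permutes X"
  by (simp add: act_letter_def permutes_inv)

lemma act_permutes: "(\<And>g. \<theta> g permutes X) \<Longrightarrow> act \<theta> w permutes X"
proof (induction w)
  case Nil
  have "act \<theta> [] = id" by (simp add: fun_eq_iff)
  then show ?case by (metis permutes_id)
next
  case (Cons l w)
  have "act \<theta> (l # w) = act \<theta> w \<circ> act_letter \<theta> l" by (simp add: fun_eq_iff)
  with Cons show ?case by (metis permutes_compose act_letter_permutes)
qed

lemma act_inverse_word:
  assumes "\<And>g. bij (\<theta> g)"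
  shows "act \<theta> (inverse_word w) (act \<theta> w x) = x" "act \<theta> w (act \<theta> (inverse_word w) x) = x"
proof -
  have l: "act_letter \<theta> (fst l, \<not> snd l) (act_letter \<theta> l x) = x" "act_letter \<theta> l (act_letter \<theta> (fst l, \<not> snd l) x) = x" for l x
    using assms by (auto simp: act_letter_def bij_is_surj surj_f_inv_f bij_is_inj)
  show "act \<theta> (inverse_word w) (act \<theta> w x) = x" for x
    by (induction w arbitrary: x) (auto simp: l)
  show "act \<theta> w (act \<theta> (inverse_word w) x) = x"
    by (induction w arbitrary: x) (auto simp: l)
qed

lemma act_bij:
  assumes "\<And>g. bij (\<theta> g)"
  shows "bij (act \<theta> w)" "finv (act \<theta> w) = act \<theta> (inverse_word w)"
proof -
  show b: "bij (act \<theta> w)"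
    by (rule bij_betw_byWitness[where f' = "act \<theta> (inverse_word w)"]) (auto simp: act_inverse_word assms)
  show "finv (act \<theta> w) = act \<theta> (inverse_word w)"
    by (rule inv_unique_comp) (auto simp: fun_eq_iff act_inverse_word assms)
qed

text \<open>
  Actions are compared along an injection or an inclusion by checking only the two generators; this
  serves both for appending a block and for passing to the limit.
\<close>

lemma act_transfer:
  assumes "\<And>g. \<theta> g permutes X" "\<And>g. bij (\<theta>' g)"
    and "\<And>g x. x \<in> X \<Longrightarrow> \<theta>' g (j x) = j (\<theta> g x)" "x \<in> X"
  shows "act \<theta>' w (j x) = j (act \<theta> w x)"
  using assms(4)
proof (induction w arbitrary: x)
  case (Cons l w)
  have "act_letter \<theta>' l (j x) = j (act_letter \<theta> l x)"
  proof (cases "snd l")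
    case False
    define y where "y = finv (\<theta> (fst l)) x"
    have "y \<in> X" using Cons.prems permutes_inv[OF assms(1)] by (simp add: y_def permutes_in_image)
    moreover have "\<theta> (fst l) y = x" by (simp add: y_def permutes_inverses[OF assms(1)])
    ultimately have "\<theta>' (fst l) (j y) = j x" using assms(3)[of y "fst l"] by simp
    then have "finv (\<theta>' (fst l)) (j x) = j y" using bij_is_inj[OF assms(2)] by (metis inv_f_f)
    with False show ?thesis by (simp add: act_letter_def y_def)
  qed (use Cons.prems assms(3) in \<open>simp add: act_letter_def\<close>)
  moreover have "act_letter \<theta> l x \<in> X"
    using Cons.prems act_letter_permutes[of \<theta> X l] assms(1) by (simp add: permutes_in_image)
  ultimately show ?case using Cons.IH by simp
qed simp

lemma act_conj_letter_Suc:
  assumes "\<And>g. bij (\<theta> g)"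
  shows "act \<theta> (conj_letter (Suc i) s) = finv (\<theta> True) \<circ> act \<theta> (conj_letter i s) \<circ> \<theta> True"
proof -
  have "conj_letter (Suc i) s = (True, True) # conj_letter i s @ [(True, False)]"
    by (simp add: conj_letter_def replicate_append_same)
  then show ?thesis by (simp add: fun_eq_iff act_letter_def)
qed

text \<open>
  Conjugation by \<open>t\<close> shifts the conjugates \<open>a\<^sub>i\<close> by one, on the level of the permutations.
\<close>

lemma conj_words_shift:
  assumes \<theta>: "\<And>g. bij (\<theta> g)"
  shows "u \<in> conj_words I \<Longrightarrow> \<exists>u' \<in> conj_words (Suc ` I). act \<theta> u' = finv (\<theta> True) \<circ> act \<theta> u \<circ> \<theta> True"
    and "u \<in> conj_words (Suc ` I) \<Longrightarrow> \<exists>u' \<in> conj_words I. act \<theta> u' = \<theta> True \<circ> act \<theta> u \<circ> finv (\<theta> True)"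
proof -
  note c = bij_comp_inv[OF \<theta>[of True]] and cl = act_conj_letter_Suc[OF \<theta>]
  have nil: "act \<theta> [] = id" by (simp add: fun_eq_iff)
  show "u \<in> conj_words I \<Longrightarrow> \<exists>u' \<in> conj_words (Suc ` I). act \<theta> u' = finv (\<theta> True) \<circ> act \<theta> u \<circ> \<theta> True"
  proof (induction rule: conj_words.induct)
    case Nil
    show ?case by (rule bexI[OF _ conj_words.Nil]) (simp add: nil c)
  next
    case (Cons i w s)
    from Cons.IH obtain u' where
      u': "u' \<in> conj_words (Suc ` I)" "act \<theta> u' = finv (\<theta> True) \<circ> act \<theta> w \<circ> \<theta> True" ..
    have "act \<theta> (conj_letter (Suc i) s @ u') = finv (\<theta> True) \<circ> act \<theta> (conj_letter i s @ w) \<circ> \<theta> True"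
      by (simp add: act_append u' cl comp_assoc c)
    moreover have "conj_letter (Suc i) s @ u' \<in> conj_words (Suc ` I)"
      using Cons.hyps(1) u'(1) by (intro conj_words.Cons imageI)
    ultimately show ?case ..
  qed
  show "u \<in> conj_words (Suc ` I) \<Longrightarrow> \<exists>u' \<in> conj_words I. act \<theta> u' = \<theta> True \<circ> act \<theta> u \<circ> finv (\<theta> True)"
  proof (induction rule: conj_words.induct)
    case Nil
    show ?case by (rule bexI[OF _ conj_words.Nil]) (simp add: nil c)
  next
    case (Cons i w s)
    from Cons.IH obtain u' where
      u': "u' \<in> conj_words I" "act \<theta> u' = \<theta> True \<circ> act \<theta> w \<circ> finv (\<theta> True)" ..
    from Cons.hyps(1) obtain j where j: "i = Suc j" "j \<in> I" ..
    have "act \<theta> (conj_letter j s @ u') = \<theta> True \<circ> act \<theta> (conj_letter i s @ w) \<circ> finv (\<theta> True)"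
      by (simp add: act_append u' cl comp_assoc c j)
    moreover have "conj_letter j s @ u' \<in> conj_words I"
      using j(2) u'(1) by (rule conj_words.Cons)
    ultimately show ?case ..
  qed
qed

text \<open>
  The associated subgroups of the HNN extension: \<open>t\<^sup>e w t\<^sup>-\<^sup>e\<close> with \<open>w\<close> in \<open>\<langle>a\<^sub>i | i \<in> assoc_index k e\<rangle>\<close>
  lies in \<open>\<langle>a\<^sub>0, \<dots>, a\<^sub>k\<rangle>\<close>.
\<close>

definition assoc_index :: "nat \<Rightarrow> bool \<Rightarrow> nat set" where
  "assoc_index k e = (if e then {..<k} else {1..k})"

definition syllables :: "(word \<times> bool) list \<Rightarrow> word" where
  "syllables ps = concat (map (\<lambda>(w, e). w @ [(True, e)]) ps)"

section \<open>Residual finiteness of free groups\<close>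

lemma extend_to_permutation:
  fixes f :: "'x \<Rightarrow> 'x"
  assumes "finite X" "A \<subseteq> X" "inj_on f A" "f ` A \<subseteq> X"
  obtains \<pi> where "\<pi> permutes X" "\<And>x. x \<in> A \<Longrightarrow> \<pi> x = f x"
proof -
  have fA: "finite A" using assms finite_subset by blast
  have "card (X - A) = card (X - f ` A)"
    using assms fA by (simp add: card_Diff_subset card_image)
  then obtain g where g: "bij_betw g (X - A) (X - f ` A)"
    using finite_same_card_bij[of "X - A" "X - f ` A"] assms(1) by auto
  define \<pi> where "\<pi> x = (if x \<in> A then f x else if x \<in> X then g x else x)" for x
  have "bij_betw \<pi> A (f ` A)"
    using assms by (simp add: \<pi>_def bij_betw_def cong: inj_on_cong)
  moreover have "bij_betw \<pi> (X - A) (X - f ` A)"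
    using g by (rule bij_betw_cong[THEN iffD1, rotated]) (auto simp: \<pi>_def)
  ultimately have "bij_betw \<pi> (A \<union> (X - A)) (f ` A \<union> (X - f ` A))"
    by (rule bij_betw_combine) auto
  moreover have "A \<union> (X - A) = X" "f ` A \<union> (X - f ` A) = X" using assms by auto
  ultimately have "\<pi> permutes X"
    by (intro bij_imp_permutes) (auto simp: \<pi>_def assms(2)[THEN subsetD])
  then show thesis by (rule that) (simp add: \<pi>_def)
qed

definition reduced :: "('l \<times> bool) list \<Rightarrow> bool" where
  "reduced = successively (\<lambda>x y. fst x = fst y \<longrightarrow> snd x = snd y)"

definition run :: "('l \<Rightarrow> 'x \<Rightarrow> 'x) \<Rightarrow> ('l \<times> bool) list \<Rightarrow> 'x \<Rightarrow> 'x" where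
  "run \<sigma> = fold (\<lambda>l. if snd l then \<sigma> (fst l) else finv (\<sigma> (fst l)))"

text \<open>
  The letters of the word prescribe how to walk through the points \<open>0, 1, \<dots>\<close> in order. Since the
  word is reduced, the prescriptions for one letter form a partial injection, which extends to a
  permutation.
\<close>

lemma reduced_word_moves:
  assumes "reduced ls"
  obtains \<sigma> :: "'l \<Rightarrow> nat \<Rightarrow> nat" where "\<And>v. \<sigma> v permutes {..length ls}" "run \<sigma> ls 0 = length ls"
proof -
  define n where "n = length ls"
  \<comment> \<open>\<open>v\<close> has to send the points of \<open>U v\<close> one up and those of \<open>L v\<close> one down\<close>
  define U where "U v = {i. i < n \<and> ls ! i = (v, True)}" for v
  define L where "L v = {Suc i | i. i < n \<and> ls ! i = (v, False)}" for v
  define f where "f v i = (if i \<in> U v then Suc i else i - 1)" for v i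
  have red: "\<not> (ls ! i = (v, s) \<and> ls ! Suc i = (v, \<not> s))" if "Suc i < n" for i v s
    using assms that by (auto simp: reduced_def successively_conv_nth n_def)
  have "\<exists>\<pi>. \<pi> permutes {..n} \<and> (\<forall>i \<in> U v \<union> L v. \<pi> i = f v i)" for v
  proof -
    have disj: "i \<notin> U v" if "i \<in> L v" for i
      using that red[of _ v False] by (auto simp: U_def L_def)
    have "inj_on (f v) (U v \<union> L v)"
    proof (rule inj_onI)
      fix x y assume x: "x \<in> U v \<union> L v" and y: "y \<in> U v \<union> L v" and eq: "f v x = f v y"
      have *: False if "x \<in> U v" "y \<in> L v" "f v x = f v y" for x y
      proof -
        from that(2) obtain j where j: "y = Suc j" "j < n" "ls ! j = (v, False)" by (auto simp: L_def)
        have "Suc x = j" "ls ! x = (v, True)" using that disj[of y] j by (auto simp: f_def U_def)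
        then show False using red[of x v True] j by auto
      qed
      from x y *[of x y] *[of y x] eq consider "x \<in> U v" "y \<in> U v" | "x \<in> L v" "y \<in> L v"
        by auto
      then show "x = y"
      proof cases
        case 1 with eq show ?thesis by (simp add: f_def)
      next
        case 2
        then have "x \<notin> U v" "y \<notin> U v" "0 < x" "0 < y" using disj by (auto simp: L_def)
        with eq show ?thesis by (simp add: f_def)
      qed
    qed
    moreover have "U v \<union> L v \<subseteq> {..n}" "f v ` (U v \<union> L v) \<subseteq> {..n}"
      by (auto simp: U_def L_def f_def)
    ultimately obtain \<pi> where "\<pi> permutes {..n}" "\<And>x. x \<in> U v \<union> L v \<Longrightarrow> \<pi> x = f v x"
      using extend_to_permutation[OF finite_atMost, of "U v \<union> L v" n "f v"] by blast
    then show ?thesis by blast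
  qed
  then have "\<forall>v. \<exists>\<pi>. \<pi> permutes {..n} \<and> (\<forall>i \<in> U v \<union> L v. \<pi> i = f v i)" by blast
  from choice[OF this] obtain \<sigma> where
    \<sigma>': "\<forall>v. \<sigma> v permutes {..n} \<and> (\<forall>i \<in> U v \<union> L v. \<sigma> v i = f v i)" ..
  have \<sigma>: "\<sigma> v permutes {..n}" "i \<in> U v \<union> L v \<Longrightarrow> \<sigma> v i = f v i" for v i
    using \<sigma>' by blast+
  have "run \<sigma> (take i ls) 0 = i" if "i \<le> n" for i
    using that
  proof (induction i)
    case (Suc i)
    obtain v s where vs: "ls ! i = (v, s)" by fastforce
    have split: "take (Suc i) ls = take i ls @ [(v, s)]"
      using Suc vs by (simp add: take_Suc_conv_app_nth n_def)
    show ?case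
    proof (cases s)
      case True
      then have "i \<in> U v" using vs Suc by (simp add: U_def)
      with \<sigma>(2)[of i v] True split Suc show ?thesis by (simp add: run_def f_def)
    next
      case False
      then have "Suc i \<in> L v" using vs Suc by (auto simp: L_def)
      moreover have "Suc i \<notin> U v" using red[of i v False] vs False by (auto simp: U_def)
      ultimately have "\<sigma> v (Suc i) = i" using \<sigma>(2)[of "Suc i" v] by (simp add: f_def)
      then have "finv (\<sigma> v) i = Suc i" using permutes_inverses(2)[OF \<sigma>(1), of v i] permutes_inverses(2)[OF \<sigma>(1), of v "Suc i"] by simp
      with False split Suc show ?thesis by (simp add: run_def)
    qed
  qed (simp add: run_def)
  from this[of n] have "run \<sigma> ls 0 = n" by (simp add: n_def)
  then show thesis by (intro that[of \<sigma>]) (use \<sigma>(1) in \<open>simp_all add: n_def\<close>)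
qed

text \<open>
  Finitely many words are treated at once on the disjoint union of their walks, the first component
  of a point naming the walk.
\<close>

lemma reduced_words_move:
  fixes L :: "'l set"
  assumes "finite L"
  shows "\<exists>(Y :: (('l \<times> bool) list \<times> nat) set) \<sigma>. finite Y \<and> Y \<noteq> {} \<and> (\<forall>v. \<sigma> v permutes Y) \<and>
    (\<forall>ls. reduced ls \<longrightarrow> ls \<noteq> [] \<longrightarrow> length ls \<le> R \<longrightarrow> fst ` set ls \<subseteq> L \<longrightarrow> (\<exists>y\<in>Y. run \<sigma> ls y \<noteq> y))"
proof -
  define LS where "LS = {ls :: ('l \<times> bool) list. set ls \<subseteq> L \<times> UNIV \<and> length ls \<le> R \<and> reduced ls}"
  have fin: "finite LS"
    by (rule finite_subset[OF _ finite_lists_length_le[of "L \<times> (UNIV :: bool set)" R]]) (use assms in \<open>auto simp: LS_def\<close>)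
  have "\<forall>ls. \<exists>\<sigma>. (\<forall>v::'l. \<sigma> v permutes {..length ls}) \<and> (reduced ls \<longrightarrow> run \<sigma> ls 0 = length ls)"
  proof
    fix ls :: "('l \<times> bool) list"
    show "\<exists>\<sigma>. (\<forall>v::'l. \<sigma> v permutes {..length ls}) \<and> (reduced ls \<longrightarrow> run \<sigma> ls 0 = length ls)"
    proof (cases "reduced ls")
      case True
      then show ?thesis using reduced_word_moves[OF True] by metis
    next
      case False
      then show ?thesis by (intro exI[of _ "\<lambda>_. id"]) (simp add: permutes_id)
    qed
  qed
  from choice[OF this] obtain sg where
    sg0: "\<forall>ls. (\<forall>v::'l. sg ls v permutes {..length ls}) \<and> (reduced ls \<longrightarrow> run (sg ls) ls 0 = length ls)" ..
  then have sg: "sg ls v permutes {..length ls}" "reduced ls \<Longrightarrow> run (sg ls) ls 0 = length ls" for ls v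
    by blast+
  define Y where "Y = Sigma LS (\<lambda>ls. {..length ls})"
  define \<sigma> where "\<sigma> v y = (if fst y \<in> LS then (fst y, sg (fst y) v (snd y)) else y)" for v y
  define \<sigma>' where "\<sigma>' v y = (if fst y \<in> LS then (fst y, finv (sg (fst y) v) (snd y)) else y)" for v y
  have inv1: "\<sigma> v (\<sigma>' v y) = y" "\<sigma>' v (\<sigma> v y) = y" for v y
    by (auto simp: \<sigma>_def \<sigma>'_def permutes_inverses[OF sg(1)])
  then have inv: "finv (\<sigma> v) = \<sigma>' v" for v
    by (intro inv_unique_comp) (auto simp: fun_eq_iff)
  have "\<sigma> v permutes Y" for v
  proof -
    have "\<sigma> v y = y" if "y \<notin> Y" for y
      using that permutes_not_in[OF sg(1), of "snd y" "fst y" v] by (cases y) (auto simp: \<sigma>_def Y_def)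
    moreover have "\<exists>!x. \<sigma> v x = y" for y using inv1 by metis
    ultimately show ?thesis by (auto simp: permutes_def)
  qed
  moreover have "\<exists>y\<in>Y. run \<sigma> ls y \<noteq> y"
    if ls: "reduced ls" "ls \<noteq> []" "length ls \<le> R" "fst ` set ls \<subseteq> L" for ls
  proof -
    have LS: "ls \<in> LS" using ls by (auto simp: LS_def)
    have "run \<sigma> us (ls, i) = (ls, run (sg ls) us i)" for us i
      by (induction us arbitrary: i) (simp_all add: run_def inv, simp_all add: \<sigma>_def \<sigma>'_def LS)
    then have "run \<sigma> ls (ls, 0) \<noteq> (ls, 0)" using sg(2)[OF ls(1)] ls by simp
    moreover have "(ls, 0) \<in> Y" using LS by (simp add: Y_def)
    ultimately show ?thesis by blast
  qed
  moreover have "([], 0) \<in> Y" by (simp add: Y_def LS_def reduced_def)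
  moreover have "finite Y" using fin by (simp add: Y_def)
  ultimately show ?thesis by (intro exI[of _ Y] exI[of _ \<sigma>]) auto
qed

section \<open>Finite actions of HNN extensions of finite groups\<close>

text \<open>
  A group of permutations is represented by its set of elements. The cosets \<open>K h\<close> appear as the sets of
  all \<open>\<kappa> \<circ> h\<close>, since composition of functions reverses the order of a right action.
\<close>

definition bij_group :: "('p \<Rightarrow> 'p) set \<Rightarrow> bool" where
  "bij_group K \<longleftrightarrow> id \<in> K \<and> (\<forall>f\<in>K. bij f \<and> finv f \<in> K \<and> (\<forall>g\<in>K. f \<circ> g \<in> K))"

definition coset_rep :: "('p \<Rightarrow> 'p) set \<Rightarrow> ('p \<Rightarrow> 'p) \<Rightarrow> 'p \<Rightarrow> 'p" where
  "coset_rep K h = (SOME g. g \<in> (\<lambda>\<kappa>. \<kappa> \<circ> h) ` K)"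

lemma bij_groupD:
  assumes "bij_group K"
  shows "id \<in> K" "f \<in> K \<Longrightarrow> bij f" "f \<in> K \<Longrightarrow> finv f \<in> K" "f \<in> K \<Longrightarrow> g \<in> K \<Longrightarrow> f \<circ> g \<in> K"
  using assms by (auto simp: bij_group_def)

context
  fixes K H :: "('p \<Rightarrow> 'p) set"
  assumes K: "bij_group K" and H: "bij_group H" and KH: "K \<subseteq> H"
begin

lemma rep_in: "h \<in> H \<Longrightarrow> \<exists>\<kappa>\<in>K. coset_rep K h = \<kappa> \<circ> h"
  using someI_ex[of "\<lambda>g. g \<in> (\<lambda>\<kappa>. \<kappa> \<circ> h) ` K"] bij_groupD(1)[OF K] unfolding coset_rep_def by blast

lemma rep_H: "h \<in> H \<Longrightarrow> coset_rep K h \<in> H"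
  using rep_in KH bij_groupD(4)[OF H] by fastforce

lemma rep_mult: "\<kappa> \<in> K \<Longrightarrow> h \<in> H \<Longrightarrow> coset_rep K (\<kappa> \<circ> h) = coset_rep K h"
proof -
  assume k: "\<kappa> \<in> K" and h: "h \<in> H"
  have "x \<circ> (\<kappa> \<circ> h) = (x \<circ> \<kappa>) \<circ> h" "x \<circ> h = (x \<circ> finv \<kappa>) \<circ> (\<kappa> \<circ> h)" for x
    using bij_groupD(2)[OF K k] by (simp_all add: comp_assoc bij_comp_inv)
  then have "(\<lambda>x. x \<circ> (\<kappa> \<circ> h)) ` K = (\<lambda>x. x \<circ> h) ` K"
    using bij_groupD[OF K] k by (safe; blast)
  then show ?thesis by (simp add: coset_rep_def)
qed

lemma rep_rep: "h \<in> H \<Longrightarrow> coset_rep K (coset_rep K h) = coset_rep K h"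
  using rep_in[of h] rep_mult by auto

lemma rep_quot: "h \<in> H \<Longrightarrow> h \<circ> finv (coset_rep K h) \<in> K"
proof -
  assume h: "h \<in> H"
  then obtain \<kappa> where k: "\<kappa> \<in> K" "coset_rep K h = \<kappa> \<circ> h" using rep_in by blast
  have bh: "bij h" "bij \<kappa>" using bij_groupD(2)[OF H h] bij_groupD(2)[OF K k(1)] by auto
  have "h \<circ> finv (coset_rep K h) = h \<circ> (finv h \<circ> finv \<kappa>)"
    unfolding k(2) using bh by (simp add: o_inv_distrib)
  also have "\<dots> = finv \<kappa>" using bh by (simp add: bij_comp_inv)
  finally show ?thesis using bij_groupD(3)[OF K k(1)] by simp
qed

lemma rep_eqD:
  assumes "h \<in> H" "g \<in> H" "coset_rep K (g \<circ> h) = coset_rep K h"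
  shows "g \<in> K"
proof -
  have gh: "g \<circ> h \<in> H" using assms bij_groupD(4)[OF H] by blast
  obtain a where a: "a \<in> K" "coset_rep K h = a \<circ> h" using rep_in assms by blast
  obtain b where b: "b \<in> K" "coset_rep K (g \<circ> h) = b \<circ> (g \<circ> h)" using rep_in gh by blast
  have "finv b \<circ> (a \<circ> h) \<circ> finv h = finv b \<circ> (b \<circ> (g \<circ> h)) \<circ> finv h"
    using a b assms by simp
  then have "finv b \<circ> a = g"
    using bij_groupD(2)[OF H assms(1)] bij_groupD(2)[OF K b(1)]
    by (simp add: comp_assoc bij_comp_inv)
  then show ?thesis using bij_groupD[OF K] a b by blast
qed

lemma card_eq_index: "card H = card (coset_rep K ` H) * card K"
proof -
  have "bij_betw (\<lambda>(v, \<kappa>). \<kappa> \<circ> v) (coset_rep K ` H \<times> K) H"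
  proof (rule bij_betw_byWitness[where f' = "\<lambda>h. (coset_rep K h, h \<circ> finv (coset_rep K h))"])
    show "\<forall>a\<in>coset_rep K ` H \<times> K. (\<lambda>h. (coset_rep K h, h \<circ> finv (coset_rep K h))) ((\<lambda>(v, \<kappa>). \<kappa> \<circ> v) a) = a"
      using rep_H bij_groupD(2)[OF H] by (auto simp: rep_mult rep_rep comp_assoc bij_comp_inv)
    show "\<forall>h\<in>H. (\<lambda>(v, \<kappa>). \<kappa> \<circ> v) (coset_rep K h, h \<circ> finv (coset_rep K h)) = h"
      using rep_H bij_groupD(2)[OF H] by (auto simp: comp_assoc bij_comp_inv)
    show "(\<lambda>(v, \<kappa>). \<kappa> \<circ> v) ` (coset_rep K ` H \<times> K) \<subseteq> H"
      using rep_H bij_groupD(4)[OF H] KH by auto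
    show "(\<lambda>h. (coset_rep K h, h \<circ> finv (coset_rep K h))) ` H \<subseteq> coset_rep K ` H \<times> K"
      using rep_quot by auto
  qed
  from bij_betw_same_card[OF this] show ?thesis by (simp add: card_cartesian_product)
qed

end

text \<open>
  Let \<open>\<tau>\<close> conjugate \<open>K False\<close> onto \<open>K True\<close>. Reading \<open>t\<close> or its inverse in the HNN extension turns
  an element \<open>h\<close> into a coset representative, which names the edge that is used, and the
  remaining element of the associated subgroup, which is carried over to the other side. The
  two kinds of coset representatives are matched by a bijection \<open>\<beta>\<close>, so \<open>lb\<close> names each edge in
  the same way from both of its ends, and \<open>nx\<close> is the element on arrival. An edge is traversed back
  immediately only if the element read in between lies in the associated subgroup.
\<close>

lemma hnn_data:
  fixes H :: "('p \<Rightarrow> 'p) set" and K :: "bool \<Rightarrow> ('p \<Rightarrow> 'p) set"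
  assumes H: "bij_group H" "finite H" and K: "\<And>e. bij_group (K e)" "\<And>e. K e \<subseteq> H"
    and \<tau>: "bij \<tau>" and conj: "K True = (\<lambda>\<kappa>. \<tau> \<circ> \<kappa> \<circ> finv \<tau>) ` K False"
  shows "\<exists>(lb :: bool \<Rightarrow> ('p \<Rightarrow> 'p) \<Rightarrow> 'p \<Rightarrow> 'p) nx.
    (\<forall>e. \<forall>h\<in>H. nx e h \<in> H) \<and>
    (\<forall>e. \<forall>h\<in>H. \<forall>\<kappa>\<in>K e. lb (\<not> e) (\<kappa> \<circ> nx e h) = lb e h) \<and>
    (\<forall>e. \<forall>h\<in>H. \<forall>g\<in>H. lb (\<not> e) (g \<circ> nx e h) = lb e h \<longrightarrow> g \<in> K e) \<and>
    (\<forall>e. \<forall>h\<in>H. nx (\<not> e) (nx e h) = h) \<and>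
    (\<forall>h\<in>H. \<forall>\<kappa>\<in>K True. nx False (\<kappa> \<circ> nx True h) = finv \<tau> \<circ> \<kappa> \<circ> \<tau> \<circ> h)"
proof -
  define V where "V e = coset_rep (K (\<not> e)) ` H" for e
  note rH = rep_H[OF K(1) H(1) K(2)]
    and rmult = rep_mult[OF K(1) H(1) K(2)] and rrep = rep_rep[OF K(1) H(1) K(2)]
    and rquot = rep_quot[OF K(1) H(1) K(2)] and reqD = rep_eqD[OF K(1) H(1) K(2)]
  have "inj_on (\<lambda>\<kappa>. \<tau> \<circ> \<kappa> \<circ> finv \<tau>) (K False)"
  proof (rule inj_on_inverseI)
    show "finv \<tau> \<circ> (\<tau> \<circ> \<kappa> \<circ> finv \<tau>) \<circ> \<tau> = \<kappa>" for \<kappa>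
      using \<tau> by (simp add: comp_assoc bij_comp_inv)
  qed
  then have cK: "card (K True) = card (K False)" using conj by (simp add: card_image)
  have "0 < card (K False)"
    using H(2) K finite_subset bij_groupD(1)[OF K(1)] by (metis card_gt_0_iff empty_iff)
  moreover have "card (V False) * card (K False) = card (V True) * card (K False)"
    using card_eq_index[OF K(1)[of True] H(1) K(2)] card_eq_index[OF K(1)[of False] H(1) K(2)] cK
    by (auto simp: V_def)
  ultimately have "card (V False) = card (V True)" by simp
  moreover have "finite (V e)" for e using H(2) by (simp add: V_def)
  ultimately obtain \<beta> where \<beta>: "bij_betw \<beta> (V True) (V False)"
    by (metis finite_same_card_bij)
  define \<beta>' where "\<beta>' = the_inv_into (V True) \<beta>"
  have \<beta>': "bij_betw \<beta>' (V False) (V True)" "\<And>v. v \<in> V True \<Longrightarrow> \<beta>' (\<beta> v) = v" "\<And>v. v \<in> V False \<Longrightarrow> \<beta> (\<beta>' v) = v"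
    unfolding \<beta>'_def using \<beta> bij_betw_the_inv_into[OF \<beta>] the_inv_into_f_f[of \<beta> "V True"]
      f_the_inv_into_f_bij_betw[OF \<beta>] by (auto simp: bij_betw_def)
  define b where "b e = (if e then \<beta> else \<beta>')" for e
  have b: "b e v \<in> V (\<not> e)" "b (\<not> e) (b e v) = v" if "v \<in> V e" for e v
    using that \<beta>' \<beta> by (cases e; auto simp: b_def bij_betw_def)+
  define \<phi> where "\<phi> e \<kappa> = (if e then \<tau> \<circ> \<kappa> \<circ> finv \<tau> else finv \<tau> \<circ> \<kappa> \<circ> \<tau>)" for e \<kappa>
  have \<phi>: "\<phi> e \<kappa> \<in> K e" "\<phi> (\<not> e) (\<phi> e \<kappa>) = \<kappa>" if "\<kappa> \<in> K (\<not> e)" for e \<kappa>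
  proof -
    have "\<tau> \<circ> \<kappa> \<circ> finv \<tau> \<in> K True" if "\<kappa> \<in> K False" for \<kappa> using that conj by auto
    moreover have "finv \<tau> \<circ> \<kappa> \<circ> \<tau> \<in> K False" if "\<kappa> \<in> K True" for \<kappa>
      using that \<tau> by (auto simp: conj comp_assoc bij_comp_inv)
    ultimately show "\<phi> e \<kappa> \<in> K e" using that by (cases e) (auto simp: \<phi>_def)
    show "\<phi> (\<not> e) (\<phi> e \<kappa>) = \<kappa>" using \<tau> by (cases e) (auto simp: \<phi>_def comp_assoc bij_comp_inv)
  qed
  define rp where "rp e h = coset_rep (K (\<not> e)) h" for e h
  define lb where "lb e h = (if e then rp e h else b e (rp e h))" for e h
  define nx where "nx e h = \<phi> e (h \<circ> finv (rp e h)) \<circ> b e (rp e h)" for e h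
  have rpV: "rp e h \<in> V e" if "h \<in> H" for e h using that by (simp add: rp_def V_def)
  have VH: "V e \<subseteq> H" for e using rH by (auto simp: V_def)
  have rpid: "rp e v = v" if "v \<in> V e" for e v using that rrep by (auto simp: V_def rp_def)
  have q: "h \<circ> finv (rp e h) \<in> K (\<not> e)" if "h \<in> H" for e h using rquot that by (simp add: rp_def)
  have bin: "b e (rp e h) \<in> V (\<not> e)" "b e (rp e h) \<in> H" if "h \<in> H" for e h
    using b rpV that VH by blast+
  have rpn: "rp (\<not> e) (\<kappa> \<circ> nx e h) = b e (rp e h)" if "h \<in> H" "\<kappa> \<in> K e" for e h \<kappa>
  proof -
    have "\<kappa> \<circ> \<phi> e (h \<circ> finv (rp e h)) \<in> K e" using that q \<phi>(1) bij_groupD(4)[OF K(1)] by blast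
    then have "coset_rep (K e) ((\<kappa> \<circ> \<phi> e (h \<circ> finv (rp e h))) \<circ> b e (rp e h)) = coset_rep (K e) (b e (rp e h))"
      using bin that by (intro rmult) auto
    moreover have "coset_rep (K e) (b e (rp e h)) = b e (rp e h)"
      using rpid[of "b e (rp e h)" "\<not> e"] bin that by (simp add: rp_def)
    ultimately show ?thesis by (simp add: rp_def nx_def comp_assoc)
  qed
  show ?thesis
  proof (rule exI[of _ lb], rule exI[of _ nx], intro conjI allI ballI impI)
    show nxH: "nx e h \<in> H" if "h \<in> H" for e h
      unfolding nx_def using that bin q \<phi>(1) K(2) bij_groupD(4)[OF H(1)] by blast
    show "lb (\<not> e) (\<kappa> \<circ> nx e h) = lb e h" if "h \<in> H" "\<kappa> \<in> K e" for e h \<kappa>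
      using rpn[OF that] b(2)[OF rpV[OF that(1)], of e] by (cases e) (auto simp: lb_def)
    show "g \<in> K e" if h: "h \<in> H" and g: "g \<in> H" and eq: "lb (\<not> e) (g \<circ> nx e h) = lb e h" for e h g
    proof -
      have nh: "nx e h \<in> H" "g \<circ> nx e h \<in> H" using nxH h g bij_groupD(4)[OF H(1)] by blast+
      have "rp (\<not> e) (g \<circ> nx e h) = b e (rp e h)"
      proof (cases e)
        case True
        then show ?thesis
          using eq b(2)[OF rpV[OF nh(2)], of False] by (auto simp: lb_def)
      next
        case False
        then show ?thesis using eq by (simp add: lb_def)
      qed
      also have "\<dots> = rp (\<not> e) (nx e h)"
        using rpn[OF h bij_groupD(1)[OF K(1)], of e] by simp
      finally show ?thesis using reqD[OF nh(1) g, of e] by (simp add: rp_def)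
    qed
    have key: "nx (\<not> e) (\<kappa> \<circ> nx e h) = \<phi> (\<not> e) (\<kappa> \<circ> \<phi> e (h \<circ> finv (rp e h))) \<circ> rp e h"
      if "h \<in> H" "\<kappa> \<in> K e" for e h \<kappa>
    proof -
      have "bij (b e (rp e h))" using bin that bij_groupD(2)[OF H(1)] by blast
      then have "\<kappa> \<circ> nx e h \<circ> finv (b e (rp e h)) = \<kappa> \<circ> \<phi> e (h \<circ> finv (rp e h))"
        by (simp add: nx_def comp_assoc bij_comp_inv)
      then show ?thesis
        using rpn[OF that] b(2)[OF rpV[OF that(1)]] by (simp add: nx_def)
    qed
    show "nx (\<not> e) (nx e h) = h" if "h \<in> H" for e h
    proof -
      have "bij (rp e h)" using that rpV VH bij_groupD(2)[OF H(1)] by blast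
      then show ?thesis
        using key[OF that bij_groupD(1)[OF K(1)], of e] \<phi>(2)[OF q[OF that]] by (simp add: comp_assoc bij_comp_inv)
    qed
    show "nx False (\<kappa> \<circ> nx True h) = finv \<tau> \<circ> \<kappa> \<circ> \<tau> \<circ> h" if "h \<in> H" "\<kappa> \<in> K True" for h \<kappa>
    proof -
      have "bij (rp True h)" using that rpV VH bij_groupD(2)[OF H(1)] by blast
      then show ?thesis
        using key[OF that] \<tau> by (simp add: \<phi>_def comp_assoc bij_comp_inv)
    qed
  qed
qed

lemma bij_group_act:
  assumes "\<And>g. bij (\<theta> g)"
  shows "bij_group (act \<theta> ` conj_words I)"
  unfolding bij_group_def
proof (intro conjI ballI)
  have "id = act \<theta> []" by (simp add: fun_eq_iff)
  then show "id \<in> act \<theta> ` conj_words I" using conj_words.Nil by blast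
qed (auto simp: act_bij assms act_append[symmetric] intro: conj_words_inverse_word conj_words_append)

text \<open>
  The list \<open>[(w\<^sub>1, e\<^sub>1), (w\<^sub>2, e\<^sub>2), \<dots>]\<close> stands for \<open>w\<^sub>1 t\<^sup>e\<^sup>1 w\<^sub>2 t\<^sup>e\<^sup>2 \<dots>\<close>. With \<open>N e\<close> the associated
  subgroups, the condition is that of Britton's lemma.
\<close>

definition nonbacktracking :: "(bool \<Rightarrow> word set) \<Rightarrow> (word \<times> bool) list \<Rightarrow> bool" where
  "nonbacktracking N = successively (\<lambda>p q. snd p \<noteq> snd q \<longrightarrow> fst q \<notin> N (snd p))"

text \<open>
  The points are pairs of a vertex of a finite graph and an element of the finite group \<open>H\<close>.
  The generator \<open>a\<close> multiplies the second component. The generator \<open>t\<close> moves along the edge that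
  \<open>hnn_data\<close> assigns to the second component. Hence \<open>H\<close> acts by multiplication, and the first
  component of a word without backtracking follows a reduced word in the edges, which moves some
  vertex as long as it has at most \<open>R\<close> letters.
\<close>

lemma finite_hnn_action:
  fixes \<theta> :: "bool \<Rightarrow> 'p \<Rightarrow> 'p" and k R :: nat
  assumes \<theta>: "\<And>g. bij (\<theta> g)" and fin: "finite (act \<theta> ` conj_words {..k})"
  shows "\<exists>(X :: (((('p \<Rightarrow> 'p) \<times> bool) list \<times> nat) \<times> ('p \<Rightarrow> 'p)) set) \<xi>.
      finite X \<and> X \<noteq> {} \<and> (\<forall>g. \<xi> g permutes X) \<and>
      (\<forall>w \<in> conj_words {..k}. \<forall>w' \<in> conj_words {..k}. act \<theta> w = act \<theta> w' \<longrightarrow> (\<forall>x\<in>X. act \<xi> w x = act \<xi> w' x)) \<and>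
      (\<forall>ps. \<forall>w \<in> conj_words {..k}. ps \<noteq> [] \<longrightarrow> length ps \<le> R \<longrightarrow> fst ` set ps \<subseteq> conj_words {..k} \<longrightarrow>
         nonbacktracking (\<lambda>e. {u. act \<theta> u \<in> act \<theta> ` conj_words (assoc_index k e)}) ps \<longrightarrow>
         (\<exists>x\<in>X. act \<xi> (syllables ps @ w) x \<noteq> x))"
proof -
  define H where "H = act \<theta> ` conj_words {..k}"
  define K where "K e = act \<theta> ` conj_words (assoc_index k e)" for e
  define \<tau> where "\<tau> = \<theta> True"
  have H: "bij_group H" "finite H" and K: "\<And>e. bij_group (K e)" and \<tau>: "bij \<tau>"
    using fin by (simp_all add: H_def K_def \<tau>_def bij_group_act \<theta>)
  have compH: "f \<circ> g \<in> H" if "f \<in> H" "g \<in> H" for f g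
    using bij_groupD(4)[OF H(1)] that by blast
  have "conj_words (assoc_index k e) \<subseteq> conj_words {..k}" for e
  proof -
    have "assoc_index k e \<subseteq> {..k}" by (auto simp: assoc_index_def)
    then show ?thesis using conj_words_mono by blast
  qed
  then have KH: "K e \<subseteq> H" for e by (auto simp: K_def H_def)
  have cc: "\<tau> \<circ> (finv \<tau> \<circ> f \<circ> \<tau>) \<circ> finv \<tau> = f" for f
    using \<tau> by (simp add: comp_assoc bij_comp_inv)
  have conj: "K True = (\<lambda>\<kappa>. \<tau> \<circ> \<kappa> \<circ> finv \<tau>) ` K False"
  proof (intro equalityI subsetI)
    fix f assume "f \<in> K True"
    then obtain u where u: "u \<in> conj_words {..<k}" "f = act \<theta> u" by (auto simp: K_def assoc_index_def)
    then obtain u' where u': "u' \<in> conj_words (Suc ` {..<k})" "act \<theta> u' = finv \<tau> \<circ> act \<theta> u \<circ> \<tau>"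
      using conj_words_shift(1)[where \<theta> = \<theta>, OF \<theta> u(1)] by (auto simp: \<tau>_def)
    show "f \<in> (\<lambda>\<kappa>. \<tau> \<circ> \<kappa> \<circ> finv \<tau>) ` K False"
    proof (rule image_eqI)
      show "f = \<tau> \<circ> act \<theta> u' \<circ> finv \<tau>" by (simp only: u' u(2) cc)
      show "act \<theta> u' \<in> K False"
        unfolding K_def using u'(1) by (intro imageI) (simp add: assoc_index_def image_Suc_lessThan)
    qed
  next
    fix f assume "f \<in> (\<lambda>\<kappa>. \<tau> \<circ> \<kappa> \<circ> finv \<tau>) ` K False"
    then obtain u where u: "u \<in> conj_words (Suc ` {..<k})" "f = \<tau> \<circ> act \<theta> u \<circ> finv \<tau>"
      by (auto simp: K_def assoc_index_def image_Suc_lessThan)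
    then obtain u' where u': "u' \<in> conj_words {..<k}" "act \<theta> u' = \<tau> \<circ> act \<theta> u \<circ> finv \<tau>"
      using conj_words_shift(2)[where \<theta> = \<theta>, OF \<theta> u(1)] unfolding \<tau>_def by blast
    have "f = act \<theta> u'" by (simp only: u' u(2))
    then show "f \<in> K True" using u'(1) by (simp add: K_def assoc_index_def)
  qed
  obtain lb nx :: "bool \<Rightarrow> ('p \<Rightarrow> 'p) \<Rightarrow> 'p \<Rightarrow> 'p" where data: "(\<forall>e. \<forall>h\<in>H. nx e h \<in> H) \<and>
    (\<forall>e. \<forall>h\<in>H. \<forall>\<kappa>\<in>K e. lb (\<not> e) (\<kappa> \<circ> nx e h) = lb e h) \<and>
    (\<forall>e. \<forall>h\<in>H. \<forall>g\<in>H. lb (\<not> e) (g \<circ> nx e h) = lb e h \<longrightarrow> g \<in> K e) \<and>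
    (\<forall>e. \<forall>h\<in>H. nx (\<not> e) (nx e h) = h) \<and>
    (\<forall>h\<in>H. \<forall>\<kappa>\<in>K True. nx False (\<kappa> \<circ> nx True h) = finv \<tau> \<circ> \<kappa> \<circ> \<tau> \<circ> h)"
    using hnn_data[OF H K KH \<tau> conj] by (elim exE)
  have nxH: "nx e h \<in> H"
    and lb1: "\<kappa> \<in> K e \<Longrightarrow> lb (\<not> e) (\<kappa> \<circ> nx e h) = lb e h"
    and lb2: "g \<in> H \<Longrightarrow> lb (\<not> e) (g \<circ> nx e h) = lb e h \<Longrightarrow> g \<in> K e"
    and nx1: "nx (\<not> e) (nx e h) = h"
    and nx2: "\<kappa> \<in> K True \<Longrightarrow> nx False (\<kappa> \<circ> nx True h) = finv \<tau> \<circ> \<kappa> \<circ> \<tau> \<circ> h"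
    if "h \<in> H" for e h g \<kappa>
    using data that by blast+
  define L where "L = (\<lambda>(e, h). lb e h) ` (UNIV \<times> H)"
  have "finite L" using H by (simp add: L_def)
  from reduced_words_move[OF this, of R] obtain Y :: "((('p \<Rightarrow> 'p) \<times> bool) list \<times> nat) set" and \<sigma> where
    Y0: "finite Y \<and> Y \<noteq> {} \<and> (\<forall>v. \<sigma> v permutes Y) \<and>
    (\<forall>ls. reduced ls \<longrightarrow> ls \<noteq> [] \<longrightarrow> length ls \<le> R \<longrightarrow> fst ` set ls \<subseteq> L \<longrightarrow> (\<exists>y\<in>Y. run \<sigma> ls y \<noteq> y))"
    by (elim exE)
  then have Y: "finite Y" "\<sigma> v permutes Y" "Y \<noteq> {}" 
    and move: "reduced ls \<Longrightarrow> ls \<noteq> [] \<Longrightarrow> length ls \<le> R \<Longrightarrow> fst ` set ls \<subseteq> L \<Longrightarrow> \<exists>y\<in>Y. run \<sigma> ls y \<noteq> y"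
    for v ls by blast+
  define X where "X = Y \<times> H"
  define sg where "sg e v = (if e then \<sigma> v else finv (\<sigma> v))" for e v
  have sgY: "sg e v y \<in> Y \<longleftrightarrow> y \<in> Y" for e v y
    using Y(2) by (simp add: sg_def permutes_in_image permutes_inv)
  have sgi: "sg (\<not> e) v (sg e v y) = y" for e v y
    using permutes_inverses[OF Y(2)] by (cases e) (simp_all add: sg_def)
  \<comment> \<open>the action of \<open>t\<close> and its inverse\<close>
  define tt where "tt e x = (sg e (lb e (snd x)) (fst x), nx e (snd x))" for e x
  have ttX: "tt e x \<in> X" if "x \<in> X" for e x
    using that nxH by (auto simp: tt_def X_def sgY)
  have lb0: "lb (\<not> e) (nx e h) = lb e h" if "h \<in> H" for e h
    using lb1[OF that bij_groupD(1)[OF K], of e] by simp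
  have tti: "tt (\<not> e) (tt e x) = x" if "x \<in> X" for e x
    using that by (auto simp: tt_def X_def lb0 nx1 sgi)
  define \<xi> where "\<xi> g x = (if x \<in> X then if g then tt True x else (fst x, \<theta> False \<circ> snd x) else x)" for g x
  have aH: "\<theta> False \<in> H" "finv (\<theta> False) \<in> H"
  proof -
    have "act \<theta> (conj_letter 0 True) = \<theta> False" "act \<theta> (conj_letter 0 False) = finv (\<theta> False)"
      by (simp_all add: fun_eq_iff conj_letter_def act_letter_def)
    then show "\<theta> False \<in> H" "finv (\<theta> False) \<in> H" unfolding H_def using conj_words_letter[of 0 "{..k}"] by (metis atMost_iff image_eqI le0)+
  qed
  define \<xi>' where "\<xi>' g x = (if x \<in> X then if g then tt False x else (fst x, finv (\<theta> False) \<circ> snd x) else x)" for g x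
  have aX: "(fst x, \<theta> False \<circ> snd x) \<in> X" "(fst x, finv (\<theta> False) \<circ> snd x) \<in> X" if "x \<in> X" for x
    using that aH bij_groupD(4)[OF H(1)] by (auto simp: X_def)
  have inv1: "\<xi> g (\<xi>' g x) = x" "\<xi>' g (\<xi> g x) = x" for g x
    using tti[of x True] tti[of x False] ttX[of x True] ttX[of x False] aX[of x]
    by (simp_all add: \<xi>_def \<xi>'_def bij_comp_inv[OF \<theta>])
  then have inv: "finv (\<xi> g) = \<xi>' g" for g
    by (intro inv_unique_comp) (auto simp: fun_eq_iff)
  have perm: "\<xi> g permutes X" for g
  proof -
    have "\<exists>!x. \<xi> g x = y" for y using inv1 by metis
    then show ?thesis by (auto simp: permutes_def \<xi>_def)
  qed
  have stepT: "act_letter \<xi> (True, e) x = tt e x" if "x \<in> X" for e x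
    using that by (cases e) (simp_all add: act_letter_def inv \<xi>_def \<xi>'_def)
  have letter: "act \<xi> (conj_letter i s) (y, h) = (y, act \<theta> (conj_letter i s) \<circ> h)"
    if "i \<le> k" "y \<in> Y" "h \<in> H" for i s y h
    using that
  proof (induction i arbitrary: y h)
    case 0
    then have "(y, h) \<in> X" by (simp add: X_def)
    moreover have "act \<xi> (conj_letter 0 s) (y, h) = (if s then \<xi> False else \<xi>' False) (y, h)"
      by (simp add: conj_letter_def act_letter_def inv)
    moreover have "act \<theta> (conj_letter 0 s) = (if s then \<theta> False else finv (\<theta> False))"
      by (simp add: conj_letter_def act_letter_def fun_eq_iff)
    moreover have "\<xi> False (y, h) = (y, \<theta> False \<circ> h)" "\<xi>' False (y, h) = (y, finv (\<theta> False) \<circ> h)"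
      if "(y, h) \<in> X" using that by (simp_all add: \<xi>_def \<xi>'_def)
    ultimately show ?case by (cases s) (simp_all add: comp_def)
  next
    case (Suc i)
    define \<kappa> where "\<kappa> = act \<theta> (conj_letter i s)"
    have \<kappa>: "\<kappa> \<in> K True"
      unfolding \<kappa>_def K_def using Suc.prems by (intro imageI conj_words_letter) (simp add: assoc_index_def)
    have x: "(y, h) \<in> X" using Suc.prems by (simp add: X_def)
    define y' where "y' = sg True (lb True h) y"
    have y': "y' \<in> Y" using Suc.prems by (simp add: y'_def sgY)
    have "conj_letter (Suc i) s = (True, True) # conj_letter i s @ [(True, False)]"
      by (simp add: conj_letter_def replicate_append_same)
    then have "act \<xi> (conj_letter (Suc i) s) (y, h) = act_letter \<xi> (True, False) (act \<xi> (conj_letter i s) (act_letter \<xi> (True, True) (y, h)))"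
      by simp
    also have "\<dots> = act_letter \<xi> (True, False) (act \<xi> (conj_letter i s) (y', nx True h))"
      by (simp add: stepT[OF x] tt_def y'_def)
    also have "\<dots> = act_letter \<xi> (True, False) (y', \<kappa> \<circ> nx True h)"
      using Suc.prems y' nxH by (simp add: Suc.IH \<kappa>_def comp_def)
    also have "\<dots> = tt False (y', \<kappa> \<circ> nx True h)"
    proof (rule stepT)
      have "\<kappa> \<circ> nx True h \<in> H"
        using \<kappa> KH nxH Suc.prems(3) by (intro compH) blast+
      with y' show "(y', \<kappa> \<circ> nx True h) \<in> X" by (simp add: X_def)
    qed
    also have "\<dots> = (y, finv \<tau> \<circ> \<kappa> \<circ> \<tau> \<circ> h)"
      using lb1[OF Suc.prems(3) \<kappa>] nx2[OF Suc.prems(3) \<kappa>] sgi[of True "lb True h" y]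
      by (simp add: tt_def y'_def)
    also have "finv \<tau> \<circ> \<kappa> \<circ> \<tau> = act \<theta> (conj_letter (Suc i) s)"
      by (simp add: \<kappa>_def \<tau>_def act_conj_letter_Suc[OF \<theta>])
    finally show ?case .
  qed
  have wordH: "act \<theta> w \<in> H" if "w \<in> conj_words {..k}" for w using that by (simp add: H_def)
  have actH: "act \<xi> w (y, h) = (y, act \<theta> w \<circ> h)" if "w \<in> conj_words {..k}" "y \<in> Y" "h \<in> H" for w y h
    using that
  proof (induction arbitrary: h rule: conj_words.induct)
    case Nil
    then show ?case by (simp add: fun_eq_iff)
  next
    case (Cons i w s)
    have "act \<theta> (conj_letter i s) \<circ> h \<in> H"
      using Cons wordH[OF conj_words_letter] bij_groupD(4)[OF H(1)] by blast
    with Cons show ?case by (simp add: letter act_append comp_def)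
  qed
  \<comment> \<open>the edges that a word follows when it starts at a point with second component \<open>h\<close>\<close>
  define labels where "labels = rec_list (\<lambda>_. []) (\<lambda>p _ r h. (lb (snd p) (act \<theta> (fst p) \<circ> h), snd p) # r (nx (snd p) (act \<theta> (fst p) \<circ> h)))"
  have labels: "labels [] h = []"
    "labels ((w, e) # ps) h = (lb e (act \<theta> w \<circ> h), e) # labels ps (nx e (act \<theta> w \<circ> h))" for w e ps h
    by (simp_all add: labels_def)
  have syl: "\<exists>h'\<in>H. act \<xi> (syllables ps) (y, h) = (run \<sigma> (labels ps h) y, h')"
    if "fst ` set ps \<subseteq> conj_words {..k}" "y \<in> Y" "h \<in> H" for ps y h
    using that
  proof (induction ps arbitrary: y h)
    case Nil
    then show ?case by (simp add: syllables_def labels run_def)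
  next
    case (Cons p ps)
    obtain w e where p: "p = (w, e)" by fastforce
    define h1 where "h1 = act \<theta> w \<circ> h"
    have w: "w \<in> conj_words {..k}" using Cons.prems p by simp
    have h1: "h1 \<in> H" unfolding h1_def by (intro compH wordH w Cons.prems)
    have "act \<xi> (syllables (p # ps)) (y, h) = act \<xi> (syllables ps) (act_letter \<xi> (True, e) (y, h1))"
      using Cons.prems w by (simp add: syllables_def p actH h1_def)
    also have "act_letter \<xi> (True, e) (y, h1) = (sg e (lb e h1) y, nx e h1)"
      using stepT[of "(y, h1)" e] Cons.prems h1 by (simp add: X_def tt_def)
    finally show ?case
      using Cons.IH[of "sg e (lb e h1) y" "nx e h1"] Cons.prems h1 nxH
      by (auto simp: p labels run_def sg_def h1_def[symmetric] sgY[of e "lb e h1" y, unfolded sg_def])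
  qed
  have lablen: "length (labels ps h) = length ps" for ps h
    by (induction ps arbitrary: h) (auto simp: labels)
  have labL: "fst ` set (labels ps h) \<subseteq> L" if "fst ` set ps \<subseteq> conj_words {..k}" "h \<in> H" for ps h
    using that
  proof (induction ps arbitrary: h)
    case (Cons p ps)
    obtain w e where p: "p = (w, e)" by fastforce
    have "act \<theta> w \<circ> h \<in> H" by (intro compH wordH) (use p Cons.prems in auto)
    with Cons nxH show ?case by (auto simp: p labels L_def)
  qed (simp add: labels)
  have labred: "reduced (labels ps h)"
    if "fst ` set ps \<subseteq> conj_words {..k}" "h \<in> H" "nonbacktracking (\<lambda>e. {u. act \<theta> u \<in> K e}) ps" for ps h
    using that
  proof (induction ps arbitrary: h)
    case Nil
    then show ?case by (simp add: labels reduced_def)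
  next
    case (Cons p ps)
    obtain w e where p: "p = (w, e)" by fastforce
    define h1 where "h1 = act \<theta> w \<circ> h"
    have h1: "h1 \<in> H" unfolding h1_def by (intro compH wordH) (use p Cons.prems in auto)
    have IH: "reduced (labels ps (nx e h1))"
      using Cons.prems h1 nxH by (intro Cons.IH) (auto simp: nonbacktracking_def successively_Cons)
    show ?case
    proof (cases ps)
      case Nil
      then show ?thesis by (simp add: p labels reduced_def)
    next
      case (Cons q qs)
      obtain w' e' where q: "q = (w', e')" by fastforce
      have nb: "e \<noteq> e' \<Longrightarrow> act \<theta> w' \<notin> K e" and w': "w' \<in> conj_words {..k}"
        using Cons.prems by (auto simp: nonbacktracking_def Cons p q)
      have "e = e'" if "lb e h1 = lb e' (act \<theta> w' \<circ> nx e h1)"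
      proof (rule ccontr)
        assume ne: "e \<noteq> e'"
        then have "e' = (\<not> e)" by auto
        with that lb2[OF h1 wordH[OF w'], of e] nb ne show False by simp
      qed
      then show ?thesis
        using IH by (simp add: p labels Cons q reduced_def h1_def)
    qed
  qed
  show ?thesis
  proof (rule exI[of _ X], rule exI[of _ \<xi>], intro conjI allI ballI impI)
    show "finite X" "X \<noteq> {}" using Y H bij_groupD(1)[OF H(1)] by (auto simp: X_def)
    show "\<xi> g permutes X" for g by (rule perm)
    show "act \<xi> w x = act \<xi> w' x" if "w \<in> conj_words {..k}" "w' \<in> conj_words {..k}" "act \<theta> w = act \<theta> w'" "x \<in> X" for w w' x
      using that by (auto simp: X_def actH)
  next
    fix ps w
    assume ps: "ps \<noteq> []" "length ps \<le> R" "fst ` set ps \<subseteq> conj_words {..k}" and w: "w \<in> conj_words {..k}"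
      and "nonbacktracking (\<lambda>e. {u. act \<theta> u \<in> act \<theta> ` conj_words (assoc_index k e)}) ps"
    then have nb: "nonbacktracking (\<lambda>e. {u. act \<theta> u \<in> K e}) ps" by (simp add: K_def)
    have id: "id \<in> H" using bij_groupD(1)[OF H(1)] .
    have "labels ps id \<noteq> []" using lablen[of ps id] ps(1) by auto
    then obtain y where y: "y \<in> Y" "run \<sigma> (labels ps id) y \<noteq> y"
      using move[OF labred[OF ps(3) id nb]] labL[OF ps(3) id] lablen[of ps id] ps(2) by auto
    obtain h' where h': "h' \<in> H" "act \<xi> (syllables ps) (y, id) = (run \<sigma> (labels ps id) y, h')"
      using syl[OF ps(3) y(1) id] by blast
    have "run \<sigma> (labels ps id) y' \<in> Y" if "y' \<in> Y" for y'
    proof -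
      have "run \<sigma> ls z \<in> Y" if "z \<in> Y" for ls z
        using that
      proof (induction ls arbitrary: z)
        case (Cons l ls)
        have "run \<sigma> (l # ls) z = run \<sigma> ls (sg (snd l) (fst l) z)" by (simp add: run_def sg_def)
        with Cons sgY show ?case by simp
      qed (simp add: run_def)
      from this[OF that] show ?thesis .
    qed
    with h' y w have "fst (act \<xi> (syllables ps @ w) (y, id)) \<noteq> y" by (simp add: actH)
    then have "act \<xi> (syllables ps @ w) (y, id) \<noteq> (y, id)" by auto
    moreover have "(y, id) \<in> X" using y id by (simp add: X_def)
    ultimately show "\<exists>x\<in>X. act \<xi> (syllables ps @ w) x \<noteq> x" by blast
  qed
qed

section \<open>The tower of finite permutation groups\<close>

lemma adjoin_block:
  fixes \<theta> :: "bool \<Rightarrow> nat \<Rightarrow> nat" and \<xi> :: "bool \<Rightarrow> 'x \<Rightarrow> 'x"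
  assumes \<theta>: "\<And>g. \<theta> g permutes {..<m}" and \<xi>: "\<And>g. \<xi> g permutes X" and X: "finite X" "X \<noteq> {}"
  shows "\<exists>m' \<theta>' f. m < m' \<and> (\<forall>g. \<theta>' g permutes {..<m'}) \<and> (\<forall>g. \<forall>x<m. \<theta>' g x = \<theta> g x) \<and>
    bij_betw f X {m..<m'} \<and> (\<forall>w. \<forall>x\<in>X. act \<theta>' w (f x) = f (act \<xi> w x))"
proof -
  define m' where "m' = m + card X"
  have "\<exists>f. bij_betw f X {m..<m'}"
    by (rule finite_same_card_bij) (simp_all add: m'_def X)
  then obtain f where f: "bij_betw f X {m..<m'}" ..
  define f' where "f' = the_inv_into X f"
  have f': "bij_betw f' {m..<m'} X" "\<And>x. x \<in> X \<Longrightarrow> f' (f x) = x"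
    unfolding f'_def
    by (rule bij_betw_the_inv_into[OF f]) (rule the_inv_into_f_f[OF bij_betw_imp_inj_on[OF f]])
  define \<theta>' where "\<theta>' g x = (if x < m then \<theta> g x else if x < m' then f (\<xi> g (f' x)) else x)" for g x
  have perm: "\<theta>' g permutes {..<m'}" for g
  proof -
    have "bij_betw (\<theta> g) {..<m} {..<m}" using \<theta> by (simp add: permutes_imp_bij)
    then have "bij_betw (\<theta>' g) {..<m} {..<m}"
      by (rule bij_betw_cong[THEN iffD1, rotated]) (simp add: \<theta>'_def)
    moreover have "bij_betw (f \<circ> (\<xi> g \<circ> f')) {m..<m'} {m..<m'}"
      by (rule bij_betw_trans[OF bij_betw_trans[OF f'(1) permutes_imp_bij[OF \<xi>]] f])
    then have "bij_betw (\<theta>' g) {m..<m'} {m..<m'}"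
      by (rule bij_betw_cong[THEN iffD1, rotated]) (simp add: \<theta>'_def)
    ultimately have "bij_betw (\<theta>' g) ({..<m} \<union> {m..<m'}) ({..<m} \<union> {m..<m'})"
      by (rule bij_betw_combine) auto
    moreover have "{..<m} \<union> {m..<m'} = {..<m'}" by (auto simp: m'_def)
    ultimately show ?thesis by (intro bij_imp_permutes) (auto simp: \<theta>'_def m'_def)
  qed
  have "act \<theta>' w (f x) = f (act \<xi> w x)" if "x \<in> X" for w x
  proof (rule act_transfer[where j = f and \<theta> = \<xi> and \<theta>' = \<theta>', OF \<xi> _ _ that])
    show "bij (\<theta>' g)" for g using perm by (rule permutes_bij)
    show "\<theta>' g (f y) = f (\<xi> g y)" if "y \<in> X" for g y
      using bij_betwE[OF f] that f'(2) by (auto simp: \<theta>'_def)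
  qed
  moreover have "m < m'" using X by (simp add: m'_def card_gt_0_iff)
  moreover have "\<theta>' g x = \<theta> g x" if "x < m" for g x using that by (simp add: \<theta>'_def)
  ultimately show ?thesis using perm f by blast
qed

lemma nonbacktracking_mono:
  assumes "nonbacktracking N ps" "\<And>p e. p \<in> set ps \<Longrightarrow> fst p \<in> N' e \<Longrightarrow> fst p \<in> N e"
  shows "nonbacktracking N' ps"
  using assms unfolding nonbacktracking_def successively_conv_nth by (metis Suc_lessD nth_mem)

text \<open>
  The third condition says that words in \<open>a\<^sub>0, \<dots>, a\<^sub>k\<close> that agree on the old points agree on the new
  ones, the last one that short words without backtracking are not in \<open>\<langle>a\<^sub>0, \<dots>, a\<^sub>k\<rangle>\<close>.
\<close>

definition next_stage :: "nat \<Rightarrow> nat \<Rightarrow> nat \<times> (bool \<Rightarrow> nat \<Rightarrow> nat) \<Rightarrow> nat \<times> (bool \<Rightarrow> nat \<Rightarrow> nat) \<Rightarrow> bool" where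
  "next_stage k R s s' \<longleftrightarrow> (case s of (m, \<theta>) \<Rightarrow> case s' of (m', \<theta>') \<Rightarrow>
    m < m' \<and> (\<forall>g. \<forall>x<m. \<theta>' g x = \<theta> g x) \<and>
    (\<forall>w \<in> conj_words {..k}. \<forall>w' \<in> conj_words {..k}. (\<forall>x<m. act \<theta> w x = act \<theta> w' x) \<longrightarrow> (\<forall>x<m'. act \<theta>' w x = act \<theta>' w' x)) \<and>
    (\<forall>ps. \<forall>w \<in> conj_words {..k}. ps \<noteq> [] \<longrightarrow> length ps \<le> R \<longrightarrow> fst ` set ps \<subseteq> conj_words {..k} \<longrightarrow>
       nonbacktracking (\<lambda>e. {u. \<exists>v \<in> conj_words (assoc_index k e). \<forall>x<m. act \<theta> u x = act \<theta> v x}) ps \<longrightarrow>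
       (\<exists>x<m'. act \<theta>' (syllables ps @ w) x \<noteq> x)))"

lemma next_stageD:
  assumes "next_stage k R (m, \<theta>) (m', \<theta>')"
  shows "m < m'" "x < m \<Longrightarrow> \<theta>' g x = \<theta> g x"
    "w \<in> conj_words {..k} \<Longrightarrow> w' \<in> conj_words {..k} \<Longrightarrow> \<forall>x<m. act \<theta> w x = act \<theta> w' x \<Longrightarrow> x < m' \<Longrightarrow> act \<theta>' w x = act \<theta>' w' x"
    "ps \<noteq> [] \<Longrightarrow> length ps \<le> R \<Longrightarrow> fst ` set ps \<subseteq> conj_words {..k} \<Longrightarrow> w \<in> conj_words {..k} \<Longrightarrow>
       nonbacktracking (\<lambda>e. {u. \<exists>v \<in> conj_words (assoc_index k e). \<forall>x<m. act \<theta> u x = act \<theta> v x}) ps \<Longrightarrow>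
       \<exists>x<m'. act \<theta>' (syllables ps @ w) x \<noteq> x"
  using assms unfolding next_stage_def prod.case by blast+

lemma next_stage_exists:
  assumes \<theta>: "\<And>g. \<theta> g permutes {..<m}"
  shows "\<exists>m' \<theta>'. (\<forall>g. \<theta>' g permutes {..<m'}) \<and> next_stage k R (m, \<theta>) (m', \<theta>')"
proof -
  have bij: "bij (\<theta> g)" for g using \<theta> by (rule permutes_bij)
  have ap: "act \<theta> w permutes {..<m}" for w using \<theta> by (rule act_permutes)
  have ext: "act \<theta> w = act \<theta> w'" if "\<forall>x<m. act \<theta> w x = act \<theta> w' x" for w w'
  proof
    show "act \<theta> w x = act \<theta> w' x" for x
      using that ap[of w] ap[of w'] by (cases "x < m") (auto simp: permutes_not_in)
  qed
  have "finite (act \<theta> ` conj_words {..k})"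
    by (rule finite_subset[OF _ finite_permutations[of "{..<m}"]]) (use ap in auto)
  from finite_hnn_action[where \<theta> = \<theta> and k = k and R = R, OF bij this]
  obtain X :: "((((nat \<Rightarrow> nat) \<times> bool) list \<times> nat) \<times> (nat \<Rightarrow> nat)) set" and \<xi> where
    X\<xi>: "finite X \<and> X \<noteq> {} \<and> (\<forall>g. \<xi> g permutes X) \<and>
      (\<forall>w \<in> conj_words {..k}. \<forall>w' \<in> conj_words {..k}. act \<theta> w = act \<theta> w' \<longrightarrow> (\<forall>x\<in>X. act \<xi> w x = act \<xi> w' x)) \<and>
      (\<forall>ps. \<forall>w \<in> conj_words {..k}. ps \<noteq> [] \<longrightarrow> length ps \<le> R \<longrightarrow> fst ` set ps \<subseteq> conj_words {..k} \<longrightarrow>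
         nonbacktracking (\<lambda>e. {u. act \<theta> u \<in> act \<theta> ` conj_words (assoc_index k e)}) ps \<longrightarrow>
         (\<exists>x\<in>X. act \<xi> (syllables ps @ w) x \<noteq> x))"
    by (elim exE)
  have X: "finite X" "X \<noteq> {}" and \<xi>: "\<And>g. \<xi> g permutes X" and
    A: "\<And>w w'. w \<in> conj_words {..k} \<Longrightarrow> w' \<in> conj_words {..k} \<Longrightarrow> act \<theta> w = act \<theta> w' \<Longrightarrow> \<forall>x\<in>X. act \<xi> w x = act \<xi> w' x" and
    B: "\<And>ps w. ps \<noteq> [] \<Longrightarrow> length ps \<le> R \<Longrightarrow> fst ` set ps \<subseteq> conj_words {..k} \<Longrightarrow> w \<in> conj_words {..k} \<Longrightarrow>
       nonbacktracking (\<lambda>e. {u. act \<theta> u \<in> act \<theta> ` conj_words (assoc_index k e)}) ps \<Longrightarrow>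
       \<exists>x\<in>X. act \<xi> (syllables ps @ w) x \<noteq> x"
    using X\<xi> by blast+
  from adjoin_block[where \<theta> = \<theta> and \<xi> = \<xi>, OF \<theta> \<xi> X] obtain m' \<theta>' f where
    "m < m' \<and> (\<forall>g. \<theta>' g permutes {..<m'}) \<and> (\<forall>g. \<forall>x<m. \<theta>' g x = \<theta> g x) \<and>
    bij_betw f X {m..<m'} \<and> (\<forall>w. \<forall>x\<in>X. act \<theta>' w (f x) = f (act \<xi> w x))"
    by (elim exE)
  then have m': "m < m'" and \<theta>': "\<And>g. \<theta>' g permutes {..<m'}" and
    ag: "\<And>g x. x < m \<Longrightarrow> \<theta>' g x = \<theta> g x" and f: "bij_betw f X {m..<m'}" and
    af: "\<And>w x. x \<in> X \<Longrightarrow> act \<theta>' w (f x) = f (act \<xi> w x)"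
    by blast+
  have low: "act \<theta>' w x = act \<theta> w x" if "x < m" for w x
    using act_transfer[where \<theta> = \<theta> and \<theta>' = \<theta>' and j = "\<lambda>x. x" and X = "{..<m}", OF \<theta> permutes_bij[OF \<theta>']] ag that
    by auto
  have rel: "act \<theta>' w x = act \<theta>' w' x"
    if "w \<in> conj_words {..k}" "w' \<in> conj_words {..k}" "\<forall>x<m. act \<theta> w x = act \<theta> w' x" "x < m'" for w w' x
  proof (cases "x < m")
    case True
    then show ?thesis using that low by simp
  next
    case False
    then have "x \<in> f ` X" using f that(4) by (simp add: bij_betw_def)
    then obtain y where "y \<in> X" "x = f y" by blast
    with A[OF that(1,2) ext[OF that(3)]] af show ?thesis by simp
  qed
  have moves: "\<exists>x<m'. act \<theta>' (syllables ps @ w) x \<noteq> x"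
    if "ps \<noteq> []" "length ps \<le> R" "fst ` set ps \<subseteq> conj_words {..k}" "w \<in> conj_words {..k}"
      "nonbacktracking (\<lambda>e. {u. \<exists>v \<in> conj_words (assoc_index k e). \<forall>x<m. act \<theta> u x = act \<theta> v x}) ps" for ps w
  proof -
    have "nonbacktracking (\<lambda>e. {u. act \<theta> u \<in> act \<theta> ` conj_words (assoc_index k e)}) ps"
      by (rule nonbacktracking_mono[OF that(5)]) auto
    with B that obtain x where x: "x \<in> X" "act \<xi> (syllables ps @ w) x \<noteq> x" by blast
    have "act \<xi> (syllables ps @ w) x \<in> X"
      using act_permutes[of \<xi> X] \<xi> x by (simp add: permutes_in_image del: act_simps)
    then have "act \<theta>' (syllables ps @ w) (f x) \<noteq> f x"
      using x af f by (metis bij_betw_imp_inj_on inj_onD)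
    moreover have "f x < m'" using bij_betwE[OF f] x by auto
    ultimately show ?thesis by blast
  qed
  have "next_stage k R (m, \<theta>) (m', \<theta>')"
    unfolding next_stage_def prod.case
    by (intro conjI allI ballI impI m' ag; (rule rel moves; assumption)?)
  with \<theta>' show ?thesis by blast
qed

text \<open>
  Every point lies below all sufficiently late \<open>m k\<close>, where the generators no longer change, so the
  stages have a limit. In the limit the group of the words in \<open>a\<^sub>0, \<dots>, a\<^sub>k\<close> acts faithfully on the
  points below \<open>m k\<close>, and the bound \<open>R k (m k)\<close> on the length of the words without backtracking may
  depend on \<open>m k\<close>, hence on the order of this group.
\<close>

lemma tower_exists:
  fixes R :: "nat \<Rightarrow> nat \<Rightarrow> nat"
  shows "\<exists>(\<theta> :: bool \<Rightarrow> nat \<Rightarrow> nat) m. (\<forall>g. bij (\<theta> g)) \<and> \<theta> False \<noteq> id \<and>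
    (\<forall>k w. \<forall>x<m k. act \<theta> w x < m k) \<and>
    (\<forall>k. \<forall>w \<in> conj_words {..k}. \<forall>w' \<in> conj_words {..k}. (\<forall>x<m k. act \<theta> w x = act \<theta> w' x) \<longrightarrow> act \<theta> w = act \<theta> w') \<and>
    (\<forall>k ps. \<forall>w \<in> conj_words {..k}. ps \<noteq> [] \<longrightarrow> length ps \<le> R k (m k) \<longrightarrow> fst ` set ps \<subseteq> conj_words {..k} \<longrightarrow>
       nonbacktracking (\<lambda>e. {u. act \<theta> u \<in> act \<theta> ` conj_words (assoc_index k e)}) ps \<longrightarrow>
       act \<theta> (syllables ps @ w) \<noteq> id)"
proof -
  \<comment> \<open>the first segment makes \<open>a\<close> nontrivial\<close>
  define base where "base = (2::nat, \<lambda>g. if g then id else transpose 0 (1::nat))"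
  define P where "P n s \<longleftrightarrow> (n = 0 \<longrightarrow> s = base) \<and> (\<forall>g. snd s g permutes {..<fst s})" for n :: nat and s
  have "\<exists>st. \<forall>n. P n (st n) \<and> next_stage n (R n (fst (st n))) (st n) (st (Suc n))"
  proof (rule dependent_nat_choice)
    have "transpose 0 1 permutes {..<2::nat}" by (rule permutes_swap_id) auto
    then have "P 0 base" by (auto simp: P_def base_def permutes_id)
    then show "\<exists>x. P 0 x" by blast
  next
    fix s n assume "P n s"
    then obtain m' \<theta>' where "\<forall>g. \<theta>' g permutes {..<m'}" "next_stage n (R n (fst s)) s (m', \<theta>')"
      using next_stage_exists[of "snd s" "fst s" n "R n (fst s)"] by (auto simp: P_def)
    then show "\<exists>y. P (Suc n) y \<and> next_stage n (R n (fst s)) s y"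
      by (intro exI[of _ "(m', \<theta>')"]) (auto simp: P_def)
  qed
  then obtain st where st: "\<And>n. P n (st n)" "\<And>n. next_stage n (R n (fst (st n))) (st n) (st (Suc n))" by blast
  define m where "m n = fst (st n)" for n
  define \<eta> where "\<eta> n = snd (st n)" for n
  have st_eq: "st n = (m n, \<eta> n)" for n by (simp add: m_def \<eta>_def)
  have perm: "\<eta> n g permutes {..<m n}" for n g using st(1) by (simp add: P_def m_def \<eta>_def)
  note nxt = next_stageD[OF st(2)[unfolded st_eq fst_conv]]
  have msuc: "m n < m (Suc n)" for n by (rule nxt(1))
  have smono: "strict_mono m" using msuc by (simp add: strict_mono_Suc_iff)
  have lt: "x < m x" for x
  proof (induction x)
    case 0
    show ?case using st(1)[of 0] by (simp add: P_def m_def base_def)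
  next
    case (Suc x)
    then show ?case using msuc[of x] by linarith
  qed
  have agree: "\<eta> k g x = \<eta> j g x" if "j \<le> k" "x < m j" for j k g x
    using that(1)
  proof (induction rule: dec_induct)
    case (step n)
    have "x < m n" using that(2) step(1) smono by (meson less_le_trans strict_mono_less_eq)
    with step nxt(2) show ?case by simp
  qed simp
  define \<theta> where "\<theta> g x = \<eta> x g x" for g x
  have \<theta>: "\<theta> g x = \<eta> k g x" if "x < m k" for g x k
    using agree[of x k x g] agree[of k x x g] that lt[of x] by (cases "x \<le> k") (auto simp: \<theta>_def)
  have bij: "bij (\<theta> g)" for g
  proof (rule bijI)
    show "inj (\<theta> g)"
    proof (rule injI)
      fix x y assume eq: "\<theta> g x = \<theta> g y"
      define k where "k = max x y"
      have "x < m k" "y < m k" 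
        using less_le_trans[OF lt[of x]] less_le_trans[OF lt[of y]]
          strict_mono_leD[OF smono, of x k] strict_mono_leD[OF smono, of y k] by (simp_all add: k_def)
      with eq \<theta> permutes_inj[OF perm[of k g]] show "x = y" by (metis injD)
    qed
    show "surj (\<theta> g)"
    proof (rule surjI)
      fix y
      have "finv (\<eta> y g) y < m y" using permutes_in_image[OF permutes_inv[OF perm[of y g]], of y] lt[of y] by simp
      then show "\<theta> g (finv (\<eta> y g) y) = y" using \<theta> permutes_inverses(1)[OF perm[of y g]] by metis
    qed
  qed
  have act: "act \<theta> w x = act (\<eta> k) w x" if "x < m k" for w x k
    using act_transfer[where \<theta> = "\<eta> k" and \<theta>' = \<theta> and j = "\<lambda>x. x" and X = "{..<m k}", OF perm bij] \<theta> that
    by auto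
  have "transpose 0 1 (0::nat) = 1" by simp
  moreover have "\<theta> False 0 = transpose 0 1 (0::nat)"
    using st(1)[of 0] by (simp add: \<theta>_def \<eta>_def P_def base_def)
  ultimately have "\<theta> False \<noteq> id" by (metis id_apply zero_neq_one)
  moreover have "\<forall>k w. \<forall>x<m k. act \<theta> w x < m k"
    using act act_permutes[of "\<eta> _"] perm by (metis lessThan_iff permutes_in_image)
  moreover have rel: "act \<theta> w = act \<theta> w'"
    if w: "w \<in> conj_words {..k}" "w' \<in> conj_words {..k}" "\<forall>x<m k. act \<theta> w x = act \<theta> w' x" for k w w'
  proof
    fix x
    have "\<forall>x<m n. act (\<eta> n) w x = act (\<eta> n) w' x" if "k \<le> n" for n
      using that
    proof (induction rule: dec_induct)
      case base
      then show ?case using w(3) act by metis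
    next
      case (step n)
      have "w \<in> conj_words {..n}" "w' \<in> conj_words {..n}" using w conj_words_mono step(1) by (meson atMost_subset_iff)+
      with nxt(3) step show ?case by blast
    qed
    moreover have "x < m (max k x)" using less_le_trans[OF lt[of x]] strict_mono_leD[OF smono, of x "max k x"] by simp
    ultimately show "act \<theta> w x = act \<theta> w' x" using act by (metis max.cobounded1)
  qed
  moreover have "act \<theta> (syllables ps @ w) \<noteq> id"
    if ps: "ps \<noteq> []" "length ps \<le> R k (m k)" "fst ` set ps \<subseteq> conj_words {..k}" "w \<in> conj_words {..k}"
      "nonbacktracking (\<lambda>e. {u. act \<theta> u \<in> act \<theta> ` conj_words (assoc_index k e)}) ps" for k ps w
  proof -
    have "nonbacktracking (\<lambda>e. {u. \<exists>v \<in> conj_words (assoc_index k e). \<forall>x<m k. act (\<eta> k) u x = act (\<eta> k) v x}) ps"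
    proof (rule nonbacktracking_mono[OF ps(5)])
      fix p e assume p: "p \<in> set ps"
        and "fst p \<in> {u. \<exists>v \<in> conj_words (assoc_index k e). \<forall>x<m k. act (\<eta> k) u x = act (\<eta> k) v x}"
      then obtain v where v: "v \<in> conj_words (assoc_index k e)" "\<forall>x<m k. act \<theta> (fst p) x = act \<theta> v x"
        using act by auto
      moreover have "assoc_index k e \<subseteq> {..k}" by (auto simp: assoc_index_def)
      then have "v \<in> conj_words {..k}" using v conj_words_mono by blast
      ultimately have "act \<theta> (fst p) = act \<theta> v" using rel ps(3) p by (metis image_subset_iff)
      with v(1) show "fst p \<in> {u. act \<theta> u \<in> act \<theta> ` conj_words (assoc_index k e)}" by auto
    qed
    from nxt(4)[OF ps(1-4) this] obtain x where "x < m (Suc k)" "act (\<eta> (Suc k)) (syllables ps @ w) x \<noteq> x" by blast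
    with act show ?thesis by (metis id_apply)
  qed
  ultimately show ?thesis
    using bij by (intro exI[of _ \<theta>] exI[of _ m]) (simp del: act_simps)
qed

section \<open>Finite window subgroups and their coset graphs\<close>

text \<open>
  The function \<open>r\<close> evaluates words; \<open>a\<close> is the value of \<open>[(False, True)]\<close> and \<open>t\<close> that of
  \<open>[(True, True)]\<close>. The assumption \<open>girth\<close> is Britton's lemma for words with at most \<open>R k\<close> letters \<open>t\<close>.
\<close>

locale tower_group = group G for G (structure) +
  fixes r :: "word \<Rightarrow> 'a" and R :: "nat \<Rightarrow> nat"
  assumes r_append: "r (u @ w) = r u \<otimes> r w"
    and r_surj: "range r = carrier G"
    and r_cancel: "r [(g, s), (g, \<not> s)] = \<one>"
    and a_nontrivial: "r [(False, True)] \<noteq> \<one>"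
    and finite_window: "finite (r ` conj_words {..k})"
    and girth: "ps \<noteq> [] \<Longrightarrow> length ps \<le> R k \<Longrightarrow> fst ` set ps \<subseteq> conj_words {..k} \<Longrightarrow>
      nonbacktracking (\<lambda>e. {u. r u \<in> r ` conj_words (assoc_index k e)}) ps \<Longrightarrow> r (syllables ps) \<notin> r ` conj_words {..k}"
    and girth_large: "k + 2 \<le> R k"
begin

definition H :: "nat \<Rightarrow> 'a set" where "H k = r ` conj_words {..k}"

abbreviation t :: "bool \<Rightarrow> 'a" where "t e \<equiv> r [(True, e)]"

lemma r_closed [simp, intro]: "r w \<in> carrier G"
  using r_surj by auto

lemma r_Nil: "r [] = \<one>"
proof -
  have "r [] \<otimes> r [] = r []" using r_append[of "[]" "[]"] by simp
  then show ?thesis using l_cancel_one r_closed by blast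
qed

lemma r_inverse_word: "r w \<otimes> r (inverse_word w) = \<one>"
proof (induction w)
  case (Cons l w)
  have "r (l # w) \<otimes> r (inverse_word (l # w)) = r [l] \<otimes> ((r w \<otimes> r (inverse_word w)) \<otimes> r [(fst l, \<not> snd l)])"
    using r_append[of "[l]" w] r_append[of "inverse_word w" "[(fst l, \<not> snd l)]"] by (simp add: m_assoc)
  also have "\<dots> = r [l] \<otimes> r [(fst l, \<not> snd l)]" by (simp add: Cons)
  also have "\<dots> = \<one>" using r_append[of "[l]" "[(fst l, \<not> snd l)]"] r_cancel[of "fst l" "snd l"] by simp
  finally show ?case .
qed (simp add: r_Nil)

lemma inv_r: "inv (r w) = r (inverse_word w)"
  by (rule inv_equality) (use r_inverse_word[of "inverse_word w"] in auto)

lemma inv_cancel: "x \<in> carrier G \<Longrightarrow> y \<in> carrier G \<Longrightarrow> inv x \<otimes> (x \<otimes> y) = y"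
  by (simp add: m_assoc[symmetric])

lemma t_cancel: "t e \<otimes> t (\<not> e) = \<one>" "t (\<not> e) \<otimes> t e = \<one>"
  using r_append[of "[(True, e)]" "[(True, \<not> e)]"] r_append[of "[(True, \<not> e)]" "[(True, e)]"]
    r_cancel[of True e] r_cancel[of True "\<not> e"] by auto

lemma subgroup_H: "subgroup (H k) G"
proof (rule subgroupI)
  show "H k \<noteq> {}" using conj_words.Nil by (auto simp: H_def)
  show "inv x \<in> H k" if "x \<in> H k" for x
    using that by (auto simp: H_def inv_r intro: conj_words_inverse_word)
  show "x \<otimes> y \<in> H k" if "x \<in> H k" "y \<in> H k" for x y
    using that by (auto simp: H_def r_append[symmetric] intro: conj_words_append)
qed (auto simp: H_def)

lemma finite_H: "finite (H k)"
  using finite_window by (simp add: H_def)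

lemma H_mono: "j \<le> k \<Longrightarrow> H j \<subseteq> H k"
  unfolding H_def by (intro image_mono subsetI) (auto intro: conj_words_mono)

lemma a_in_H: "r [(False, s)] \<in> H k"
  using conj_words_letter[of 0 "{..k}" s] by (auto simp: H_def conj_letter_def)

lemma conj_letter_Suc: "conj_letter (Suc i) s = (True, True) # conj_letter i s @ [(True, False)]"
  by (simp add: conj_letter_def replicate_append_same)

lemma r_conj_letter_Suc: "r (conj_letter (Suc i) s) = t True \<otimes> r (conj_letter i s) \<otimes> t False"
  unfolding conj_letter_Suc
  using r_append[of "[(True, True)]" "conj_letter i s @ [(True, False)]"]
    r_append[of "conj_letter i s" "[(True, False)]"] by (simp add: m_assoc)

lemma conj_mult: "x \<in> carrier G \<Longrightarrow> y \<in> carrier G \<Longrightarrow>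
    t e \<otimes> (x \<otimes> y) \<otimes> t (\<not> e) = (t e \<otimes> x \<otimes> t (\<not> e)) \<otimes> (t e \<otimes> y \<otimes> t (\<not> e))"
proof -
  assume "x \<in> carrier G" "y \<in> carrier G"
  moreover from this have "t (\<not> e) \<otimes> (t e \<otimes> z) = z" if "z \<in> carrier G" for z
    using that t_cancel[of e] by (metis l_one m_assoc r_closed)
  ultimately show ?thesis by (simp add: m_assoc)
qed

lemma shift_up: "u \<in> conj_words I \<Longrightarrow> t True \<otimes> r u \<otimes> t False \<in> r ` conj_words (Suc ` I)"
proof (induction rule: conj_words.induct)
  case Nil
  show ?case using conj_words.Nil[of "Suc ` I"] t_cancel[of True] by (force simp: r_Nil)
next
  case (Cons i w s)
  then obtain w' where w': "w' \<in> conj_words (Suc ` I)" "t True \<otimes> r w \<otimes> t False = r w'" by auto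
  have "t True \<otimes> r (conj_letter i s @ w) \<otimes> t False = r (conj_letter (Suc i) s @ w')"
    using conj_mult[of "r (conj_letter i s)" "r w" True] w' by (simp add: r_append r_conj_letter_Suc)
  moreover have "conj_letter (Suc i) s @ w' \<in> conj_words (Suc ` I)"
    using Cons w' by (intro conj_words.Cons) auto
  ultimately show ?case by simp
qed

lemma shift_down: "u \<in> conj_words (Suc ` I) \<Longrightarrow> t False \<otimes> r u \<otimes> t True \<in> r ` conj_words I"
proof (induction rule: conj_words.induct)
  case Nil
  show ?case using conj_words.Nil[of I] t_cancel[of False] by (force simp: r_Nil)
next
  case (Cons i w s)
  then obtain w' j where w': "w' \<in> conj_words I" "t False \<otimes> r w \<otimes> t True = r w'" "i = Suc j" "j \<in> I" by auto
  have "t False \<otimes> r (conj_letter i s) \<otimes> t True = (t False \<otimes> t True) \<otimes> r (conj_letter j s) \<otimes> (t False \<otimes> t True)"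
    using w' by (simp add: r_conj_letter_Suc m_assoc)
  then have "t False \<otimes> r (conj_letter i s @ w) \<otimes> t True = r (conj_letter j s @ w')"
    using conj_mult[of "r (conj_letter i s)" "r w" False] w' t_cancel[of False] by (simp add: r_append)
  moreover have "conj_letter j s @ w' \<in> conj_words I"
    using w' by (intro conj_words.Cons) auto
  ultimately show ?case by simp
qed

lemma conj_assoc: "r u \<in> r ` conj_words (assoc_index k e) \<Longrightarrow> t e \<otimes> r u \<otimes> t (\<not> e) \<in> H k"
proof -
  assume "r u \<in> r ` conj_words (assoc_index k e)"
  then obtain v where v: "v \<in> conj_words (assoc_index k e)" "r u = r v" by auto
  show ?thesis
  proof (cases e)
    case True
    then have "t e \<otimes> r u \<otimes> t (\<not> e) \<in> r ` conj_words (Suc ` {..<k})"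
      using shift_up[of v "{..<k}"] v by (simp add: assoc_index_def)
    moreover have "conj_words (Suc ` {..<k}) \<subseteq> conj_words {..k}" by (auto intro: conj_words_mono)
    ultimately show ?thesis by (auto simp: H_def)
  next
    case False
    then have "t e \<otimes> r u \<otimes> t (\<not> e) \<in> r ` conj_words {..<k}"
      using shift_down[of v "{..<k}"] v by (simp add: assoc_index_def image_Suc_lessThan)
    moreover have "conj_words {..<k} \<subseteq> conj_words {..k}" by (auto intro: conj_words_mono)
    ultimately show ?thesis by (auto simp: H_def)
  qed
qed

lemma syllables_append: "syllables (ps @ [(w, e)]) = syllables ps @ w @ [(True, e)]"
  by (simp add: syllables_def)

definition coset_graph :: "nat \<Rightarrow> ('a set \<times> 'a set) set" where
  "coset_graph k = {(g <# H k, (g \<otimes> t e) <# H k) | g e. g \<in> carrier G}"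

lemma sym_coset_graph: "sym (coset_graph k)"
proof (rule symI)
  fix x y assume "(x, y) \<in> coset_graph k"
  then obtain g e where g: "g \<in> carrier G" "x = g <# H k" "y = (g \<otimes> t e) <# H k"
    by (auto simp: coset_graph_def)
  then have "(g \<otimes> t e) \<otimes> t (\<not> e) = g" by (simp add: m_assoc t_cancel)
  with g show "(y, x) \<in> coset_graph k"
    unfolding coset_graph_def by (intro CollectI exI[of _ "g \<otimes> t e"] exI[of _ "\<not> e"]) auto
qed

lemma coset_eq_iff:
  assumes "x \<in> carrier G" "y \<in> carrier G"
  shows "x <# H k = y <# H k \<longleftrightarrow> inv x \<otimes> y \<in> H k"
proof
  assume "x <# H k = y <# H k"
  moreover have "y \<in> y <# H k"
    using subgroup.one_closed[OF subgroup_H] assms by (force simp: l_coset_def)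
  ultimately obtain h where "h \<in> H k" "y = x \<otimes> h" by (auto simp: l_coset_def)
  with assms subgroup.mem_carrier[OF subgroup_H] show "inv x \<otimes> y \<in> H k"
    by (simp add: m_assoc[symmetric])
next
  assume "inv x \<otimes> y \<in> H k"
  moreover have "x \<otimes> (inv x \<otimes> y) = y" using assms by (simp add: m_assoc[symmetric])
  moreover have "(x \<otimes> h) <# H k = x <# H k" if "h \<in> H k" for h
  proof -
    have h: "h \<in> carrier G" using that subgroup.mem_carrier[OF subgroup_H] by blast
    have "(x \<otimes> h) <# H k = x <# (h <# H k)"
      using lcos_m_assoc[OF subgroup.subset[OF subgroup_H] assms(1) h] by simp
    also have "h <# H k = H k" using coset_join3[OF h subgroup_H that] .
    finally show ?thesis .
  qed
  ultimately show "x <# H k = y <# H k" by metis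
qed

text \<open>
  A closed walk in the coset graph is the image of a word \<open>w\<^sub>1 t\<^sup>e\<^sup>1 w\<^sub>2 t\<^sup>e\<^sup>2 \<dots>\<close> with all \<open>w\<^sub>i\<close> in
  \<open>H k\<close>. If \<open>t\<^sup>e w t\<^sup>-\<^sup>e\<close> occurs with \<open>w\<close> in the associated subgroup, the walk returns to the coset it
  came from.
\<close>

lemma no_short_cycle:
  assumes s: "1 \<le> s" "s \<le> R k" and p0: "p 0 = g <# H k" "g \<in> carrier G"
    and adj: "\<forall>i<s. (p i, p (Suc i)) \<in> coset_graph k"
    and nb: "\<forall>i. Suc (Suc i) \<le> s \<longrightarrow> p i \<noteq> p (Suc (Suc i))"
  shows "p s \<noteq> g <# H k"
proof -
  let ?N = "\<lambda>e. {u. r u \<in> r ` conj_words (assoc_index k e)}"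
  have "\<exists>ps. length ps = j \<and> fst ` set ps \<subseteq> conj_words {..k} \<and> nonbacktracking ?N ps \<and>
      (\<forall>i\<le>j. p i = (g \<otimes> r (syllables (take i ps))) <# H k)" if "j \<le> s" for j
    using that
  proof (induction j)
    case 0
    show ?case using p0 by (intro exI[of _ "[]"]) (simp add: nonbacktracking_def syllables_def r_Nil)
  next
    case (Suc j)
    then obtain ps where ps: "length ps = j" "fst ` set ps \<subseteq> conj_words {..k}" "nonbacktracking ?N ps"
      "\<forall>i\<le>j. p i = (g \<otimes> r (syllables (take i ps))) <# H k" by auto
    have "(p j, p (Suc j)) \<in> coset_graph k" using adj Suc.prems by simp
    then obtain x e where x: "x \<in> carrier G" "p j = x <# H k" "p (Suc j) = (x \<otimes> t e) <# H k"
      unfolding coset_graph_def by blast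
    define P where "P = g \<otimes> r (syllables ps)"
    have P: "P \<in> carrier G" using p0 by (simp add: P_def)
    have "P <# H k = x <# H k" using ps x by (auto simp: P_def)
    then have "inv P \<otimes> x \<in> H k" using coset_eq_iff P x by blast
    then obtain w where w: "w \<in> conj_words {..k}" "inv P \<otimes> x = r w" by (auto simp: H_def)
    have xw: "x = P \<otimes> r w" using P x by (simp add: w(2)[symmetric] m_assoc[symmetric])
    have "p (Suc j) = (g \<otimes> r (syllables (ps @ [(w, e)]))) <# H k"
      using p0 by (simp add: x xw P_def syllables_append r_append m_assoc)
    moreover have "nonbacktracking ?N (ps @ [(w, e)])"
    proof (cases ps rule: rev_cases)
      case Nil
      then show ?thesis by (simp add: nonbacktracking_def)
    next
      case (snoc qs q)
      obtain w' e' where q: "q = (w', e')" by fastforce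
      have False if ne: "e' \<noteq> e" and in_assoc: "r w \<in> r ` conj_words (assoc_index k e')"
      proof -
        have e: "e = (\<not> e')" using ne by auto
        define Q where "Q = g \<otimes> r (syllables qs)"
        have Q: "Q \<in> carrier G" using p0 by (simp add: Q_def)
        have w': "r w' \<in> H k" using ps(2) by (auto simp: snoc q H_def)
        have "x \<otimes> t e = Q \<otimes> (r w' \<otimes> (t e' \<otimes> r w \<otimes> t (\<not> e')))"
          using p0 by (simp add: xw P_def Q_def snoc q syllables_append r_append m_assoc e)
        moreover have "r w' \<otimes> (t e' \<otimes> r w \<otimes> t (\<not> e')) \<in> H k"
          using conj_assoc[OF in_assoc] w' subgroup.m_closed[OF subgroup_H] by blast
        moreover from this have "inv Q \<otimes> (Q \<otimes> (r w' \<otimes> (t e' \<otimes> r w \<otimes> t (\<not> e')))) \<in> H k"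
          using Q by (simp add: m_assoc[symmetric])
        ultimately have "Q <# H k = p (Suc j)"
          using Q x by (simp add: coset_eq_iff)
        moreover have "j = Suc (length qs)" using ps(1) snoc by simp
        moreover from this have "p (length qs) = Q <# H k" using ps(4) by (simp add: snoc Q_def)
        ultimately show False using nb Suc.prems by metis
      qed
      then show ?thesis using ps(3) by (auto simp: snoc q nonbacktracking_def successively_append_iff)
    qed
    moreover have "p i = (g \<otimes> r (syllables (take i (ps @ [(w, e)])))) <# H k" if "i \<le> j" for i
      using that ps by simp
    ultimately show ?case
      using ps w by (intro exI[of _ "ps @ [(w, e)]"]) (auto simp: le_Suc_eq)
  qed
  from this[of s] obtain ps where ps: "length ps = s" "fst ` set ps \<subseteq> conj_words {..k}" "nonbacktracking ?N ps"
      "p s = (g \<otimes> r (syllables ps)) <# H k" by auto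
  have "ps \<noteq> []" using s ps(1) by auto
  then have "r (syllables ps) \<notin> H k"
    using girth[OF _ _ ps(2,3)] s ps(1) by (simp add: H_def)
  then have "inv g \<otimes> (g \<otimes> r (syllables ps)) \<notin> H k"
    using p0 by (simp add: m_assoc[symmetric])
  then show ?thesis using coset_eq_iff[of g "g \<otimes> r (syllables ps)" k] p0 ps(4) by auto
qed

lemma coset_walk:
  assumes "g \<in> carrier G"
  shows "\<exists>j \<le> length w. (g <# H k, (g \<otimes> r w) <# H k) \<in> coset_graph k ^^ j"
proof (induction w rule: rev_induct)
  case Nil
  show ?case using assms by (simp add: r_Nil)
next
  case (snoc l w)
  then obtain j where j: "j \<le> length w" "(g <# H k, (g \<otimes> r w) <# H k) \<in> coset_graph k ^^ j" by auto
  have app: "g \<otimes> r (w @ [l]) = (g \<otimes> r w) \<otimes> r [l]" using assms by (simp add: r_append m_assoc)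
  show ?case
  proof (cases "fst l")
    case True
    then have "((g \<otimes> r w) <# H k, (g \<otimes> r (w @ [l])) <# H k) \<in> coset_graph k"
      unfolding app coset_graph_def using assms
      by (intro CollectI exI[of _ "g \<otimes> r w"] exI[of _ "snd l"]) (cases l; auto)
    with j show ?thesis by (intro exI[of _ "Suc j"]) auto
  next
    case False
    then have "r [l] \<in> H k" using a_in_H[of "snd l"] by (cases l) auto
    then have "(g \<otimes> r w) <# H k = (g \<otimes> r (w @ [l])) <# H k"
      using assms unfolding app by (simp add: coset_eq_iff inv_cancel)
    with j show ?thesis by (intro exI[of _ j]) auto
  qed
qed

end

section \<open>Separation on the scale of the girth\<close>

context tower_group
begin

text \<open>
  Only a component \<open>V0\<close> with more than half of the vertices has to be cut. All its points are joined
  to a base point by words of length at most \<open>c N\<^sup>2\<close>, so their cosets lie in a ball without cycles.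
  The cut set consists of the points from which a word of length at most \<open>c\<close>, such as the word of an
  edge, can reach the balanced coset \<open>z\<close>. An edge between two other points does not pass \<open>z\<close>, so its
  ends lie in the same branch.
\<close>

lemma cut_size_le:
  assumes S: "S \<subseteq> carrier G" "\<And>s. s \<in> S \<Longrightarrow> \<exists>w. length w \<le> c \<and> s = r w"
    and \<Gamma>: "pair_graph \<Gamma>" "subgraph (with_proj \<Gamma>) (with_proj (cayley_graph G S))" "card (pverts \<Gamma>) \<le> N"
    and large: "2 * (c * N\<^sup>2 + c) + 1 \<le> R k"
  shows "cut_size \<Gamma> \<le> card (H k) * card {w :: word. length w \<le> c}"
proof -
  interpret \<Gamma>: pair_graph \<Gamma> by fact
  define V where "V = pverts \<Gamma>"
  define E where "E = parcs \<Gamma>"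
  have finV: "finite V" by (simp add: V_def)
  have finE: "finite E" by (simp add: E_def)
  have EV: "E \<subseteq> V \<times> V"
    using \<Gamma>.in_arcsD1 \<Gamma>.in_arcsD2 by (auto simp: E_def V_def)
  have symE: "sym E" using \<Gamma>.arcs_symmetric by (auto simp: E_def sym_def)
  have VG: "V \<subseteq> carrier G" and EC: "E \<subseteq> parcs (cayley_graph G S)"
    using \<Gamma>(2) by (auto simp: subgraph_def V_def E_def cayley_graph_def)
  define f where "f x = x <# H k" for x
  define W where "W = {w :: word. length w \<le> c}"
  have finW: "finite W" unfolding W_def using finite_lists_length_le[of "UNIV :: (bool \<times> bool) set" c] by simp
  have arc: "\<exists>w\<in>W. y = x \<otimes> r w \<or> x = y \<otimes> r w" if xy: "(x, y) \<in> E" for x y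
  proof -
    obtain s where s: "s \<in> S" "y = x \<otimes> s \<or> x = y \<otimes> s" using xy EC by (auto simp: cayley_graph_def)
    with S(2)[OF s(1)] show ?thesis by (auto simp: W_def)
  qed
  have inverse_word_len: "length (inverse_word w) = length w" for w by (simp add: inverse_word_def)
  have arc': "\<exists>w\<in>W. y = x \<otimes> r w" if xy: "(x, y) \<in> E" for x y
  proof -
    have xc: "x \<in> carrier G" "y \<in> carrier G" using xy EV VG by auto
    obtain w where w: "w \<in> W" "y = x \<otimes> r w \<or> x = y \<otimes> r w" using arc[OF xy] by blast
    then show ?thesis
    proof (elim disjE)
      assume "x = y \<otimes> r w"
      then have "y = x \<otimes> r (inverse_word w)" using xc r_inverse_word[of w] by (simp add: m_assoc)
      then show ?thesis using w(1) inverse_word_len[of w] by (intro bexI[of _ "inverse_word w"]) (auto simp: W_def)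
    qed blast
  qed
  show ?thesis
  proof (cases "\<forall>x\<in>V. 2 * card (E\<^sup>* `` {x}) \<le> card V")
    case True
    have "card ((Restr E V)\<^sup>* `` {x}) \<le> card (E\<^sup>* `` {x})" if "x \<in> V" for x
    proof (rule card_mono)
      have "E\<^sup>* `` {x} \<subseteq> V"
      proof
        fix y assume "y \<in> E\<^sup>* `` {x}"
        then have "(x, y) \<in> E\<^sup>*" by simp
        then show "y \<in> V" by induction (use that EV in auto)
      qed
      then show "finite (E\<^sup>* `` {x})" using finV by (rule finite_subset)
      have "(Restr E V)\<^sup>* \<subseteq> E\<^sup>*" by (rule rtrancl_mono) auto
      then show "(Restr E V)\<^sup>* `` {x} \<subseteq> E\<^sup>* `` {x}" by (rule Image_mono) simp
    qed
    with True have "\<forall>x\<in>V. 2 * card ((Restr E V)\<^sup>* `` {x}) \<le> card V"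
      by fastforce
    then have "is_cut_set \<Gamma> {}"
      unfolding is_cut_set_iff[OF \<Gamma>(1)] V_def[symmetric] E_def[symmetric] Diff_empty by simp
    from cut_size_le_card_cut_set[OF \<Gamma>(1) this] show ?thesis by simp
  next
    case False
    then obtain x0 where x0: "x0 \<in> V" "card V < 2 * card (E\<^sup>* `` {x0})" by (auto simp: not_le)
    define V0 where "V0 = E\<^sup>* `` {x0}"
    have V0V: "V0 \<subseteq> V"
    proof
      fix y assume "y \<in> V0"
      then have "(x0, y) \<in> E\<^sup>*" by (simp add: V0_def)
      then show "y \<in> V" by induction (use x0 EV in auto)
    qed
    have finV0: "finite V0" using V0V finV finite_subset by blast
    have x0c: "x0 \<in> carrier G" using x0 VG by auto
    define D where "D = c * N\<^sup>2 + c"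
    interpret tree_ball "coset_graph k" "f x0" D
    proof
      show "sym (coset_graph k)" by (rule sym_coset_graph)
      fix s and p :: "nat \<Rightarrow> 'a set"
      assume "1 \<le> s" "s \<le> 2 * D + 1" "p 0 = f x0" "\<forall>i<s. (p i, p (Suc i)) \<in> coset_graph k"
        "\<forall>i. Suc (Suc i) \<le> s \<longrightarrow> p i \<noteq> p (Suc (Suc i))"
      moreover have "2 * D + 1 \<le> R k" using large by (simp add: D_def)
      ultimately show "p s \<noteq> f x0"
        using no_short_cycle[of s k p x0] x0c by (auto simp: f_def)
    qed
    have near: "reached (f (x0 \<otimes> r w)) \<and> dist (f (x0 \<otimes> r w)) \<le> length w" for w
    proof -
      obtain j where "j \<le> length w" "(f x0, f (x0 \<otimes> r w)) \<in> coset_graph k ^^ j"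
        using coset_walk[OF x0c, where k = k and w = w] by (auto simp: f_def)
      with dist_le reached_relpow show ?thesis by (meson le_trans)
    qed
    have words: "\<exists>w. length w \<le> c * N\<^sup>2 \<and> x = x0 \<otimes> r w" if "x \<in> V0" for x
    proof -
      have steps: "\<exists>w. length w \<le> c * n \<and> y = x0 \<otimes> r w" if "(x0, y) \<in> E ^^ n" for n y
        using that
      proof (induction n arbitrary: y)
        case 0
        then show ?case using x0c by (intro exI[of _ "[]"]) (simp add: r_Nil)
      next
        case (Suc n)
        then obtain z where z: "(x0, z) \<in> E ^^ n" "(z, y) \<in> E" by auto
        obtain w where w: "length w \<le> c * n" "z = x0 \<otimes> r w" using Suc.IH[OF z(1)] by blast
        obtain w' where w': "length w' \<le> c" "y = z \<otimes> r w'" using arc'[OF z(2)] by (auto simp: W_def)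
        then show ?case using w x0c by (intro exI[of _ "w @ w'"]) (simp add: r_append m_assoc)
      qed
      have "card E \<le> card (V \<times> V)" using EV finV by (intro card_mono) auto
      also have "\<dots> \<le> N\<^sup>2"
        using \<Gamma>(3) by (simp add: card_cartesian_product V_def power2_eq_square mult_le_mono)
      finally have cE: "card E \<le> N\<^sup>2" .
      have "(x0, x) \<in> E\<^sup>*" using that by (simp add: V0_def)
      then obtain n where n: "n \<le> card E" "(x0, x) \<in> E ^^ n"
        unfolding rtrancl_finite_eq_relpow[OF finE] by auto
      from steps[OF n(2)] obtain w where w: "length w \<le> c * n" "x = x0 \<otimes> r w" by blast
      moreover have "c * n \<le> c * N\<^sup>2" using n(1) cE by simp
      ultimately show ?thesis using le_trans by blast
    qed
    have near': "reached (f (x \<otimes> r w)) \<and> dist (f (x \<otimes> r w)) \<le> D" if "x \<in> V0" "length w \<le> c" for x w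
    proof -
      from words[OF that(1)] obtain u where u: "length u \<le> c * N\<^sup>2" "x = x0 \<otimes> r u" by blast
      have "x \<otimes> r w = x0 \<otimes> r (u @ w)" using u(2) x0c by (simp add: r_append m_assoc)
      with near[of "u @ w"] u(1) that(2) show ?thesis by (simp add: D_def)
    qed
    have nearV: "reached (f x) \<and> dist (f x) \<le> D" if "x \<in> V0" for x
      using near'[OF that, of "[]"] that V0V VG by (auto simp: r_Nil)
    obtain z and label :: "'a set \<Rightarrow> 'a set option" where
      lab: "\<And>u v. (u, v) \<in> coset_graph k \<Longrightarrow> reached u \<Longrightarrow> dist u \<le> D \<Longrightarrow> dist v \<le> D \<Longrightarrow> u \<noteq> z \<Longrightarrow> v \<noteq> z \<Longrightarrow>
        label u = label v" and
      small: "\<And>l. 2 * card {x \<in> V0. f x \<noteq> z \<and> label (f x) = l} \<le> card V0"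
      using balanced_vertex[where V = V0 and f = f, OF finV0 nearV] by blast
    define C where "C = {x \<in> V0. \<exists>w\<in>W. f (x \<otimes> r w) = z}"
    have along: "label (f (x \<otimes> r w)) = label (f x)" if x: "x \<in> V0" "x \<notin> C" and w: "w \<in> W" for x w
      using w
    proof (induction w rule: rev_induct)
      case Nil
      then show ?case using x V0V VG by (auto simp: r_Nil)
    next
      case (snoc l w)
      have xc: "x \<in> carrier G" using x V0V VG by auto
      have wW: "w \<in> W" and len: "length w \<le> c" "length (w @ [l]) \<le> c" using snoc.prems by (auto simp: W_def)
      have app: "x \<otimes> r (w @ [l]) = (x \<otimes> r w) \<otimes> r [l]" using xc by (simp add: r_append m_assoc)
      have "label (f (x \<otimes> r (w @ [l]))) = label (f (x \<otimes> r w))"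
      proof (cases "fst l")
        case True
        then have "(f (x \<otimes> r w), f (x \<otimes> r (w @ [l]))) \<in> coset_graph k"
          unfolding app coset_graph_def f_def using xc
          by (intro CollectI exI[of _ "x \<otimes> r w"] exI[of _ "snd l"]) (cases l; auto)
        moreover have "f (x \<otimes> r w) \<noteq> z" "f (x \<otimes> r (w @ [l])) \<noteq> z"
          using x wW snoc.prems by (auto simp: C_def)
        ultimately show ?thesis
          using lab near'[OF x(1) len(1)] near'[OF x(1) len(2)] by metis
      next
        case False
        then have "r [l] \<in> H k" using a_in_H[of "snd l"] by (cases l) auto
        then have "f (x \<otimes> r w) = f (x \<otimes> r (w @ [l]))"
          using xc unfolding app f_def by (simp add: coset_eq_iff inv_cancel)
        then show ?thesis by simp
      qed
      with snoc.IH[OF wW] show ?case by simp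
    qed
    define E' where "E' = Restr E (V - C)"
    have "is_cut_set \<Gamma> C"
      unfolding is_cut_set_iff[OF \<Gamma>(1)] V_def[symmetric] E_def[symmetric] E'_def[symmetric]
    proof (intro conjI ballI)
      show "C \<subseteq> V" using V0V by (auto simp: C_def)
      fix x assume x: "x \<in> V - C"
      have E'E: "E' \<subseteq> E" by (auto simp: E'_def)
      show "2 * card (E'\<^sup>* `` {x}) \<le> card V"
      proof (cases "x \<in> V0")
        case True
        have stays: "y \<in> V0 \<and> y \<notin> C \<and> label (f y) = label (f x)" if "(x, y) \<in> E'\<^sup>*" for y
          using that
        proof (induction rule: rtrancl_induct)
          case (step y y')
          have e: "(y, y') \<in> E" "y' \<notin> C" using step by (auto simp: E'_def)
          then have "y' \<in> V0" using step.IH by (auto simp: V0_def intro: rtrancl_into_rtrancl)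
          moreover obtain w where "w \<in> W" "y' = y \<otimes> r w" using arc'[OF e(1)] by blast
          ultimately show ?case using along[of y w] step.IH e(2) by auto
        qed (use x True in auto)
        have nz: "f y \<noteq> z" if "y \<in> V0" "y \<notin> C" for y
        proof
          assume "f y = z"
          moreover have "y \<in> carrier G" using that V0V VG by blast
          ultimately have "f (y \<otimes> r []) = z" by (simp add: r_Nil)
          moreover have "[] \<in> W" by (simp add: W_def)
          ultimately show False using that unfolding C_def by blast
        qed
        have "E'\<^sup>* `` {x} \<subseteq> {y \<in> V0. f y \<noteq> z \<and> label (f y) = label (f x)}"
        proof
          fix y assume "y \<in> E'\<^sup>* `` {x}"
          then have "y \<in> V0 \<and> y \<notin> C \<and> label (f y) = label (f x)" by (intro stays) simp
          with nz show "y \<in> {y \<in> V0. f y \<noteq> z \<and> label (f y) = label (f x)}" by simp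
        qed
        then have "card (E'\<^sup>* `` {x}) \<le> card {y \<in> V0. f y \<noteq> z \<and> label (f y) = label (f x)}"
          by (intro card_mono) (use finV0 in auto)
        with small[of "label (f x)"] card_mono[OF finV V0V] show ?thesis by linarith
      next
        case False
        have stays: "y \<in> V \<and> y \<notin> V0" if "(x, y) \<in> E'\<^sup>*" for y
          using that
        proof (induction rule: rtrancl_induct)
          case (step y y')
          have "(y', y) \<in> E" "y' \<in> V" using step(2) E'E symE EV by (auto dest: symD)
          then show ?case using step.IH by (auto simp: V0_def intro: rtrancl_into_rtrancl)
        qed (use x False in auto)
        have "E'\<^sup>* `` {x} \<subseteq> V - V0"
        proof
          fix y assume "y \<in> E'\<^sup>* `` {x}"
          then have "y \<in> V \<and> y \<notin> V0" by (intro stays) simp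
          then show "y \<in> V - V0" by simp
        qed
        then have "card (E'\<^sup>* `` {x}) \<le> card (V - V0)"
          by (intro card_mono) (use finV in auto)
        also have "\<dots> = card V - card V0" using V0V finV0 by (simp add: card_Diff_subset)
        finally show ?thesis using x0(2) by (simp add: V0_def[symmetric])
      qed
    qed
    then have "cut_size \<Gamma> \<le> card C" by (rule cut_size_le_card_cut_set[OF \<Gamma>(1)])
    also have "card C \<le> card (\<Union>w\<in>W. {x \<in> V0. f (x \<otimes> r w) = z})"
      by (intro card_mono finite_UN_I finW) (use finV0 in \<open>auto simp: C_def\<close>)
    also have "\<dots> \<le> (\<Sum>w\<in>W. card {x \<in> V0. f (x \<otimes> r w) = z})"
      by (rule card_UN_le[OF finW])
    also have "\<dots> \<le> (\<Sum>w\<in>W. card (H k))"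
    proof (rule sum_mono)
      fix w assume "w \<in> W"
      show "card {x \<in> V0. f (x \<otimes> r w) = z} \<le> card (H k)"
      proof (cases "{x \<in> V0. f (x \<otimes> r w) = z} = {}")
        case True
        then show ?thesis by (metis card.empty le0)
      next
        case False
        then obtain y where y: "y \<in> V0" "f (y \<otimes> r w) = z" by auto
        define g where "g = y \<otimes> r w"
        have g: "g \<in> carrier G" "f g = z" using y V0V VG by (auto simp: g_def)
        show ?thesis
        proof (rule card_inj_on_le)
          show "inj_on (\<lambda>x. inv g \<otimes> (x \<otimes> r w)) {x \<in> V0. f (x \<otimes> r w) = z}"
          proof (rule inj_onI)
            fix x y assume "x \<in> {x \<in> V0. f (x \<otimes> r w) = z}" "y \<in> {x \<in> V0. f (x \<otimes> r w) = z}"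
              and eq: "inv g \<otimes> (x \<otimes> r w) = inv g \<otimes> (y \<otimes> r w)"
            then have "x \<in> carrier G" "y \<in> carrier G" using V0V VG by auto
            with eq g show "x = y" by simp
          qed
          show "(\<lambda>x. inv g \<otimes> (x \<otimes> r w)) ` {x \<in> V0. f (x \<otimes> r w) = z} \<subseteq> H k"
          proof clarify
            fix x assume "x \<in> V0" "z = f (x \<otimes> r w)"
            moreover from this have "x \<in> carrier G" using V0V VG by auto
            ultimately show "inv g \<otimes> (x \<otimes> r w) \<in> H k"
              using coset_eq_iff[of g "x \<otimes> r w" k] g by (simp add: f_def)
          qed
        qed (rule finite_H)
      qed
    qed
    also have "\<dots> = card (H k) * card {w :: word. length w \<le> c}" by (simp add: W_def)
    finally show ?thesis .
  qed
qed

lemma sep_upper_bound: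
  assumes S: "S \<subseteq> carrier G" "\<And>s. s \<in> S \<Longrightarrow> \<exists>w. length w \<le> c \<and> s = r w"
    and large: "2 * (c * N\<^sup>2 + c) + 1 \<le> R k"
  shows "sep (cayley_graph G S) N \<le> card (H k) * card {w :: word. length w \<le> c}"
proof (rule sep_le)
  interpret pair_bidirected_digraph "cayley_graph G S" by (rule cayley_graph_bidirected)
  show "pair_wf_digraph (cayley_graph G S)" by unfold_locales
qed (rule cut_size_le[OF S _ _ _ large])

lemma finite_word_length:
  assumes "finite S" "S \<subseteq> carrier G"
  obtains c where "\<And>s. s \<in> S \<Longrightarrow> \<exists>w. length w \<le> c \<and> s = r w"
proof -
  have "\<forall>s\<in>S. \<exists>w. s = r w" using assms(2) r_surj by (metis imageE subsetD)
  then obtain W where W: "\<forall>s\<in>S. s = r (W s)" by (rule bchoice[THEN exE])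
  show thesis
  proof (rule that)
    fix s assume "s \<in> S"
    then have "length (W s) \<le> Max ((length \<circ> W) ` S)" using assms(1) by auto
    with W \<open>s \<in> S\<close> show "\<exists>w. length w \<le> Max ((length \<circ> W) ` S) \<and> s = r w" by blast
  qed
qed

end

section \<open>Bounded separation forces an isoperimetric inequality\<close>

context group
begin

definition mult_list :: "'a list \<Rightarrow> 'a" where
  "mult_list us = foldr (\<otimes>) us \<one>"

definition edge_boundary :: "'a set \<Rightarrow> 'a set \<Rightarrow> ('a \<times> 'a) set" where
  "edge_boundary U A = {(x, u) \<in> A \<times> U. x \<otimes> u \<notin> A}"

lemma mult_list_simps [simp]: "mult_list [] = \<one>" "mult_list (u # us) = u \<otimes> mult_list us"
  by (simp_all add: mult_list_def)

lemma mult_list_closed [simp]: "set us \<subseteq> carrier G \<Longrightarrow> mult_list us \<in> carrier G"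
  by (induction us) auto

lemma mult_list_append: "set us \<subseteq> carrier G \<Longrightarrow> set vs \<subseteq> carrier G \<Longrightarrow> mult_list (us @ vs) = mult_list us \<otimes> mult_list vs"
  by (induction us) (auto simp: m_assoc)

lemma generate_mult_list:
  assumes "S \<subseteq> carrier G" "x \<in> generate G S"
  shows "\<exists>us. set us \<subseteq> S \<union> m_inv G ` S \<and> x = mult_list us"
  using assms(2)
proof (induction rule: generate.induct)
  case one
  show ?case by (intro exI[of _ "[]"]) simp
next
  case (incl h)
  then show ?case using assms(1) by (intro exI[of _ "[h]"]) auto
next
  case (inv h)
  then show ?case using assms(1) by (intro exI[of _ "[m_inv G h]"]) auto
next
  case (eng h1 h2)
  then obtain us vs where *: "set us \<subseteq> S \<union> m_inv G ` S" "h1 = mult_list us" "set vs \<subseteq> S \<union> m_inv G ` S" "h2 = mult_list vs"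
    by auto
  have "S \<union> m_inv G ` S \<subseteq> carrier G" using assms(1) by auto
  with * have "h1 \<otimes> h2 = mult_list (us @ vs)" using mult_list_append[of us vs] by (metis order_trans)
  with * show ?case by (intro exI[of _ "us @ vs"]) simp
qed

text \<open>
  A walk that leaves the set crosses its boundary in one of its steps, and a step is determined by
  its starting point.
\<close>

lemma card_exits_le:
  assumes "finite A" "A \<subseteq> carrier G" "finite U" "U \<subseteq> carrier G" "set us \<subseteq> U"
  shows "card {x \<in> A. x \<otimes> mult_list us \<notin> A} \<le> length us * card (edge_boundary U A)"
  using assms(5)
proof (induction us)
  case Nil
  have "{x \<in> A. x \<otimes> mult_list [] \<notin> A} = {}" using assms(2) by auto
  then show ?case by (metis card.empty le0)
next
  case (Cons u us)
  have u: "u \<in> U" "u \<in> carrier G" "set us \<subseteq> U" "mult_list us \<in> carrier G" using Cons.prems assms(4) by auto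
  have fin: "finite (edge_boundary U A)"
    using assms by (auto simp: edge_boundary_def intro: finite_subset[of _ "A \<times> U"])
  have "{x \<in> A. x \<otimes> mult_list (u # us) \<notin> A} \<subseteq> {x \<in> A. x \<otimes> u \<notin> A} \<union> {x \<in> A. x \<otimes> u \<in> {y \<in> A. y \<otimes> mult_list us \<notin> A}}"
    using u assms(2) by (auto simp: m_assoc)
  then have "card {x \<in> A. x \<otimes> mult_list (u # us) \<notin> A} \<le> card ({x \<in> A. x \<otimes> u \<notin> A} \<union> {x \<in> A. x \<otimes> u \<in> {y \<in> A. y \<otimes> mult_list us \<notin> A}})"
    by (intro card_mono) (use assms in auto)
  also have "\<dots> \<le> card {x \<in> A. x \<otimes> u \<notin> A} + card {x \<in> A. x \<otimes> u \<in> {y \<in> A. y \<otimes> mult_list us \<notin> A}}"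
    by (rule card_Un_le)
  also have "\<dots> \<le> card (edge_boundary U A) + length us * card (edge_boundary U A)"
  proof (rule add_mono)
    show "card {x \<in> A. x \<otimes> u \<notin> A} \<le> card (edge_boundary U A)"
      by (rule card_inj_on_le[where f = "\<lambda>x. (x, u)"]) (use u fin in \<open>auto simp: edge_boundary_def inj_on_def\<close>)
    have "card {x \<in> A. x \<otimes> u \<in> {y \<in> A. y \<otimes> mult_list us \<notin> A}} \<le> card {y \<in> A. y \<otimes> mult_list us \<notin> A}"
    proof (rule card_inj_on_le[where f = "\<lambda>x. x \<otimes> u"])
      show "inj_on (\<lambda>x. x \<otimes> u) {x \<in> A. x \<otimes> u \<in> {y \<in> A. y \<otimes> mult_list us \<notin> A}}"
      proof (rule inj_onI)
        fix x y assume "x \<in> {x \<in> A. x \<otimes> u \<in> {y \<in> A. y \<otimes> mult_list us \<notin> A}}"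
          "y \<in> {x \<in> A. x \<otimes> u \<in> {y \<in> A. y \<otimes> mult_list us \<notin> A}}" and eq: "x \<otimes> u = y \<otimes> u"
        then have "x \<in> carrier G" "y \<in> carrier G" using assms(2) by auto
        with eq u(2) show "x = y" by simp
      qed
    qed (use assms in auto)
    with Cons.IH[OF u(3)] show "card {x \<in> A. x \<otimes> u \<in> {y \<in> A. y \<otimes> mult_list us \<notin> A}} \<le> length us * card (edge_boundary U A)"
      by linarith
  qed
  finally show ?case by simp
qed

text \<open>
  An element \<open>x\<close> of \<open>A\<close> has \<open>x g \<in> A\<close> for at most \<open>card A\<close> elements \<open>g\<close>, so averaging over \<open>T\<close>
  at least half of \<open>A\<close> leaves \<open>A\<close>; each time it crosses the boundary.
\<close>

lemma small_sets_expand: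
  assumes A: "finite A" "A \<subseteq> carrier G" and U: "finite U" "U \<subseteq> carrier G"
    and T: "finite T" "\<And>g. g \<in> T \<Longrightarrow> \<exists>us. set us \<subseteq> U \<and> length us \<le> l \<and> g = mult_list us"
    and large: "2 * card A \<le> card T"
  shows "card A \<le> 2 * l * card (edge_boundary U A)"
proof (cases "A = {}")
  case False
  define b where "b = card (edge_boundary U A)"
  have TG: "g \<in> carrier G" if "g \<in> T" for g
    using T(2)[OF that] U(2) mult_list_closed by (meson order_trans)
  have exits: "card {x \<in> A. x \<otimes> g \<notin> A} \<le> l * b" if g: "g \<in> T" for g
  proof -
    obtain us where us: "set us \<subseteq> U" "length us \<le> l" "g = mult_list us" using T(2)[OF g] by blast
    from card_exits_le[OF A U us(1)] have "card {x \<in> A. x \<otimes> g \<notin> A} \<le> length us * b"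
      by (simp add: us(3) b_def)
    also have "\<dots> \<le> l * b" using us(2) by simp
    finally show ?thesis .
  qed
  have "card A * card T = (\<Sum>g\<in>T. card {x \<in> A. x \<otimes> g \<in> A} + card {x \<in> A. x \<otimes> g \<notin> A})"
  proof -
    have "card {x \<in> A. x \<otimes> g \<in> A} + card {x \<in> A. x \<otimes> g \<notin> A} = card A" for g
    proof -
      have "card ({x \<in> A. x \<otimes> g \<in> A} \<union> {x \<in> A. x \<otimes> g \<notin> A}) = card {x \<in> A. x \<otimes> g \<in> A} + card {x \<in> A. x \<otimes> g \<notin> A}"
        by (rule card_Un_disjoint) (use A in auto)
      moreover have "{x \<in> A. x \<otimes> g \<in> A} \<union> {x \<in> A. x \<otimes> g \<notin> A} = A" by auto
      ultimately show ?thesis by simp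
    qed
    then show ?thesis by simp
  qed
  also have "\<dots> = (\<Sum>g\<in>T. card {x \<in> A. x \<otimes> g \<in> A}) + (\<Sum>g\<in>T. card {x \<in> A. x \<otimes> g \<notin> A})"
    by (rule sum.distrib)
  also have "(\<Sum>g\<in>T. card {x \<in> A. x \<otimes> g \<in> A}) = card (Sigma T (\<lambda>g. {x \<in> A. x \<otimes> g \<in> A}))"
    by (rule card_SigmaI[symmetric]) (use T A in auto)
  also have "\<dots> \<le> card (A \<times> A)"
  proof (rule card_inj_on_le[where f = "\<lambda>(g, x). (x, x \<otimes> g)"])
    show "inj_on (\<lambda>(g, x). (x, x \<otimes> g)) (Sigma T (\<lambda>g. {x \<in> A. x \<otimes> g \<in> A}))"
      using TG A(2) by (auto simp: inj_on_def subset_iff)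
  qed (use A in auto)
  also have "(\<Sum>g\<in>T. card {x \<in> A. x \<otimes> g \<notin> A}) \<le> (\<Sum>g\<in>T. l * b)"
    by (rule sum_mono) (rule exits)
  finally have "card A * card T \<le> card A * card A + card T * (l * b)"
    by (simp add: card_cartesian_product)
  moreover have "2 * (card A * card A) \<le> card A * card T"
    using large mult_le_mono2[of "2 * card A" "card T" "card A"] by (simp add: mult.left_commute)
  ultimately have "card A * card T \<le> 2 * (card T * (l * b))" by linarith
  then have "card T * card A \<le> card T * (2 * l * b)" by (simp only: ac_simps)
  moreover have "0 < card A" using A(1) False by (simp add: card_gt_0_iff)
  with large have "0 < card T" by linarith
  ultimately show ?thesis by (simp add: b_def)
qed simp

text \<open>
  An edge that leaves a component of \<open>F - C\<close> ends in \<open>C\<close> or outside \<open>F\<close>.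
\<close>

lemma edge_boundary_pieces:
  assumes F: "finite F" "F \<subseteq> carrier G" and U: "finite U" "U \<subseteq> carrier G"
    and C: "C \<subseteq> F" and P: "finite P" "pairwise disjnt P" "\<Union>P = F - C"
    and closed: "\<And>A x u. A \<in> P \<Longrightarrow> x \<in> A \<Longrightarrow> u \<in> U \<Longrightarrow> x \<otimes> u \<in> F - C \<Longrightarrow> x \<otimes> u \<in> A"
  shows "(\<Sum>A\<in>P. card (edge_boundary U A)) \<le> card (edge_boundary U F) + card C * card U"
proof -
  have PF: "A \<subseteq> F" if "A \<in> P" for A using P(3) that by blast
  have finb: "finite (edge_boundary U A)" if "A \<subseteq> F" for A
    using finite_subset[OF that F(1)] U(1) by (auto simp: edge_boundary_def intro: finite_subset[of _ "A \<times> U"])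
  have "(\<Sum>A\<in>P. card (edge_boundary U A)) = card (\<Union>A\<in>P. edge_boundary U A)"
  proof (rule card_UN_disjoint[symmetric])
    show "\<forall>A\<in>P. \<forall>B\<in>P. A \<noteq> B \<longrightarrow> edge_boundary U A \<inter> edge_boundary U B = {}"
    proof (intro ballI impI)
      fix A B assume "A \<in> P" "B \<in> P" "A \<noteq> B"
      then have "A \<inter> B = {}" using P(2) by (auto simp: pairwise_def disjnt_def)
      then show "edge_boundary U A \<inter> edge_boundary U B = {}" by (auto simp: edge_boundary_def)
    qed
  qed (use P(1) finb PF in auto)
  also have "\<dots> \<le> card (edge_boundary U F \<union> {(x, u) \<in> F \<times> U. x \<otimes> u \<in> C})"
  proof (rule card_mono)
    show "finite (edge_boundary U F \<union> {(x, u) \<in> F \<times> U. x \<otimes> u \<in> C})"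
      using finb[of F] F(1) U(1) by (auto intro: finite_subset[of _ "F \<times> U"])
    show "(\<Union>A\<in>P. edge_boundary U A) \<subseteq> edge_boundary U F \<union> {(x, u) \<in> F \<times> U. x \<otimes> u \<in> C}"
    proof
      fix p assume "p \<in> (\<Union>A\<in>P. edge_boundary U A)"
      then obtain A x u where A: "A \<in> P" and p: "p = (x, u)" and xu: "x \<in> A" "u \<in> U" "x \<otimes> u \<notin> A"
        by (auto simp: edge_boundary_def)
      have "x \<in> F" using PF A xu by blast
      then show "p \<in> edge_boundary U F \<union> {(x, u) \<in> F \<times> U. x \<otimes> u \<in> C}"
        using closed[OF A xu(1,2)] xu by (auto simp: edge_boundary_def p)
    qed
  qed
  also have "\<dots> \<le> card (edge_boundary U F) + card {(x, u) \<in> F \<times> U. x \<otimes> u \<in> C}"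
    by (rule card_Un_le)
  also have "card {(x, u) \<in> F \<times> U. x \<otimes> u \<in> C} \<le> card (C \<times> U)"
  proof (rule card_inj_on_le[where f = "\<lambda>(x, u). (x \<otimes> u, u)"])
    show "inj_on (\<lambda>(x, u). (x \<otimes> u, u)) {(x, u) \<in> F \<times> U. x \<otimes> u \<in> C}"
    proof (rule inj_onI)
      fix p p' assume pp: "p \<in> {(x, u) \<in> F \<times> U. x \<otimes> u \<in> C}" "p' \<in> {(x, u) \<in> F \<times> U. x \<otimes> u \<in> C}"
        and eq: "(\<lambda>(x, u). (x \<otimes> u, u)) p = (\<lambda>(x, u). (x \<otimes> u, u)) p'"
      obtain x y u where p: "p = (x, u)" "p' = (y, u)" and xy: "x \<otimes> u = y \<otimes> u"
        using eq by (cases p; cases p') auto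
      have "x \<in> carrier G" "y \<in> carrier G" "u \<in> carrier G" using pp p F(2) U(2) by auto
      with xy p show "p = p'" by simp
    qed
    show "finite (C \<times> U)" using C F(1) U(1) finite_subset by blast
  qed auto
  finally show ?thesis by (simp add: card_cartesian_product)
qed

end

text \<open>
  This is the bookkeeping of the repeated cutting: a set of \<open>n > m\<close> elements may be charged
  \<open>2 n - m\<close>, and this pays both for the charges of its parts of size at most \<open>n / 2\<close> and for \<open>m\<close>
  more. The critical case is that of two or more parts bigger than \<open>m\<close>, each of which saves \<open>m\<close>.
\<close>

lemma pieces_excess:
  fixes f :: "'b \<Rightarrow> nat"
  assumes P: "finite P" "\<And>A. A \<in> P \<Longrightarrow> 2 * f A \<le> c" "sum f P \<le> c" and m: "m < c"
  shows "m + (\<Sum>A\<in>P. if f A \<le> m then 0 else 2 * f A - m) \<le> 2 * c - m"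
proof -
  define Q where "Q = {A \<in> P. m < f A}"
  have Q: "finite Q" "Q \<subseteq> P" using P by (auto simp: Q_def)
  have "(\<Sum>A\<in>P. if f A \<le> m then 0 else 2 * f A - m) = (\<Sum>A\<in>Q. 2 * f A - m)"
    by (rule sum.mono_neutral_cong_right) (use P in \<open>auto simp: Q_def\<close>)
  moreover have "m + (\<Sum>A\<in>Q. 2 * f A - m) \<le> 2 * c - m"
  proof -
    consider "Q = {}" | A where "Q = {A}" | "2 \<le> card Q"
      using Q(1) by (metis One_nat_def Suc_1 Suc_leI card_1_singletonE card_gt_0_iff le_neq_implies_less)
    then show ?thesis
    proof cases
      case 1
      then show ?thesis using m by simp
    next
      case (2 A)
      then have "A \<in> P" "m < f A" using Q by (auto simp: Q_def)
      with P(2)[of A] m show ?thesis by (simp add: 2)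
    next
      case 3
      have "(\<Sum>A\<in>Q. 2 * f A - m) + card Q * m = (\<Sum>A\<in>Q. 2 * f A - m + m)"
        by (simp add: sum.distrib)
      also have "\<dots> = (\<Sum>A\<in>Q. 2 * f A)"
        by (rule sum.cong) (auto simp: Q_def)
      also have "\<dots> = 2 * sum f Q" by (simp add: sum_distrib_left)
      also have "\<dots> \<le> 2 * c" using P(3) sum_mono2[OF P(1) Q(2), of f] by simp
      finally have "(\<Sum>A\<in>Q. 2 * f A - m) + card Q * m \<le> 2 * c" .
      moreover have "2 * m \<le> card Q * m" using 3 by simp
      ultimately show ?thesis by linarith
    qed
  qed
  ultimately show ?thesis by simp
qed

text \<open>
  By induction on \<open>F\<close>: cut \<open>F\<close> by at most \<open>B\<close> elements and apply the induction hypothesis to the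
  components. Their boundaries add up to at most the boundary of \<open>F\<close> and \<open>B * card U\<close> more, and
  \<open>pieces_excess\<close> absorbs the cost of the cut.
\<close>

lemma (in group) isoperimetry_from_bounded_sep:
  fixes S U and B K m :: nat
  assumes S: "finite S" "S \<subseteq> carrier G" and U: "U = S \<union> m_inv G ` S"
    and B: "\<And>n. sep (cayley_graph G S) n \<le> B"
    and small: "\<And>A. finite A \<Longrightarrow> A \<subseteq> carrier G \<Longrightarrow> card A \<le> m \<Longrightarrow> card A \<le> K * card (edge_boundary U A)"
    and F: "finite F" "F \<subseteq> carrier G"
  shows "m * card F \<le> m * K * card (edge_boundary U F) +
    (if card F \<le> m then 0 else B * (1 + K * card U) * (2 * card F - m))"
  using F
proof (induction "card F" arbitrary: F rule: less_induct)
  case less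
  define q where "q = B * (1 + K * card U)"
  define excess where "excess n = (if n \<le> m then 0 else 2 * n - m)" for n
  have UG: "finite U" "U \<subseteq> carrier G" using S by (auto simp: U)
  show ?case
  proof (cases "card F \<le> m")
    case True
    then show ?thesis using small[OF less.prems True] by simp
  next
    case False
    define \<Gamma> where "\<Gamma> = \<lparr>pverts = F, parcs = Restr (parcs (cayley_graph G S)) F\<rparr>"
    have \<Gamma>: "pair_graph \<Gamma>"
      using less.prems(1) by unfold_locales (auto simp: \<Gamma>_def cayley_graph_def symmetric_def sym_def arcs_ends_def arc_to_ends_def)
    have wf: "wf_digraph (with_proj \<Gamma>)" "wf_digraph (with_proj (cayley_graph G S))"
      by unfold_locales (auto simp: \<Gamma>_def cayley_graph_def)
    have "subgraph (with_proj \<Gamma>) (with_proj (cayley_graph G S))"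
      using wf less.prems(2) by (auto simp: subgraph_def compatible_def \<Gamma>_def cayley_graph_def)
    then have "cut_size \<Gamma> \<le> B"
      using cut_size_le_sep[OF \<Gamma>, of "cayley_graph G S" "card F"] B[of "card F"] by (simp add: \<Gamma>_def)
    then obtain C where cut: "is_cut_set \<Gamma> C" "card C \<le> B"
      using cut_size_attained[OF \<Gamma>] by metis
    define W where "W = F - C"
    define E where "E = Restr (parcs (cayley_graph G S)) W"
    have "Restr (parcs \<Gamma>) (pverts \<Gamma> - C) = E" by (auto simp: \<Gamma>_def E_def W_def)
    then have C: "C \<subseteq> F" "\<And>x. x \<in> W \<Longrightarrow> 2 * card (E\<^sup>* `` {x}) \<le> card F"
      using cut(1) unfolding is_cut_set_iff[OF \<Gamma>] by (auto simp: \<Gamma>_def W_def)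
    define P where "P = (\<lambda>x. E\<^sup>* `` {x}) ` W"
    have symE: "sym E" by (auto simp: E_def cayley_graph_def sym_def)
    have EW: "y \<in> W" if "(x, y) \<in> E\<^sup>*" "x \<in> W" for x y
      using that by induction (auto simp: E_def)
    have finW: "finite W" using less.prems by (simp add: W_def)
    have finP: "finite P" using finW by (simp add: P_def)
    have UP: "\<Union>P = W" using EW by (auto simp: P_def)
    have disj: "pairwise disjnt P"
    proof -
      have "E\<^sup>* `` {x} = E\<^sup>* `` {y}" if "(x, z) \<in> E\<^sup>*" "(y, z) \<in> E\<^sup>*" for x y z
      proof -
        have "(x, y) \<in> E\<^sup>*" "(y, x) \<in> E\<^sup>*"
          using that sym_rtrancl[OF symE] by (meson rtrancl_trans symD)+
        then show ?thesis by (auto intro: rtrancl_trans)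
      qed
      note same = this
      show ?thesis
      proof (rule pairwiseI)
        fix A A' assume "A \<in> P" "A' \<in> P" "A \<noteq> A'"
        then obtain x y where xy: "A = E\<^sup>* `` {x}" "A' = E\<^sup>* `` {y}" by (auto simp: P_def)
        show "disjnt A A'"
          unfolding disjnt_iff using same[of x _ y] xy \<open>A \<noteq> A'\<close> by blast
      qed
    qed
    have closed: "x \<otimes> u \<in> A" if A: "A \<in> P" and x: "x \<in> A" and u: "u \<in> U" and xu: "x \<otimes> u \<in> F - C" for A x u
    proof -
      obtain y where y: "y \<in> W" "A = E\<^sup>* `` {y}" using A by (auto simp: P_def)
      have xW: "x \<in> W" using UP A x by blast
      have xG: "x \<in> carrier G" using xW less.prems(2) by (auto simp: W_def)
      have uG: "u \<in> carrier G" using u UG(2) by blast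
      show ?thesis
      proof (cases "x = x \<otimes> u")
        case True
        then show ?thesis using x by simp
      next
        case False
        have "\<exists>s\<in>S. x \<otimes> u = x \<otimes> s \<or> x = x \<otimes> u \<otimes> s"
        proof (cases "u \<in> S")
          case False
          then obtain s where s: "s \<in> S" "u = inv s" using u by (auto simp: U)
          then have "x = x \<otimes> u \<otimes> s" using xG S(2) by (auto simp: m_assoc)
          with s show ?thesis by blast
        qed blast
        then have "(x, x \<otimes> u) \<in> E"
          using False xW xu xG uG by (auto simp: E_def cayley_graph_def W_def)
        then show ?thesis using x y by (auto intro: rtrancl_into_rtrancl)
      qed
    qed
    have PW: "A \<subseteq> F \<and> finite A \<and> A \<subseteq> carrier G" if "A \<in> P" for A
      using UP that finW less.prems(2) finite_subset[of A W] by (auto simp: W_def)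
    have half: "2 * card A \<le> card F" if "A \<in> P" for A
      using that C(2) by (auto simp: P_def)
    have cardW: "card W = (\<Sum>A\<in>P. card A)"
      using card_Union_disjoint[OF disj] PW UP by simp
    have cardF: "card F = card C + card W"
      using card_Diff_subset[OF finite_subset[OF C(1) less.prems(1)] C(1)] card_mono[OF less.prems(1) C(1)]
      by (simp add: W_def)
    have IH: "m * card A \<le> m * K * card (edge_boundary U A) + q * excess (card A)" if A: "A \<in> P" for A
      using less.hyps[of A] half[OF A] PW[OF A] False by (auto simp: q_def excess_def split: if_splits)
    have "(\<Sum>A\<in>P. m * card A) \<le> (\<Sum>A\<in>P. m * K * card (edge_boundary U A) + q * excess (card A))"
      by (rule sum_mono) (rule IH)
    also have "\<dots> = m * K * (\<Sum>A\<in>P. card (edge_boundary U A)) + q * (\<Sum>A\<in>P. excess (card A))"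
      by (simp add: sum.distrib sum_distrib_left)
    also have "\<dots> \<le> m * K * (card (edge_boundary U F) + B * card U) + q * (\<Sum>A\<in>P. excess (card A))"
    proof -
      have "(\<Sum>A\<in>P. card (edge_boundary U A)) \<le> card (edge_boundary U F) + card C * card U"
        by (rule edge_boundary_pieces) (use less.prems UG C finP disj UP closed in \<open>auto simp: W_def\<close>)
      also have "\<dots> \<le> card (edge_boundary U F) + B * card U" using cut(2) by simp
      finally show ?thesis by simp
    qed
    finally have "m * card W \<le> m * K * (card (edge_boundary U F) + B * card U) + q * (\<Sum>A\<in>P. excess (card A))"
      by (simp add: cardW sum_distrib_left)
    moreover have "m * card C \<le> m * B" using cut(2) by simp
    moreover have "m * card F = m * card C + m * card W" by (simp add: cardF distrib_left)
    ultimately have "m * card F \<le> m * B + (m * K * (card (edge_boundary U F) + B * card U) + q * (\<Sum>A\<in>P. excess (card A)))"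
      by linarith
    also have "\<dots> = m * K * card (edge_boundary U F) + q * (m + (\<Sum>A\<in>P. excess (card A)))"
      by (simp add: q_def algebra_simps)
    also have "\<dots> \<le> m * K * card (edge_boundary U F) + q * (2 * card F - m)"
    proof -
      have "m + (\<Sum>A\<in>P. excess (card A)) \<le> 2 * card F - m"
        unfolding excess_def by (rule pieces_excess) (use finP half cardW cardF False in auto)
      then show ?thesis by simp
    qed
    finally show ?thesis using False by (simp add: q_def)
  qed
qed

section \<open>Exponential growth and Foelner sets\<close>

context tower_group
begin

lemma r_mult_list: "r w = mult_list (map (\<lambda>l. r [l]) w)"
proof (induction w)
  case (Cons l w)
  then show ?case using r_append[of "[l]" w] by simp
qed (simp add: r_Nil)

text \<open>
  The path from \<open>H\<^sub>n\<close> along \<open>t\<close> and, after \<open>a\<^sub>n\<close>, back along the inverse of \<open>t\<close> does not backtrack if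
  \<open>a\<^sub>n\<close> is not in \<open>\<langle>a\<^sub>0, \<dots>, a\<^sub>n\<^sub>-\<^sub>1\<rangle>\<close>. As there are no short cycles, it does not return to \<open>H\<^sub>n\<close>, so
  \<open>a\<^sub>n\<^sub>+\<^sub>1\<close> is not in \<open>H\<^sub>n\<close> either.
\<close>

lemma new_conjugate: "r (conj_letter n True) \<notin> r ` conj_words {..<n}"
proof (induction n)
  case 0
  have "conj_words {..<0} = {[]}" by (auto intro: conj_words.Nil elim: conj_words.cases)
  then show ?case using a_nontrivial by (simp add: conj_letter_def r_Nil)
next
  case (Suc n)
  let ?ps = "[([], True), (conj_letter n True, False)]"
  have "r (syllables ?ps) \<notin> r ` conj_words {..n}"
  proof (rule girth)
    show "length ?ps \<le> R n" using girth_large[of n] by simp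
    show "fst ` set ?ps \<subseteq> conj_words {..n}" by (auto intro: conj_words.Nil conj_words_letter)
    show "nonbacktracking (\<lambda>e. {u. r u \<in> r ` conj_words (assoc_index n e)}) ?ps"
      using Suc.IH by (simp add: nonbacktracking_def assoc_index_def)
  qed simp
  then show ?case by (simp add: syllables_def conj_letter_Suc lessThan_Suc_atMost)
qed

lemma t_power_notin_H: "0 < j \<Longrightarrow> r (replicate j (True, True)) \<notin> H n"
proof -
  assume j: "0 < j"
  define k where "k = max j n"
  let ?ps = "replicate j ([] :: word, True)"
  have "r (syllables ?ps) \<notin> r ` conj_words {..k}"
  proof (rule girth)
    show "length ?ps \<le> R k" using girth_large[of k] by (simp add: k_def)
    show "fst ` set ?ps \<subseteq> conj_words {..k}" by (auto intro: conj_words.Nil)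
    show "nonbacktracking (\<lambda>e. {u. r u \<in> r ` conj_words (assoc_index k e)}) ?ps"
      by (auto simp: nonbacktracking_def successively_conv_nth)
  qed (use j in simp)
  moreover have "syllables ?ps = replicate j (True, True)"
    by (induction j) (auto simp: syllables_def)
  ultimately show ?thesis using H_mono[of n k] by (auto simp: H_def k_def)
qed

text \<open>
  The words \<open>a\<^sup>\<epsilon>\<^sup>0 t a\<^sup>\<epsilon>\<^sup>1 t \<dots> t a\<^sup>\<epsilon>\<^sup>n\<close> with all exponents \<open>0\<close> or \<open>1\<close>: they have linear length and represent
  exponentially many elements.
\<close>

fun binary_words :: "nat \<Rightarrow> word set" where
  "binary_words 0 = {[], [(False, True)]}"
| "binary_words (Suc n) = (\<lambda>w. w @ [(True, True)]) ` binary_words n \<union> (\<lambda>w. w @ [(True, True), (False, True)]) ` binary_words n"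

lemma binary_words_length: "w \<in> binary_words n \<Longrightarrow> length w \<le> 2 * n + 1"
  by (induction n arbitrary: w) (auto, fastforce+)

lemma replicate_t: "r (replicate (Suc n) (True, True)) = r (replicate n (True, True)) \<otimes> t True"
  using r_append[of "replicate n (True, True)" "[(True, True)]"] by (simp add: replicate_append_same)

lemma t_power_a: "r (replicate n (True, True)) \<otimes> r [(False, s)] = r (conj_letter n s) \<otimes> r (replicate n (True, True))"
proof -
  let ?p = "replicate n (True, True)" and ?q = "replicate n (True, False)" and ?a = "(False, s)"
  have "r ?q \<otimes> r ?p = \<one>"
    using r_inverse_word[of ?q] by (simp add: inverse_word_def)
  moreover have "r (conj_letter n s) = r ?p \<otimes> (r [?a] \<otimes> r ?q)"
    using r_append[of ?p "?a # ?q"] r_append[of "[?a]" ?q] by (simp add: conj_letter_def)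
  ultimately show ?thesis by (simp add: m_assoc)
qed

lemma binary_words_in_window: "w \<in> binary_words n \<Longrightarrow> \<exists>h\<in>H n. r w = h \<otimes> r (replicate n (True, True))"
proof (induction n arbitrary: w)
  case 0
  have "r w \<in> H 0" using 0 subgroup.one_closed[OF subgroup_H] a_in_H[of True 0] by (auto simp: r_Nil)
  then show ?case by (intro bexI[of _ "r w"]) (simp_all add: r_Nil)
next
  case (Suc n)
  then obtain w' where w': "w' \<in> binary_words n"
      "w = w' @ [(True, True)] \<or> w = w' @ [(True, True), (False, True)]" by auto
  obtain h where h: "h \<in> H n" "r w' = h \<otimes> r (replicate n (True, True))" using Suc.IH[OF w'(1)] by blast
  have hG: "h \<in> carrier G" using h(1) subgroup.mem_carrier[OF subgroup_H] by blast
  have h': "h \<in> H (Suc n)" using h(1) H_mono[of n "Suc n"] by auto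
  have 1: "r (w' @ [(True, True)]) = h \<otimes> r (replicate (Suc n) (True, True))"
    using hG by (simp add: r_append h(2) replicate_t m_assoc del: replicate_Suc)
  have c: "r (conj_letter (Suc n) True) \<in> H (Suc n)" unfolding H_def by (intro imageI conj_words_letter) simp
  have "r (w' @ [(True, True), (False, True)]) = h \<otimes> (r (replicate (Suc n) (True, True)) \<otimes> r [(False, True)])"
    using r_append[of "w' @ [(True, True)]" "[(False, True)]"] 1 hG by (simp add: m_assoc del: replicate_Suc)
  also have "\<dots> = (h \<otimes> r (conj_letter (Suc n) True)) \<otimes> r (replicate (Suc n) (True, True))"
    using hG by (simp add: t_power_a m_assoc del: replicate_Suc)
  finally have 2: "r (w' @ [(True, True), (False, True)]) = (h \<otimes> r (conj_letter (Suc n) True)) \<otimes> r (replicate (Suc n) (True, True))" .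
  show ?case using w'(2) 1 2 h' c subgroup.m_closed[OF subgroup_H h' c] by metis
qed

text \<open>
  The elements of \<open>binary_words n\<close> lie in \<open>H\<^sub>n t\<^sup>n\<close>. If appending \<open>t\<close> and \<open>t a\<close> to two of them gave the same
  element, \<open>a\<^sub>n\<^sub>+\<^sub>1\<close> would be in \<open>H\<^sub>n\<close>. So the number of elements doubles.
\<close>

lemma card_binary_words: "card (r ` binary_words n) = 2 ^ Suc n"
proof (induction n)
  case 0
  have "r [] \<noteq> r [(False, True)]" using a_nontrivial by (simp add: r_Nil)
  then show ?case by simp
next
  case (Suc n)
  have fin: "finite (binary_words n)" for n by (induction n) auto
  have a: "r [(False, True)] \<in> carrier G" by simp
  define X where "X = (\<lambda>x. x \<otimes> t True) ` r ` binary_words n"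
  define Y where "Y = (\<lambda>x. x \<otimes> (t True \<otimes> r [(False, True)])) ` r ` binary_words n"
  have ta: "r [(True, True), (False, True)] = t True \<otimes> r [(False, True)]"
    using r_append[of "[(True, True)]" "[(False, True)]"] by simp
  have "r ` binary_words (Suc n) = X \<union> Y"
    by (simp add: X_def Y_def image_Un image_image r_append ta)
  moreover have "card X = 2 ^ Suc n" "card Y = 2 ^ Suc n"
    unfolding X_def Y_def Suc.IH[symmetric]
    by (rule card_image; rule inj_onI; auto)+
  moreover have "X \<inter> Y = {}"
  proof (rule ccontr)
    assume "X \<inter> Y \<noteq> {}"
    then obtain v w where vw: "v \<in> binary_words n" "w \<in> binary_words n"
      "r v \<otimes> t True = r w \<otimes> (t True \<otimes> r [(False, True)])" by (auto simp: X_def Y_def)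
    obtain g where g: "g \<in> H n" "r v = g \<otimes> r (replicate n (True, True))" using binary_words_in_window[OF vw(1)] by blast
    obtain h where h: "h \<in> H n" "r w = h \<otimes> r (replicate n (True, True))" using binary_words_in_window[OF vw(2)] by blast
    have G: "g \<in> carrier G" "h \<in> carrier G" using g h subgroup.mem_carrier[OF subgroup_H] by blast+
    have "g \<otimes> r (replicate (Suc n) (True, True)) = h \<otimes> (r (replicate (Suc n) (True, True)) \<otimes> r [(False, True)])"
      using vw(3) G by (simp add: g h replicate_t m_assoc del: replicate_Suc)
    also have "\<dots> = (h \<otimes> r (conj_letter (Suc n) True)) \<otimes> r (replicate (Suc n) (True, True))"
      using G by (simp add: t_power_a m_assoc del: replicate_Suc)
    finally have "g = h \<otimes> r (conj_letter (Suc n) True)" using G by (simp del: replicate_Suc)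
    then have "inv h \<otimes> g = r (conj_letter (Suc n) True)" using G by (simp add: inv_cancel)
    moreover have "inv h \<otimes> g \<in> H n"
      using g h subgroup_H subgroup.m_closed subgroup.m_inv_closed by metis
    ultimately show False using new_conjugate[of "Suc n"] by (simp add: H_def lessThan_Suc_atMost)
  qed
  moreover have "finite X" "finite Y" using fin by (simp_all add: X_def Y_def)
  ultimately show ?case by (simp add: card_Un_disjoint)
qed

end

lemma linear_below_power: "\<exists>n. D * (2 * n + 1) \<le> (2::nat) ^ n"
proof -
  define j where "j = 4 * D"
  have j: "j + 1 \<le> 2 ^ j" by (metis Suc_eq_plus1 Suc_leI less_exp)
  have "D * (2 * (2 * j) + 1) \<le> (j + 1) * (j + 1)"
    by (simp add: j_def algebra_simps)
  also have "\<dots> \<le> 2 ^ j * 2 ^ j" using j by (intro mult_le_mono)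
  also have "\<dots> = 2 ^ (2 * j)" by (simp add: power_add[symmetric] mult_2)
  finally show ?thesis by blast
qed

context tower_group
begin

definition foelner :: "nat \<Rightarrow> 'a set" where
  "foelner n = (\<lambda>(h, j). h \<otimes> r (replicate j (True, True))) ` (H n \<times> {..n})"

lemma H_closed: "h \<in> H n \<Longrightarrow> h \<in> carrier G"
  using subgroup.mem_carrier[OF subgroup_H] .

lemma r_replicate_add: "r (replicate (i + j) (True, True)) = r (replicate i (True, True)) \<otimes> r (replicate j (True, True))"
  by (simp add: replicate_add r_append)

lemma foelner_basic: "finite (foelner n)" "foelner n \<subseteq> carrier G" "card (foelner n) = card (H n) * Suc n"
proof -
  show "finite (foelner n)" by (simp add: foelner_def finite_H)
  show "foelner n \<subseteq> carrier G" using H_closed by (auto simp: foelner_def)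
  \<comment> \<open>injectivity: no positive power of \<open>t\<close> lies in \<open>H n\<close>\<close>
  have *: "i = j \<and> g = h" if gh: "g \<in> H n" "h \<in> H n" and "i \<le> j"
      and eq: "g \<otimes> r (replicate i (True, True)) = h \<otimes> r (replicate j (True, True))" for g h i j
  proof -
    define d where "d = j - i"
    have j: "j = d + i" using \<open>i \<le> j\<close> by (simp add: d_def)
    have "g \<otimes> r (replicate i (True, True)) = (h \<otimes> r (replicate d (True, True))) \<otimes> r (replicate i (True, True))"
      using eq gh H_closed by (simp add: j r_replicate_add m_assoc)
    then have g: "g = h \<otimes> r (replicate d (True, True))" using gh H_closed by simp
    then have "inv h \<otimes> g = r (replicate d (True, True))" using gh H_closed by (simp add: inv_cancel)
    moreover have "inv h \<otimes> g \<in> H n"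
      using gh subgroup_H subgroup.m_closed subgroup.m_inv_closed by metis
    ultimately have "d = 0" using t_power_notin_H[of d n] by auto
    then show ?thesis using g j gh H_closed by (simp add: r_Nil)
  qed
  have "inj_on (\<lambda>(h, j). h \<otimes> r (replicate j (True, True))) (H n \<times> {..n})"
  proof (rule inj_onI, clarify)
    fix g i h j assume "g \<in> H n" "h \<in> H n" "g \<otimes> r (replicate i (True, True)) = h \<otimes> r (replicate j (True, True))"
    then show "g = h \<and> i = j" using *[of g h i j] *[of h g j i] by (cases "i \<le> j") auto
  qed
  then show "card (foelner n) = card (H n) * Suc n"
    by (simp add: foelner_def card_image card_cartesian_product)
qed

text \<open>
  Right multiplication by \<open>a\<close> sends \<open>h t\<^sup>j\<close> to \<open>h a\<^sub>j t\<^sup>j\<close>, so only the extreme powers of \<open>t\<close> have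
  edges to the outside.
\<close>

lemma foelner_boundary: "card (edge_boundary (range (\<lambda>l. r [l])) (foelner n)) \<le> 2 * card (H n)"
proof -
  define p where "p j = r (replicate j (True, True))" for j
  have "edge_boundary (range (\<lambda>l. r [l])) (foelner n) \<subseteq>
      (\<lambda>h. (h \<otimes> p n, t True)) ` H n \<union> (\<lambda>h. (h \<otimes> p 0, t False)) ` H n"
  proof
    fix q assume "q \<in> edge_boundary (range (\<lambda>l. r [l])) (foelner n)"
    then obtain h j l where q: "q = (h \<otimes> p j, r [l])" and h: "h \<in> H n" "j \<le> n"
      and out: "h \<otimes> p j \<otimes> r [l] \<notin> foelner n"
      by (auto simp: edge_boundary_def foelner_def p_def)
    have inF: "g \<otimes> p i \<in> foelner n" if "g \<in> H n" "i \<le> n" for g i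
      using that by (auto simp: foelner_def p_def)
    have hG: "h \<in> carrier G" and pG: "p i \<in> carrier G" for i using h H_closed by (auto simp: p_def)
    obtain g s where l: "l = (g, s)" by fastforce
    show "q \<in> (\<lambda>h. (h \<otimes> p n, t True)) ` H n \<union> (\<lambda>h. (h \<otimes> p 0, t False)) ` H n"
    proof (cases g)
      case False
      have c: "p j \<otimes> r [(False, s)] = r (conj_letter j s) \<otimes> p j"
        unfolding p_def by (rule t_power_a)
      have "r (conj_letter j s) \<in> H n" unfolding H_def using h(2) by (intro imageI conj_words_letter) simp
      then have "h \<otimes> r (conj_letter j s) \<in> H n" using h(1) subgroup.m_closed[OF subgroup_H] by blast
      from inF[OF this h(2)] have "h \<otimes> p j \<otimes> r [l] \<in> foelner n"
        using False c hG pG by (simp add: l m_assoc)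
      with out show ?thesis by contradiction
    next
      case True
      show ?thesis
      proof (cases s)
        case s: True
        have "h \<otimes> p j \<otimes> r [l] = h \<otimes> p (Suc j)"
          using hG pG True s by (simp add: l p_def replicate_t m_assoc del: replicate_Suc)
        with inF[OF h(1), of "Suc j"] out h(2) have "j = n" by (metis Suc_leI le_neq_implies_less)
        then show ?thesis using q h True s by (auto simp: l)
      next
        case s: False
        have "j = 0"
        proof (cases j)
          case (Suc i)
          have "h \<otimes> p j \<otimes> r [l] = h \<otimes> p i"
            using hG pG[of i] True s t_cancel[of True] by (simp add: l p_def Suc replicate_t m_assoc del: replicate_Suc)
          with inF[OF h(1), of i] out h(2) Suc show ?thesis by simp
        qed
        then show ?thesis using q h True s by (auto simp: l)
      qed
    qed
  qed
  then have "card (edge_boundary (range (\<lambda>l. r [l])) (foelner n)) \<le>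
      card ((\<lambda>h. (h \<otimes> p n, t True)) ` H n \<union> (\<lambda>h. (h \<otimes> p 0, t False)) ` H n)"
    by (intro card_mono) (use finite_H in auto)
  also have "\<dots> \<le> card ((\<lambda>h. (h \<otimes> p n, t True)) ` H n) + card ((\<lambda>h. (h \<otimes> p 0, t False)) ` H n)"
    by (rule card_Un_le)
  also have "\<dots> \<le> card (H n) + card (H n)"
    by (intro add_mono card_image_le finite_H)
  finally show ?thesis by simp
qed

text \<open>
  A linear isoperimetric inequality for all finite sets is incompatible with Foelner sets.
\<close>

lemma sep_unbounded:
  assumes S: "finite_generating_set G S"
  shows "\<exists>n. B < sep (cayley_graph G S) n"
proof (rule ccontr)
  assume "\<nexists>n. B < sep (cayley_graph G S) n"
  then have B: "sep (cayley_graph G S) n \<le> B" for n by (simp add: not_less)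
  have SG: "finite S" "S \<subseteq> carrier G" "generate G S = carrier G"
    using S by (auto simp: finite_generating_set_def)
  define U where "U = S \<union> m_inv G ` S"
  have U: "finite U" "U \<subseteq> carrier G" using SG by (auto simp: U_def)
  obtain c where c: "\<And>u. u \<in> U \<Longrightarrow> \<exists>w. length w \<le> c \<and> u = r w"
    using finite_word_length[OF U] by blast
  have "\<forall>l. \<exists>us. set us \<subseteq> U \<and> r [l] = mult_list us"
    using generate_mult_list[OF SG(2)] SG(3) by (simp add: U_def)
  then obtain us where us: "\<And>l. set (us l) \<subseteq> U" "\<And>l. r [l] = mult_list (us l)" by metis
  define d where "d = Max (range (\<lambda>l. length (us l)))"
  have d: "length (us l) \<le> d" for l unfolding d_def by (intro Max_ge) auto
  have words: "\<exists>vs. set vs \<subseteq> U \<and> length vs \<le> d * length w \<and> r w = mult_list vs" for w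
  proof (induction w)
    case Nil
    show ?case by (intro exI[of _ "[]"]) (simp add: r_Nil)
  next
    case (Cons l w)
    then obtain vs where vs: "set vs \<subseteq> U" "length vs \<le> d * length w" "r w = mult_list vs" by blast
    have "set (us l) \<subseteq> carrier G" "set vs \<subseteq> carrier G" using us(1)[of l] vs(1) U(2) by auto
    then have "r (l # w) = mult_list (us l @ vs)"
      using r_append[of "[l]" w] us(2)[of l] vs(3) by (simp add: mult_list_append)
    with vs us(1)[of l] d[of l] show ?case by (intro exI[of _ "us l @ vs"]) auto
  qed
  \<comment> \<open>sets of size \<open>2 ^ n\<close> expand by a factor of order \<open>1 / n\<close>, which outweighs the cost \<open>B / 2 ^ n\<close> of cutting\<close>
  obtain n where n: "(4 * B * (1 + 2 * d * card U)) * (2 * n + 1) \<le> 2 ^ n"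
    using linear_below_power by blast
  define m where "m = (2::nat) ^ n"
  define K where "K = 2 * (d * (2 * n + 1))"
  have small: "card A \<le> K * card (edge_boundary U A)"
    if A: "finite A" "A \<subseteq> carrier G" "card A \<le> m" for A
  proof -
    have "finite (binary_words n)" by (induction n) auto
    moreover have "\<exists>vs. set vs \<subseteq> U \<and> length vs \<le> d * (2 * n + 1) \<and> g = mult_list vs" if g: "g \<in> r ` binary_words n" for g
    proof -
      obtain w where w: "w \<in> binary_words n" "g = r w" using g by blast
      obtain vs where "set vs \<subseteq> U" "length vs \<le> d * length w" "r w = mult_list vs" using words by blast
      moreover have "d * length w \<le> d * (2 * n + 1)" using binary_words_length[OF w(1)] by (rule mult_le_mono2)
      ultimately show ?thesis using w(2) le_trans by blast
    qed
    ultimately show ?thesis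
      unfolding K_def using A U card_binary_words[of n]
      by (intro small_sets_expand[where T = "r ` binary_words n"]) (auto simp: m_def)
  qed
  define q where "q = B * (1 + K * card U)"
  have "4 * q \<le> m"
  proof -
    have "1 + K * card U \<le> (1 + 2 * d * card U) * (2 * n + 1)"
      by (simp add: K_def algebra_simps)
    then have "4 * q \<le> (4 * B) * ((1 + 2 * d * card U) * (2 * n + 1))"
      unfolding q_def mult.assoc[symmetric] by (metis mult.assoc mult_le_mono2)
    also have "\<dots> \<le> m" unfolding m_def mult.assoc[symmetric] using n by (simp only: mult.assoc)
    finally show ?thesis .
  qed
  have expand: "card F \<le> 2 * K * card (edge_boundary U F)" if F: "finite F" "F \<subseteq> carrier G" for F
  proof -
    have "m * card F \<le> m * K * card (edge_boundary U F) + (if card F \<le> m then 0 else q * (2 * card F - m))"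
      unfolding q_def by (rule isoperimetry_from_bounded_sep[OF SG(1,2) U_def B small F])
    also have "(if card F \<le> m then 0 else q * (2 * card F - m)) \<le> q * (2 * card F)"
      by simp
    finally have 1: "m * card F \<le> m * K * card (edge_boundary U F) + 2 * (q * card F)" by simp
    have "4 * (q * card F) \<le> m * card F" using \<open>4 * q \<le> m\<close> mult_le_mono1[of "4 * q" m "card F"] by simp
    with 1 have "m * card F \<le> 2 * (m * K * card (edge_boundary U F))" by linarith
    then have "m * card F \<le> m * (2 * K * card (edge_boundary U F))" by (simp only: ac_simps)
    moreover have "0 < m" by (simp add: m_def)
    ultimately show ?thesis by simp
  qed
  have boundary: "card (edge_boundary U (foelner N)) \<le> card U * (c * (2 * card (H N)))" for N
  proof -
    let ?F = "foelner N"
    have "card (edge_boundary U ?F) \<le> card (\<Union>u\<in>U. (\<lambda>x. (x, u)) ` {x \<in> ?F. x \<otimes> u \<notin> ?F})"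
      by (intro card_mono) (use U foelner_basic in \<open>auto simp: edge_boundary_def\<close>)
    also have "\<dots> \<le> (\<Sum>u\<in>U. card ((\<lambda>x. (x, u)) ` {x \<in> ?F. x \<otimes> u \<notin> ?F}))"
      by (rule card_UN_le[OF U(1)])
    also have "\<dots> \<le> (\<Sum>u\<in>U. c * (2 * card (H N)))"
    proof (rule sum_mono)
      fix u assume "u \<in> U"
      then obtain w where w: "length w \<le> c" "u = r w" using c by blast
      have "card ((\<lambda>x. (x, u)) ` {x \<in> ?F. x \<otimes> u \<notin> ?F}) \<le> card {x \<in> ?F. x \<otimes> u \<notin> ?F}"
        by (rule card_image_le) (use foelner_basic in auto)
      also have "\<dots> \<le> length (map (\<lambda>l. r [l]) w) * card (edge_boundary (range (\<lambda>l. r [l])) ?F)"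
        unfolding w(2) r_mult_list[of w] by (rule card_exits_le) (use foelner_basic in auto)
      also have "\<dots> \<le> c * (2 * card (H N))"
        using w(1) foelner_boundary[of N] by (intro mult_le_mono) auto
      finally show "card ((\<lambda>x. (x, u)) ` {x \<in> ?F. x \<otimes> u \<notin> ?F}) \<le> c * (2 * card (H N))" .
    qed
    also have "\<dots> = card U * (c * (2 * card (H N)))" by simp
    finally show ?thesis .
  qed
  define N where "N = 2 * K * (card U * (c * 2))"
  have "card (H N) * Suc N \<le> 2 * K * (card U * (c * (2 * card (H N))))"
    using expand[OF foelner_basic(1,2)] boundary[of N] foelner_basic(3)[of N]
    by (metis le_trans mult_le_mono2)
  also have "\<dots> = card (H N) * N" by (simp add: N_def)
  finally have "card (H N) = 0" by simp
  moreover have "\<one> \<in> H N" using subgroup.one_closed[OF subgroup_H] .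
  ultimately show False using finite_H by auto
qed

end

section \<open>Groups with arbitrarily slow unbounded separation\<close>

text \<open>
  The group of permutations generated by \<open>\<theta>\<close> is countable; its elements are coded by natural
  numbers through chosen words.
\<close>

lemma nat_group_of_tower:
  fixes \<theta> :: "bool \<Rightarrow> nat \<Rightarrow> nat"
  assumes \<theta>: "\<And>g. bij (\<theta> g)" "\<theta> False \<noteq> id"
    and invariant: "\<And>k w x. x < m k \<Longrightarrow> act \<theta> w x < m k"
    and faithful: "\<And>k w w'. w \<in> conj_words {..k} \<Longrightarrow> w' \<in> conj_words {..k} \<Longrightarrow> (\<forall>x<m k. act \<theta> w x = act \<theta> w' x) \<Longrightarrow> act \<theta> w = act \<theta> w'"
    and nontrivial: "\<And>k ps w. w \<in> conj_words {..k} \<Longrightarrow> ps \<noteq> [] \<Longrightarrow> length ps \<le> R k \<Longrightarrow> fst ` set ps \<subseteq> conj_words {..k} \<Longrightarrow>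
       nonbacktracking (\<lambda>e. {u. act \<theta> u \<in> act \<theta> ` conj_words (assoc_index k e)}) ps \<Longrightarrow>
       act \<theta> (syllables ps @ w) \<noteq> id"
    and large: "\<And>k. k + 2 \<le> R k"
  obtains G :: "nat monoid" and r where "tower_group G r R" "\<And>k. card (r ` conj_words {..k}) \<le> m k ^ m k"
proof -
  define r :: "word \<Rightarrow> nat" where "r w = to_nat (SOME w'. act \<theta> w' = act \<theta> w)" for w
  define word_of :: "nat \<Rightarrow> word" where "word_of = from_nat"
  have word_of_r: "act \<theta> (word_of (r w)) = act \<theta> w" for w
    unfolding r_def word_of_def from_nat_to_nat by (rule someI[of _ w]) simp
  have r_eq: "r u = r w \<longleftrightarrow> act \<theta> u = act \<theta> w" for u w
    using word_of_r by (metis r_def)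
  define G :: "nat monoid" where "G = \<lparr>carrier = range r, monoid.mult = \<lambda>x y. r (word_of x @ word_of y), one = r []\<rparr>"
  have mult: "r u \<otimes>\<^bsub>G\<^esub> r w = r (u @ w)" for u w
    by (simp add: G_def r_eq act_append word_of_r)
  have one: "\<one>\<^bsub>G\<^esub> = r []" and carrier: "carrier G = range r" by (simp_all add: G_def)
  have grp: "group G"
  proof (rule groupI)
    fix x assume "x \<in> carrier G"
    then obtain w where w: "x = r w" by (auto simp: carrier)
    have "act \<theta> (inverse_word w @ w) = act \<theta> []" using act_inverse_word(2)[of \<theta> w] \<theta>(1) by (simp add: fun_eq_iff)
    then have "r (inverse_word w) \<otimes>\<^bsub>G\<^esub> x = \<one>\<^bsub>G\<^esub>" by (simp add: w mult one r_eq)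
    then show "\<exists>y\<in>carrier G. y \<otimes>\<^bsub>G\<^esub> x = \<one>\<^bsub>G\<^esub>" by (auto simp: carrier)
  qed (auto simp: carrier mult one)
  have image_iff: "r u \<in> r ` W \<longleftrightarrow> act \<theta> u \<in> act \<theta> ` W" for u W
    by (auto simp: image_iff r_eq)
  have card_window: "finite (r ` conj_words {..k}) \<and> card (r ` conj_words {..k}) \<le> m k ^ m k" for k
  proof -
    define F where "F = {..<m k} \<rightarrow>\<^sub>E {..<m k}"
    \<comment> \<open>by faithfulness, an element is determined by its action on the points below \<open>m k\<close>\<close>
    define \<rho> where "\<rho> x = restrict (act \<theta> (word_of x)) {..<m k}" for x
    have "inj_on \<rho> (r ` conj_words {..k})"
    proof (rule inj_onI, clarify)
      fix u w assume uw: "u \<in> conj_words {..k}" "w \<in> conj_words {..k}" "\<rho> (r u) = \<rho> (r w)"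
      have "act \<theta> u x = act \<theta> w x" if "x < m k" for x
        using fun_cong[OF uw(3), of x] that by (simp add: \<rho>_def word_of_r)
      then show "r u = r w" using faithful[OF uw(1,2)] by (simp add: r_eq)
    qed
    moreover have "\<rho> ` r ` conj_words {..k} \<subseteq> F"
      by (auto simp: F_def \<rho>_def invariant PiE_iff split: if_splits)
    moreover have "finite F" by (simp add: F_def finite_PiE)
    moreover have "card F = m k ^ m k" by (simp add: F_def card_funcsetE)
    ultimately show ?thesis by (metis card_inj_on_le inj_on_finite)
  qed
  interpret G: group G by (rule grp)
  have "tower_group G r R"
  proof (unfold_locales)
    show "r (u @ w) = r u \<otimes>\<^bsub>G\<^esub> r w" for u w by (simp add: mult)
    show "range r = carrier G" by (simp add: carrier)
    show "r [(g, s), (g, \<not> s)] = \<one>\<^bsub>G\<^esub>" for g s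
    proof -
      have "act \<theta> [(g, s), (g, \<not> s)] = act \<theta> []"
        using act_inverse_word(1)[of \<theta> "[(g, s)]"] \<theta>(1) by (simp add: fun_eq_iff)
      then show ?thesis by (simp add: one r_eq)
    qed
    show "r [(False, True)] \<noteq> \<one>\<^bsub>G\<^esub>"
    proof -
      have "act \<theta> [(False, True)] = \<theta> False" by (simp add: fun_eq_iff act_letter_def)
      moreover have "act \<theta> [] = id" by (simp add: fun_eq_iff)
      ultimately show ?thesis using \<theta>(2) by (simp add: one r_eq)
    qed
    show "finite (r ` conj_words {..k})" for k using card_window by blast
    show "k + 2 \<le> R k" for k by (rule large)
    show "r (syllables ps) \<notin> r ` conj_words {..k}"
      if ps: "ps \<noteq> []" "length ps \<le> R k" "fst ` set ps \<subseteq> conj_words {..k}"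
        "nonbacktracking (\<lambda>e. {u. r u \<in> r ` conj_words (assoc_index k e)}) ps" for ps k
    proof
      assume "r (syllables ps) \<in> r ` conj_words {..k}"
      then obtain w where w: "w \<in> conj_words {..k}" "act \<theta> (syllables ps) = act \<theta> w" by (auto simp: r_eq)
      have "act \<theta> (syllables ps @ inverse_word w) = id"
        using act_inverse_word(1)[of \<theta> w] \<theta>(1) w(2) by (simp add: fun_eq_iff)
      with nontrivial[OF conj_words_inverse_word[OF w(1)] ps(1-3)] ps(4) show False by (simp add: image_iff)
    qed
  qed
  with card_window that show thesis by blast
qed

definition words_upto :: "nat \<Rightarrow> nat" where
  "words_upto c = card {w :: word. length w \<le> c}"

lemma words_upto_mono: "c \<le> d \<Longrightarrow> words_upto c \<le> words_upto d"
  unfolding words_upto_def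
  by (rule card_mono) (use finite_lists_length_le[of "UNIV :: (bool \<times> bool) set" d] in auto)

theorem theorem1p4:
  fixes \<rho> :: "nat \<Rightarrow> nat"
  assumes "mono \<rho>"
    and "\<forall>B. \<exists>n. \<rho> n > B"
  shows "\<exists>G :: nat monoid. finitely_generated_group G \<and>
           (\<forall>S. finite_generating_set G S \<longrightarrow>
              \<not> growth_equiv (\<lambda>n. 1) (sep (cayley_graph G S)) \<and>
              \<not> growth_le \<rho> (sep (cayley_graph G S)))"
proof -
  \<comment> \<open>at stage \<open>k\<close>, constants and word lengths up to \<open>k\<close> are taken care of; \<open>M ^ M\<close> bounds the order of \<open>H k\<close>\<close>
  define bound where "bound k M = k * (M ^ M * words_upto k) + k" for k M
  define scale where "scale k M = (SOME n. \<rho> n > bound k M)" for k M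
  have scale: "\<rho> (scale k M) > bound k M" for k M
    unfolding scale_def by (rule someI_ex) (use assms(2) in blast)
  define R where "R k M = 2 * (k * (k * scale k M + k)\<^sup>2 + k) + 2 + k" for k M
  obtain \<theta> :: "bool \<Rightarrow> nat \<Rightarrow> nat" and m where tower: "(\<forall>g. bij (\<theta> g)) \<and> \<theta> False \<noteq> id \<and>
    (\<forall>k w. \<forall>x<m k. act \<theta> w x < m k) \<and>
    (\<forall>k. \<forall>w \<in> conj_words {..k}. \<forall>w' \<in> conj_words {..k}. (\<forall>x<m k. act \<theta> w x = act \<theta> w' x) \<longrightarrow> act \<theta> w = act \<theta> w') \<and>
    (\<forall>k ps. \<forall>w \<in> conj_words {..k}. ps \<noteq> [] \<longrightarrow> length ps \<le> R k (m k) \<longrightarrow> fst ` set ps \<subseteq> conj_words {..k} \<longrightarrow>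
       nonbacktracking (\<lambda>e. {u. act \<theta> u \<in> act \<theta> ` conj_words (assoc_index k e)}) ps \<longrightarrow>
       act \<theta> (syllables ps @ w) \<noteq> id)"
    using tower_exists[of R] by (elim exE)
  obtain G :: "nat monoid" and r where G: "tower_group G r (\<lambda>k. R k (m k))"
    and card_window: "\<And>k. card (r ` conj_words {..k}) \<le> m k ^ m k"
  proof (rule nat_group_of_tower[where \<theta> = \<theta> and m = m and R = "\<lambda>k. R k (m k)"])
    show "k + 2 \<le> R k (m k)" for k by (simp add: R_def)
  qed (use tower in blast)+
  interpret tower_group G r "\<lambda>k. R k (m k)" by (rule G)
  have "finite_generating_set G (range (\<lambda>l. r [l]))"
  proof -
    have "r w \<in> generate G (range (\<lambda>l. r [l]))" for w
    proof (induction w)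
      case (Cons l w)
      then show ?case using r_append[of "[l]" w] by (auto intro: generate.eng generate.incl)
    qed (auto simp: r_Nil intro: generate.one)
    then have "carrier G \<subseteq> generate G (range (\<lambda>l. r [l]))" unfolding r_surj[symmetric] by blast
    moreover have "generate G (range (\<lambda>l. r [l])) \<subseteq> carrier G" by (rule generate_incl) auto
    ultimately show ?thesis by (auto simp: finite_generating_set_def)
  qed
  then have "finitely_generated_group G"
    using is_group by (auto simp: finitely_generated_group_def)
  moreover have "\<not> growth_equiv (\<lambda>n. 1) (sep (cayley_graph G S))" if "finite_generating_set G S" for S
  proof
    assume "growth_equiv (\<lambda>n. 1) (sep (cayley_graph G S))"
    then obtain C where "\<And>n. sep (cayley_graph G S) n \<le> C * 1 + C"
      by (auto simp: growth_equiv_def growth_le_def)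
    with sep_unbounded[OF that, of "C * 1 + C"] show False by (meson leD)
  qed
  moreover have "\<not> growth_le \<rho> (sep (cayley_graph G S))" if gen: "finite_generating_set G S" for S
  proof
    assume "growth_le \<rho> (sep (cayley_graph G S))"
    then obtain C where C: "\<And>n. \<rho> n \<le> C * sep (cayley_graph G S) (C * n + C) + C"
      by (auto simp: growth_le_def)
    have S: "finite S" "S \<subseteq> carrier G" using gen by (auto simp: finite_generating_set_def)
    obtain c where c: "\<And>s. s \<in> S \<Longrightarrow> \<exists>w. length w \<le> c \<and> s = r w"
      using finite_word_length[OF S] by blast
    define k where "k = max C c"
    define M where "M = m k"
    define n where "n = scale k M"
    have "sep (cayley_graph G S) (C * n + C) \<le> card (H k) * card {w :: word. length w \<le> c}"
    proof (rule sep_upper_bound[OF S(2) c])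
      have "(C * n + C)\<^sup>2 \<le> (k * n + k)\<^sup>2"
        by (intro power_mono add_mono mult_le_mono1) (auto simp: k_def)
      then have "c * (C * n + C)\<^sup>2 \<le> k * (k * n + k)\<^sup>2"
        by (intro mult_le_mono) (auto simp: k_def)
      moreover have "2 * (a + c) + 1 \<le> 2 * (b + k) + 2 + k" if "a \<le> b" for a b
        using that by (simp add: k_def)
      ultimately show "2 * (c * (C * n + C)\<^sup>2 + c) + 1 \<le> R k (m k)"
        unfolding R_def M_def[symmetric] n_def[symmetric] by blast
    qed
    also have "\<dots> \<le> M ^ M * words_upto k"
      using card_window[of k] words_upto_mono[of c k]
      by (intro mult_le_mono) (auto simp: H_def M_def k_def words_upto_def)
    finally have sep: "sep (cayley_graph G S) (C * n + C) \<le> M ^ M * words_upto k" .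
    have "\<rho> n \<le> C * sep (cayley_graph G S) (C * n + C) + C" by (rule C)
    also have "\<dots> \<le> k * (M ^ M * words_upto k) + k"
      using sep by (intro add_mono mult_le_mono) (auto simp: k_def)
    also have "\<dots> < \<rho> n" using scale[of k M] by (simp add: bound_def n_def)
    finally show False by simp
  qed
  ultimately show ?thesis by blast
qed

end
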